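(* Let $N$ be a prime such that $N-1$ is divisible by $12$ and put $n=\frac{N-1}{12}$. Let $f_1,\dots,f_{n-1}$ be the normalized Hecke eigenforms forming a basis of $S_2(\Gamma_0(N))$, and let $a_m(f_i)$ denote the $m$-th Fourier coefficient of $f_i$. Let $p\neq N$ be a prime such that $1+p$ is a multiple of $n$. Then the product of $p$-th coefficients $$\mu_N(p):=\prod_{i=1}^{n-1}a_p(f_i)$$ is divisible by $n$.
   Context: $S_2(\Gamma_0(N))$ is the space of cusp forms of weight $2$ for the Hecke congruence subgroup $\Gamma_0(N)\subset \mathrm{SL}_2(\mathbb{Z})$ of matrices whose lower left entry is divisible by $N$. When $N$ is prime and $12\mid N-1$, its dimension is $n-1$ with $n=\frac{N-1}{12}$, and it has a basis $\{f_1,\dots,f_{n-1}\}$ of normalized Hecke eigenforms, with Fourier expansions $f_i=\sum_{m\ge1}a_m(f_i)q^m$, $q=e^{2\pi i z}$, $\mathrm{Im}\,z>0$, where $a_1(f_i)=1$. Divisibility is in $\mathbb{Z}$. *)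

theory Defs
  imports
    "HOL-Complex_Analysis.Complex_Analysis"
    "HOL-Library.Function_Algebras"
begin

definition upper_half_plane :: "complex set" where
  "upper_half_plane = {z. Im z > 0}"

definition SL2Z :: "(int ^ 2 ^ 2) set" where
  "SL2Z = {A. det A = 1}"

definition Gamma0 :: "nat \<Rightarrow> (int ^ 2 ^ 2) set" where
  "Gamma0 N = {A \<in> SL2Z. int N dvd A $ 2 $ 1}"

definition slash :: "int \<Rightarrow> (complex \<Rightarrow> complex) \<Rightarrow> int ^ 2 ^ 2 \<Rightarrow> complex \<Rightarrow> complex" where
  "slash k f A z =
     (of_int (A $ 2 $ 1) * z + of_int (A $ 2 $ 2)) powi (- k) *
     f ((of_int (A $ 1 $ 1) * z + of_int (A $ 1 $ 2)) /
        (of_int (A $ 2 $ 1) * z + of_int (A $ 2 $ 2)))"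

text \<open>
  Functions on the upper half plane are represented by total functions that vanish off it, so
  that equality, linear combinations and spans are those of the function space itself.
  The last condition is vanishing at every cusp: for every \<open>A\<close> in \<open>SL2Z\<close>, the function
  \<open>slash k f A\<close> is invariant under translation by \<open>N\<close>, and its expansion in powers of
  \<open>exp (2 \<pi> i z / N)\<close> has only terms with positive exponent. (The width of the cusp divides
  \<open>N\<close>; if it is smaller, the superfluous coefficients are 0.)
\<close>
definition cusp_forms :: "int \<Rightarrow> nat \<Rightarrow> (complex \<Rightarrow> complex) set" where
  "cusp_forms k N = {f.
     (\<forall>z. z \<notin> upper_half_plane \<longrightarrow> f z = 0) \<and>
     f holomorphic_on upper_half_plane \<and>
     (\<forall>A\<in>Gamma0 N. \<forall>z\<in>upper_half_plane. slash k f A z = f z) \<and>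
     (\<forall>A\<in>SL2Z. \<exists>b :: nat \<Rightarrow> complex. b 0 = 0 \<and>
        (\<forall>z\<in>upper_half_plane.
           (\<lambda>m. b m * exp (2 * of_real pi * \<i> * z / of_nat N) ^ m) sums slash k f A z))}"

definition has_q_expansion :: "(complex \<Rightarrow> complex) \<Rightarrow> (nat \<Rightarrow> complex) \<Rightarrow> bool" where
  "has_q_expansion f a \<longleftrightarrow>
     (\<forall>z\<in>upper_half_plane. (\<lambda>m. a m * exp (2 * of_real pi * \<i> * z) ^ m) sums f z)"

lemma has_q_expansion_unique:
  assumes "has_q_expansion f a" "has_q_expansion f b"
  shows "a = b"
proof -
  let ?c = "\<lambda>m. a m - b m"
  have punctured: "(\<lambda>m. ?c m * w ^ m) sums 0" if "w \<noteq> 0" "norm w < 1" for w :: complex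
  proof -
    define z where "z = Ln w / (2 * of_real pi * \<i>)"
    have "Im z = - ln (norm w) / (2 * pi)"
      using that(1) by (simp add: z_def Im_divide power2_eq_square)
    hence "z \<in> upper_half_plane"
      using that by (simp add: upper_half_plane_def divide_neg_pos)
    moreover have "w = exp (2 * of_real pi * \<i> * z)"
      using that(1) by (simp add: z_def)
    ultimately have "(\<lambda>m. a m * w ^ m) sums f z" "(\<lambda>m. b m * w ^ m) sums f z"
      using assms by (auto simp: has_q_expansion_def)
    from sums_diff[OF this] show ?thesis by (simp add: left_diff_distrib)
  qed
  have "((\<lambda>_ :: complex. 0) \<longlongrightarrow> ?c 0) (at 0)"
    using punctured by (intro powser_limit_0_strong[of 1 ?c]) auto
  hence c0: "?c 0 = 0"
    by (simp add: tendsto_const_iff)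
  have sums0: "(\<lambda>m. ?c m * (w - 0) ^ m) sums 0" if "norm (w - 0) < 1" for w :: complex
    using that punctured[of w] powser_sums_zero[of ?c] c0 by (cases "w = 0") auto
  have "?c m = 0" for m
  proof (rule ccontr)
    assume "?c m \<noteq> 0"
    moreover from this c0 have "m > 0" by (cases m) auto
    ultimately obtain s :: real where "s > 0" "\<And>z::complex. z \<in> cball 0 s - {0} \<Longrightarrow> (0::complex) \<noteq> 0"
      using powser_0_nonzero[of 1 0 ?c "\<lambda>_. 0" m] sums0 by auto
    from this(2)[of "of_real s"] this(1) show False by simp
  qed
  thus ?thesis by (simp add: fun_eq_iff)
qed

definition fourier_coeff :: "(complex \<Rightarrow> complex) \<Rightarrow> nat \<Rightarrow> complex" where
  "fourier_coeff f = (THE a. has_q_expansion f a)"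

lemma fourier_coeff_eqI: "has_q_expansion f a \<Longrightarrow> fourier_coeff f = a"
  unfolding fourier_coeff_def by (blast intro: has_q_expansion_unique the_equality)

text \<open>
  The Hecke operator \<open>T\<^sub>m\<close> on modular forms of weight \<open>k\<close> for \<open>Gamma0 N\<close>:
  \<open>T\<^sub>m f (z) = m\<^bsup>k-1\<^esup> \<Sum> d\<^bsup>-k\<^esup> f ((a z + b) / d)\<close>, where the sum is over \<open>a d = m\<close> with
  \<open>gcd(a, N) = 1\<close> and \<open>0 \<le> b < d\<close>. For a prime \<open>m\<close> dividing \<open>N\<close> this is the operator
  usually called \<open>U\<^sub>m\<close>.
\<close>
definition hecke :: "int \<Rightarrow> nat \<Rightarrow> nat \<Rightarrow> (complex \<Rightarrow> complex) \<Rightarrow> complex \<Rightarrow> complex" where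
  "hecke k N m f z = of_nat m powi (k - 1) *
     (\<Sum>d | d dvd m \<and> coprime (m div d) N. of_nat d powi (- k) *
       (\<Sum>b<d. f ((of_nat (m div d) * z + of_nat b) / of_nat d)))"

definition fun_scale :: "complex \<Rightarrow> (complex \<Rightarrow> complex) \<Rightarrow> complex \<Rightarrow> complex" where
  "fun_scale c f = (\<lambda>z. c * f z)"

global_interpretation cfun: vector_space fun_scale
  by unfold_locales (auto simp: fun_scale_def fun_eq_iff algebra_simps)

definition hecke_eigenform :: "int \<Rightarrow> nat \<Rightarrow> (complex \<Rightarrow> complex) \<Rightarrow> bool" where
  "hecke_eigenform k N f \<longleftrightarrow> f \<in> cusp_forms k N \<and> f \<noteq> 0 \<and>
     (\<forall>m\<ge>1. \<exists>c. hecke k N m f = fun_scale c f)"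

definition normalized_hecke_eigenform :: "int \<Rightarrow> nat \<Rightarrow> (complex \<Rightarrow> complex) \<Rightarrow> bool" where
  "normalized_hecke_eigenform k N f \<longleftrightarrow> hecke_eigenform k N f \<and> fourier_coeff f 1 = 1"

end

theory Submission
  imports Defs "HOL-Number_Theory.Number_Theory" "Jordan_Normal_Form.Determinant"
begin

text \<open>
  Write \<open>N = 12 n + 1\<close>. The product of the \<open>a\<^sub>p(f\<^sub>i)\<close> is the determinant of an integer matrix,
  and an explicit integer vector with an entry congruent to 1 modulo \<open>n\<close> is mapped by this matrix
  to a multiple of \<open>n\<close>; multiplying by the adjugate matrix gives the theorem
  (\<open>det_eigenvalues_divisible\<close>). Matrix and vector come from modular symbols.

  \<^bold>\<open>Periods.\<close> A primitive \<open>F\<close> of a cusp form \<open>f\<close> of weight 2, normalized to vanish at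
  infinity, has a limit at every rational number. The resulting function \<open>c\<close> on the cusps
  changes only by an additive constant under an element of \<open>Gamma0 N\<close>, and \<open>T\<^sub>p\<close> acts on it by
  \<open>c(p x) + \<Sum>\<^sub>b c((x + b) / p)\<close>. Already its even part \<open>c(x) + c(-x)\<close> determines \<open>f\<close>: if that
  vanished at the cusps equivalent to infinity, then \<open>F(z) + F(-cnj z)\<close> would be a harmonic
  function invariant under \<open>Gamma0 N\<close> that extends to the cusps, hence constant by the
  maximum principle (\<open>even_boundary_value_zero\<close>).

  \<^bold>\<open>Symbols.\<close> For an even \<open>c\<close> the numbers \<open>y(t) = c(1/t) - c(0)\<close> depend only on \<open>t\<close> modulo \<open>N\<close>
  and satisfy \<open>y(-t) = y(t)\<close>, \<open>y(1/t) = -y(t)\<close> and the three-term relation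
  \<open>y(t) - y(t - 1) + y((t - 1)/t) = 0\<close> (\<open>manin_symbol_of\<close>). Conversely a solution of these
  relations is integrated to a function on the cusps by Euclid's algorithm (\<open>cusp_fn_edge\<close>), so
  \<open>T\<^sub>p\<close> can be written down for symbols, with integer coefficients.

  \<^bold>\<open>Counting.\<close> The functions with the two symmetries that vanish at the primitive cube roots of
  unity form a lattice of rank \<open>3 n - 2\<close>, in which a function is given by its values at the powers
  \<open>w\<^sup>k\<close> of a primitive root with \<open>0 < k < 3 n\<close>, \<open>k \<noteq> 2 n\<close>. The three-term relations
  are indexed by the orbits of \<open>t \<mapsto> 1/t\<close> and \<open>t \<mapsto> 1 - t\<close>, and at least
  \<open>2 n - 1\<close> of them are not automatic. For each of these orbits \<open>path_sym\<close> is an integral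
  function that violates exactly this relation. Subtracting such functions defines an integral
  projection \<open>proj\<close> onto the solutions (\<open>manin_proj\<close>). The operator \<open>T\<^sub>p \<circ> proj + (1 - proj)\<close>
  is therefore an integer matrix of size \<open>3 n - 2\<close>; it has the \<open>n - 1\<close> symbols of the
  eigenforms as eigenvectors with eigenvalues \<open>a\<^sub>p(f\<^sub>i)\<close>, and \<open>2 n - 1\<close> path
  symbols with eigenvalue 1. Together they are linearly independent, so the determinant is the
  product of the \<open>a\<^sub>p(f\<^sub>i)\<close>.

  \<^bold>\<open>Congruence.\<close> Modulo \<open>n\<close> the discrete logarithm satisfies all the relations; it is the
  symbol of the homomorphism from \<open>Gamma0 N\<close> to \<open>\<int>/n\<close> that sends a matrix to the logarithm
  of its lower right entry (the Shimura covering). Because its function on the cusps is given by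
  logarithms of numerators and denominators, \<open>T\<^sub>p\<close> multiplies it, up to a constant, by \<open>1 + p\<close>, which is 0
  modulo \<open>n\<close> (\<open>hecke_cusps_log_lift\<close>). Projecting an integral lift gives an exact solution
  \<open>log_lift\<close> of the relations with value 1 modulo \<open>n\<close> at \<open>w\<close>, and this is the required vector.
\<close>

section \<open>Determinants and eigenvectors\<close>

text \<open>
  The eigenvectors in the columns of \<open>B\<close> are independent, so \<open>B\<close> is invertible and the determinant
  of \<open>X\<close> is the product of the eigenvalues. The divisibility follows by applying the adjugate
  of \<open>X\<close> to the vector \<open>X v\<close>.
\<close>
lemma det_eigenvalues_divisible:
  fixes X :: "nat \<Rightarrow> nat \<Rightarrow> int" and B :: "nat \<Rightarrow> nat \<Rightarrow> complex" and d :: "nat \<Rightarrow> complex"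
    and v :: "nat \<Rightarrow> int" and m :: int
  assumes eigen: "\<And>i j. i < r \<Longrightarrow> j < r \<Longrightarrow> (\<Sum>l<r. of_int (X i l) * B l j) = d j * B i j"
    and indep: "\<And>x j. (\<And>i. i < r \<Longrightarrow> (\<Sum>j<r. B i j * x j) = 0) \<Longrightarrow> j < r \<Longrightarrow> x j = 0"
    and cong: "\<And>i. i < r \<Longrightarrow> m dvd (\<Sum>l<r. X i l * v l)"
  shows "\<exists>\<mu>. (\<Prod>j<r. d j) = of_int \<mu> \<and> (\<forall>i<r. m dvd \<mu> * v i)"
proof -
  define XM where "XM = Matrix.mat r r (\<lambda>(i,j). X i j)"
  define BM where "BM = Matrix.mat r r (\<lambda>(i,j). B i j)"
  define DM where "DM = Matrix.mat r r (\<lambda>(i,j). if i = j then d j else 0)"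
  define XC where "XC = map_mat (of_int :: int \<Rightarrow> complex) XM"
  have carr [simp]: "XM \<in> carrier_mat r r" "BM \<in> carrier_mat r r" "DM \<in> carrier_mat r r"
    "XC \<in> carrier_mat r r"
    by (auto simp: XM_def BM_def DM_def XC_def)
  have "XC * BM = BM * DM"
  proof (rule eq_matI)
    fix i j assume ij: "i < dim_row (BM * DM)" "j < dim_col (BM * DM)"
    hence ij': "i < r" "j < r" by (auto simp: BM_def DM_def)
    have "(XC * BM) $$ (i,j) = (\<Sum>l<r. of_int (X i l) * B l j)"
      using ij' by (simp add: XC_def XM_def BM_def scalar_prod_def lessThan_atLeast0)
    also have "\<dots> = d j * B i j" by (rule eigen[OF ij'])
    also have "\<dots> = (\<Sum>l<r. B i l * (if l = j then d j else 0))"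
      using ij' by (simp add: sum.delta if_distrib cong: if_cong)
    also have "\<dots> = (BM * DM) $$ (i,j)"
      using ij' by (simp add: DM_def BM_def scalar_prod_def lessThan_atLeast0)
    finally show "(XC * BM) $$ (i,j) = (BM * DM) $$ (i,j)" .
  qed (auto simp: XC_def XM_def BM_def DM_def)
  hence "Determinant.det XC * Determinant.det BM = Determinant.det BM * Determinant.det DM"
    by (metis carr(2,3,4) det_mult)
  moreover have "Determinant.det BM \<noteq> 0"
  proof
    assume "Determinant.det BM = 0"
    then obtain x where x: "x \<in> carrier_vec r" "x \<noteq> 0\<^sub>v r" "BM *\<^sub>v x = 0\<^sub>v r"
      using det_0_iff_vec_prod_zero[OF carr(2)] by auto
    have eq: "(\<Sum>j<r. B i j * vec_index x j) = 0" if "i < r" for i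
    proof -
      have "vec_index (BM *\<^sub>v x) i = (\<Sum>j<r. B i j * vec_index x j)"
        using that x(1) by (simp add: BM_def scalar_prod_def lessThan_atLeast0)
      thus ?thesis using x(3) that by simp
    qed
    have "vec_index x j = 0" if "j < r" for j
      using indep[of "\<lambda>j. vec_index x j", OF eq that] .
    hence "x = 0\<^sub>v r" using x(1) by (intro eq_vecI) auto
    with x(2) show False ..
  qed
  ultimately have "Determinant.det XC = Determinant.det DM" by simp
  moreover have "Determinant.det DM = (\<Prod>j<r. d j)"
  proof -
    have "upper_triangular DM" by (auto simp: DM_def)
    hence "Determinant.det DM = prod_list (diag_mat DM)" by (rule det_upper_triangular[OF _ carr(3)])
    also have "diag_mat DM = map d [0..<r]" by (auto simp: diag_mat_def DM_def)
    also have "prod_list \<dots> = (\<Prod>j<r. d j)"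
      by (simp add: prod.distinct_set_conv_list[symmetric] lessThan_atLeast0)
    finally show ?thesis .
  qed
  moreover have "Determinant.det XC = of_int (Determinant.det XM)"
    unfolding XC_def by (rule of_int_hom.hom_det)
  ultimately have det: "(\<Prod>j<r. d j) = of_int (Determinant.det XM)" by simp
  have "m dvd Determinant.det XM * v i" if i: "i < r" for i
  proof -
    define V where "V = Matrix.vec r v"
    have V: "V \<in> carrier_vec r" by (simp add: V_def)
    have adj: "adj_mat XM \<in> carrier_mat r r" "adj_mat XM * XM = Determinant.det XM \<cdot>\<^sub>m 1\<^sub>m r"
      using adj_mat[OF carr(1)] by auto
    have "adj_mat XM *\<^sub>v (XM *\<^sub>v V) = (adj_mat XM * XM) *\<^sub>v V"
      using assoc_mult_mat_vec[OF adj(1) carr(1) V] by simp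
    also have "\<dots> = Determinant.det XM \<cdot>\<^sub>v V"
      unfolding adj(2) using V by auto
    finally have "Determinant.det XM * v i = vec_index (adj_mat XM *\<^sub>v (XM *\<^sub>v V)) i"
      using i V by (simp add: V_def)
    also have "\<dots> = (\<Sum>j<r. adj_mat XM $$ (i,j) * vec_index (XM *\<^sub>v V) j)"
    proof -
      have U: "U \<in> carrier_vec r \<Longrightarrow> vec_index (adj_mat XM *\<^sub>v U) i = (\<Sum>j<r. adj_mat XM $$ (i,j) * vec_index U j)" for U
        using i adj(1) by (auto simp: scalar_prod_def lessThan_atLeast0 intro!: sum.cong)
      show ?thesis by (rule U) (rule mult_mat_vec_carrier[OF carr(1) V])
    qed
    also have "m dvd \<dots>"
    proof (rule dvd_sum)
      fix j assume "j \<in> {..<r}"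
      hence "vec_index (XM *\<^sub>v V) j = (\<Sum>l<r. X j l * v l)"
        by (simp add: XM_def V_def scalar_prod_def lessThan_atLeast0)
      thus "m dvd adj_mat XM $$ (i,j) * vec_index (XM *\<^sub>v V) j"
        using cong[of j] \<open>j \<in> {..<r}\<close> by simp
    qed
    finally show ?thesis .
  qed
  with det show ?thesis by blast
qed

section \<open>Primitives of cusp forms\<close>

abbreviation \<H> :: "complex set" where "\<H> \<equiv> upper_half_plane"

definition mob :: "int \<Rightarrow> int \<Rightarrow> int \<Rightarrow> int \<Rightarrow> complex \<Rightarrow> complex" where
  "mob a b c d z = (of_int a * z + of_int b) / (of_int c * z + of_int d)"

definition nome :: "nat \<Rightarrow> complex \<Rightarrow> complex" where
  "nome N z = exp (2 * of_real pi * \<i> * z / of_nat N)"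

lemma in_uhp_iff: "z \<in> \<H> \<longleftrightarrow> Im z > 0"
  by (simp add: upper_half_plane_def)

lemma open_uhp: "open \<H>"
  by (simp add: upper_half_plane_def open_halfspace_Im_gt)

lemma convex_uhp: "convex \<H>"
  using convex_halfspace_Im_gt[of 0] by (simp add: upper_half_plane_def)

lemma mob_denom_nonzero:
  assumes "a * d - b * c = (1::int)" "z \<in> \<H>"
  shows "of_int c * z + of_int d \<noteq> 0"
proof
  assume eq: "of_int c * z + of_int d = 0"
  have "of_int c * Im z = 0" using arg_cong[OF eq, of Im] by simp
  hence "c = 0" using assms(2) by (simp add: in_uhp_iff)
  with eq assms(1) show False by simp
qed

lemma Im_mob:
  assumes "a * d - b * c = (1::int)"
  shows "Im (mob a b c d z) = Im z / (norm (of_int c * z + of_int d))\<^sup>2"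
proof -
  have "(of_int a * Im z) * (of_int c * Re z + of_int d) - (of_int a * Re z + of_int b) * (of_int c * Im z)
      = of_int (a * d - b * c) * Im z"
    by (simp add: algebra_simps)
  thus ?thesis using assms
    by (simp add: mob_def Im_divide cmod_power2)
qed

lemma mob_in_uhp:
  assumes "a * d - b * c = (1::int)" "z \<in> \<H>"
  shows "mob a b c d z \<in> \<H>"
  using Im_mob[OF assms(1), of z] mob_denom_nonzero[OF assms] assms(2)
  by (simp add: in_uhp_iff)

lemma mob_mob:
  assumes "a' * d' - b' * c' = (1::int)" "z \<in> \<H>"
  shows "mob a b c d (mob a' b' c' d' z) =
    mob (a * a' + b * c') (a * b' + b * d') (c * a' + d * c') (c * b' + d * d') z"
proof -
  have nz: "of_int c' * z + of_int d' \<noteq> 0" by (rule mob_denom_nonzero[OF assms])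
  let ?u = "of_int a' * z + of_int b'" and ?v = "of_int c' * z + of_int d' :: complex"
  have "mob a b c d (mob a' b' c' d' z) = (of_int a * ?u + of_int b * ?v) / (of_int c * ?u + of_int d * ?v)"
    using nz unfolding mob_def by (simp add: divide_simps)
  thus ?thesis by (simp add: mob_def algebra_simps)
qed

lemma mob_id: "mob 1 0 0 1 z = z"
  by (simp add: mob_def)

lemma mob_inverse:
  assumes "a * d - b * c = (1::int)" "z \<in> \<H>"
  shows "mob a b c d (mob d (-b) (-c) a z) = z"
proof -
  have "d * a - (-b) * (-c) = 1" using assms(1) by (simp add: algebra_simps)
  from mob_mob[OF this assms(2), of a b c d] show ?thesis
    using assms(1) by (simp add: algebra_simps mob_id)
qed

lemma has_field_derivative_mob:
  assumes "a * d - b * c = (1::int)" "z \<in> \<H>"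
  shows "(mob a b c d has_field_derivative (of_int c * z + of_int d) powi (-2)) (at z)"
proof -
  have nz: "of_int c * z + of_int d \<noteq> 0" by (rule mob_denom_nonzero[OF assms])
  have "of_int (a * d - b * c) = (1::complex)" using assms(1) by simp
  hence det: "of_int a * of_int d = (1 + of_int b * of_int c :: complex)" by (simp add: algebra_simps)
  have "((\<lambda>z. (of_int a * z + of_int b) / (of_int c * z + of_int d)) has_field_derivative
     (of_int a * (of_int c * z + of_int d) - (of_int a * z + of_int b) * of_int c) / ((of_int c * z + of_int d) * (of_int c * z + of_int d))) (at z)"
    using nz by (auto intro!: derivative_eq_intros)
  also have "of_int a * (of_int c * z + of_int d) - (of_int a * z + of_int b) * of_int c = 1"
    using det by (simp add: algebra_simps)
  also have "1 / ((of_int c * z + of_int d) * (of_int c * z + of_int d)) = (of_int c * z + of_int d) powi (-2)"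
    by (simp add: power_int_minus power2_eq_square field_simps)
  finally show ?thesis by (simp add: mob_def[abs_def])
qed

lemma has_field_derivative_nome:
  assumes "N > 0"
  shows "(nome N has_field_derivative (2 * of_real pi * \<i> / of_nat N) * nome N z) (at z)"
  unfolding nome_def[abs_def] using assms by (auto intro!: derivative_eq_intros)

lemma norm_nome: "norm (nome N z) = exp (- 2 * pi * Im z / real N)"
  by (simp add: nome_def)

lemma nome_in_ball: "N > 0 \<Longrightarrow> z \<in> \<H> \<Longrightarrow> nome N z \<in> ball 0 1"
  by (simp add: norm_nome in_uhp_iff)

lemma ex_nome:
  assumes "N > 0" "q \<noteq> 0" "norm q < 1"
  shows "\<exists>z\<in>\<H>. nome N z = q"
proof -
  define z where "z = of_nat N * Ln q / (2 * of_real pi * \<i>)"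
  have "Im z = - (real N * ln (norm q)) / (2 * pi)"
    using assms(2) by (simp add: z_def Im_divide power2_eq_square)
  moreover have "ln (norm q) < 0" using assms by simp
  ultimately have "Im z > 0" using assms(1) by (simp add: divide_neg_pos mult_pos_neg)
  moreover have "nome N z = q" using assms by (simp add: nome_def z_def)
  ultimately show ?thesis by (auto simp: in_uhp_iff)
qed

lemma SL2Z_matrix:
  assumes "a * d - b * c = (1::int)"
  shows "vector [vector [a, b], vector [c, d]] \<in> SL2Z"
  using assms by (simp add: SL2Z_def det_2 vector_2)

lemma slash_matrix:
  "slash k f (vector [vector [a, b], vector [c, d]]) z =
     (of_int c * z + of_int d) powi (-k) * f (mob a b c d z)"
  by (simp add: slash_def mob_def vector_2)

lemma cusp_form_invariant:
  assumes "f \<in> cusp_forms k N" "a * d - b * c = (1::int)" "int N dvd c" "z \<in> \<H>"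
  shows "(of_int c * z + of_int d) powi (-k) * f (mob a b c d z) = f z"
proof -
  have "vector [vector [a, b], vector [c, d]] \<in> Gamma0 N"
    using SL2Z_matrix[OF assms(2)] assms(3) by (simp add: Gamma0_def vector_2)
  thus ?thesis using assms unfolding cusp_forms_def slash_matrix[symmetric] by blast
qed

lemma constant_on_uhp:
  assumes "\<And>z. z \<in> \<H> \<Longrightarrow> (f has_field_derivative g z) (at z)"
      and "\<And>z. z \<in> \<H> \<Longrightarrow> (h has_field_derivative g z) (at z)"
  obtains \<kappa> where "\<And>z. z \<in> \<H> \<Longrightarrow> f z = h z + \<kappa>"
proof -
  have "((\<lambda>z. f z - h z) has_field_derivative 0) (at z within \<H>)" if "z \<in> \<H>" for z
    using DERIV_diff[OF assms[OF that]] by (simp add: has_field_derivative_at_within)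
  then obtain \<kappa> where "\<And>z. z \<in> \<H> \<Longrightarrow> f z - h z = \<kappa>"
    using has_field_derivative_zero_constant[OF convex_uhp, of "\<lambda>z. f z - h z"] by blast
  with that[of \<kappa>] show ?thesis by (metis diff_add_cancel add.commute)
qed

text \<open>
  In the coordinate \<open>q = nome N z\<close> a primitive of the form \<open>h(q)\<close> has derivative proportional to
  \<open>h(q)/q\<close>. As the expansion of a cusp form at any cusp has no constant term, this quotient is
  holomorphic on the whole disc, and so is its primitive.
\<close>
lemma slash_primitive:
  assumes f: "f \<in> cusp_forms 2 N" and N: "N > 0" and det: "a * d - b * c = (1::int)"
  obtains k where "k holomorphic_on ball 0 1"
    "\<And>z. z \<in> \<H> \<Longrightarrow> ((\<lambda>z. k (nome N z)) has_field_derivative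
        (of_int c * z + of_int d) powi (-2) * f (mob a b c d z)) (at z)"
proof -
  have "\<exists>u :: nat \<Rightarrow> complex. u 0 = 0 \<and> (\<forall>z\<in>\<H>. (\<lambda>m. u m * exp (2 * of_real pi * \<i> * z / of_nat N) ^ m) sums
     slash 2 f (vector [vector [a, b], vector [c, d]]) z)"
    using f SL2Z_matrix[OF det] unfolding cusp_forms_def by blast
  then obtain u where u: "u 0 = 0"
    "\<And>z. z \<in> \<H> \<Longrightarrow> (\<lambda>m. u m * nome N z ^ m) sums ((of_int c * z + of_int d) powi (-2) * f (mob a b c d z))"
    unfolding slash_matrix nome_def[symmetric] by blast
  define g where "g = (\<lambda>q. \<Sum>m. u (Suc m) * q ^ m)"
  have g: "(\<lambda>m. u (Suc m) * q ^ m) sums g q" if q: "norm q < 1" for q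
  proof (cases "q = 0")
    case True
    have "(\<lambda>m. u (Suc m) * 0 ^ m) sums u (Suc 0)" by (rule powser_sums_zero)
    with True show ?thesis by (auto simp: g_def sums_iff)
  next
    case False
    from ex_nome[OF N this q] obtain z where z: "z \<in> \<H>" "nome N z = q" by blast
    from sums_summable[OF u(2)[OF z(1)]] have "summable (\<lambda>m. u (Suc m) * q ^ Suc m)"
      using z(2) by (subst summable_Suc_iff[of "\<lambda>m. u m * q ^ m"]) simp
    hence "summable (\<lambda>m. (u (Suc m) * q ^ Suc m) / q)" by (rule summable_divide)
    hence "summable (\<lambda>m. u (Suc m) * q ^ m)" using False by simp
    thus ?thesis by (simp add: g_def summable_sums)
  qed
  have "g holomorphic_on ball 0 1"
    by (rule power_series_holomorphic[of 0 1 "\<lambda>m. u (Suc m)"]) (use g in auto)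
  hence "(\<lambda>q. of_nat N / (2 * of_real pi * \<i>) * g q) holomorphic_on ball 0 1"
    by (intro holomorphic_intros)
  from holomorphic_convex_primitive'[OF convex_ball open_ball this] obtain k where
    k: "\<And>q. q \<in> ball 0 1 \<Longrightarrow> (k has_field_derivative of_nat N / (2 * of_real pi * \<i>) * g q) (at q within ball 0 1)"
    by auto
  show ?thesis
  proof (rule that[of k])
    show "k holomorphic_on ball 0 1"
      unfolding holomorphic_on_def field_differentiable_def using k by blast
    fix z assume z: "z \<in> \<H>"
    let ?q = "nome N z"
    have q: "?q \<in> ball 0 1" by (rule nome_in_ball[OF N z])
    hence "(k has_field_derivative of_nat N / (2 * of_real pi * \<i>) * g ?q) (at ?q)"
      using k[OF q] at_within_open[OF q open_ball] by simp
    from DERIV_chain2[OF this has_field_derivative_nome[OF N]]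
    have "((\<lambda>z. k (nome N z)) has_field_derivative g ?q * ?q) (at z)"
      using N by (simp add: field_simps)
    also have "g ?q * ?q = (of_int c * z + of_int d) powi (-2) * f (mob a b c d z)"
    proof -
      from q have "(\<lambda>m. u (Suc m) * ?q ^ m * ?q) sums (g ?q * ?q)"
        by (intro sums_mult2 g) auto
      hence "(\<lambda>m. u (Suc m) * ?q ^ Suc m) sums (g ?q * ?q)" by (simp add: mult_ac)
      hence "(\<lambda>m. u m * ?q ^ m) sums (g ?q * ?q + u 0 * ?q ^ 0)"
        by (subst sums_Suc_iff[symmetric]) (simp add: u(1))
      with u(1) u(2)[OF z] show ?thesis by (simp add: sums_iff)
    qed
    finally show "((\<lambda>z. k (nome N z)) has_field_derivative
        (of_int c * z + of_int d) powi (-2) * f (mob a b c d z)) (at z)" .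
  qed
qed

text \<open>
  The properties of a primitive of a cusp form that are used later on: regularity at every cusp,
  value 0 at infinity, and invariance under \<open>Gamma0 N\<close> up to periods. They are stated without
  reference to the form, so that they are visibly stable under linear combinations.
\<close>
definition cusp_primitive :: "nat \<Rightarrow> (complex \<Rightarrow> complex) \<Rightarrow> bool" where
  "cusp_primitive N F \<longleftrightarrow>
     (\<forall>a b c d. a * d - b * c = 1 \<longrightarrow> (\<exists>k. k holomorphic_on ball 0 1 \<and> (\<forall>z\<in>\<H>. F (mob a b c d z) = k (nome N z)))) \<and>
     (\<exists>k. k holomorphic_on ball 0 1 \<and> k 0 = 0 \<and> (\<forall>z\<in>\<H>. F z = k (nome N z))) \<and>
     (\<forall>a b c d. a * d - b * c = 1 \<longrightarrow> int N dvd c \<longrightarrow> (\<exists>\<kappa>. \<forall>z\<in>\<H>. F (mob a b c d z) = F z + \<kappa>))"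

lemma ex_cusp_primitive:
  assumes f: "f \<in> cusp_forms 2 N" and N: "N > 0"
  obtains F where "cusp_primitive N F" "\<And>z. z \<in> \<H> \<Longrightarrow> (F has_field_derivative f z) (at z)"
proof -
  have "1 * 1 - 0 * 0 = (1::int)" by simp
  from slash_primitive[OF f N this] obtain k where k: "k holomorphic_on ball 0 1"
    "\<And>z. z \<in> \<H> \<Longrightarrow> ((\<lambda>z. k (nome N z)) has_field_derivative f z) (at z)"
    unfolding mob_id by auto
  define F where "F = (\<lambda>z. k (nome N z) - k 0)"
  have F: "(F has_field_derivative f z) (at z)" if "z \<in> \<H>" for z
    unfolding F_def using DERIV_diff[OF k(2)[OF that] DERIV_const] by simp
  have FA: "((\<lambda>z. F (mob a b c d z)) has_field_derivative (of_int c * z + of_int d) powi (-2) * f (mob a b c d z)) (at z)"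
    if "a * d - b * c = (1::int)" "z \<in> \<H>" for a b c d z
    using DERIV_chain2[OF F[OF mob_in_uhp[OF that]] has_field_derivative_mob[OF that]]
    by (simp add: mult.commute)
  have "cusp_primitive N F"
    unfolding cusp_primitive_def
  proof (intro conjI allI impI)
    fix a b c d :: int assume det: "a * d - b * c = 1"
    obtain k' where k': "k' holomorphic_on ball 0 1"
      "\<And>z. z \<in> \<H> \<Longrightarrow> ((\<lambda>z. k' (nome N z)) has_field_derivative
        (of_int c * z + of_int d) powi (-2) * f (mob a b c d z)) (at z)"
      using slash_primitive[OF f N det] by blast
    obtain \<kappa> where "\<And>z. z \<in> \<H> \<Longrightarrow> F (mob a b c d z) = k' (nome N z) + \<kappa>"
      using constant_on_uhp[OF FA[OF det] k'(2)] by blast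
    with k'(1) show "\<exists>k. k holomorphic_on ball 0 1 \<and> (\<forall>z\<in>\<H>. F (mob a b c d z) = k (nome N z))"
      by (intro exI[of _ "\<lambda>q. k' q + \<kappa>"] conjI ballI holomorphic_intros)
  next
    show "\<exists>k. k holomorphic_on ball 0 1 \<and> k 0 = 0 \<and> (\<forall>z\<in>\<H>. F z = k (nome N z))"
      using k(1) by (intro exI[of _ "\<lambda>q. k q - k 0"]) (auto simp: F_def intro!: holomorphic_intros)
  next
    fix a b c d :: int assume det: "a * d - b * c = 1" and dvd: "int N dvd c"
    have "((\<lambda>z. F (mob a b c d z)) has_field_derivative f z) (at z)" if "z \<in> \<H>" for z
      using FA[OF det that] cusp_form_invariant[OF f det dvd that] by simp
    then obtain \<kappa> where "\<And>z. z \<in> \<H> \<Longrightarrow> F (mob a b c d z) = F z + \<kappa>"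
      using constant_on_uhp[OF _ F] by blast
    thus "\<exists>\<kappa>. \<forall>z\<in>\<H>. F (mob a b c d z) = F z + \<kappa>" by (intro exI ballI)
  qed
  with F that show ?thesis by blast
qed

lemma cusp_primitive_at_cusp:
  assumes "cusp_primitive N F" "a * d - b * c = 1"
  obtains k where "k holomorphic_on ball 0 1" "\<And>z. z \<in> \<H> \<Longrightarrow> F (mob a b c d z) = k (nome N z)"
proof -
  obtain k where "k holomorphic_on ball 0 1 \<and> (\<forall>z\<in>\<H>. F (mob a b c d z) = k (nome N z))"
    using assms(1)[unfolded cusp_primitive_def, THEN conjunct1, rule_format, OF assms(2)] ..
  with that[of k] show ?thesis by simp
qed

lemma cusp_primitive_at_infinity:
  assumes "cusp_primitive N F"
  obtains k where "k holomorphic_on ball 0 1" "k 0 = 0" "\<And>z. z \<in> \<H> \<Longrightarrow> F z = k (nome N z)"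
proof -
  obtain k where "k holomorphic_on ball 0 1 \<and> k 0 = 0 \<and> (\<forall>z\<in>\<H>. F z = k (nome N z))"
    using assms[unfolded cusp_primitive_def, THEN conjunct2, THEN conjunct1] ..
  with that[of k] show ?thesis by simp
qed

lemma cusp_primitive_period:
  assumes "cusp_primitive N F" "a * d - b * c = 1" "int N dvd c"
  obtains \<kappa> where "\<And>z. z \<in> \<H> \<Longrightarrow> F (mob a b c d z) = F z + \<kappa>"
proof -
  obtain \<kappa> where "\<forall>z\<in>\<H>. F (mob a b c d z) = F z + \<kappa>"
    using assms(1)[unfolded cusp_primitive_def, THEN conjunct2, THEN conjunct2, rule_format, OF assms(2,3)] ..
  with that[of \<kappa>] show ?thesis by simp
qed

lemma cusp_primitive_add:
  assumes F: "cusp_primitive N F" and G: "cusp_primitive N G"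
  shows "cusp_primitive N (\<lambda>z. r * F z + G z)"
  unfolding cusp_primitive_def
proof (intro conjI allI impI)
  fix a b c d :: int assume det: "a * d - b * c = 1"
  obtain k where k: "k holomorphic_on ball 0 1" "\<And>z. z \<in> \<H> \<Longrightarrow> F (mob a b c d z) = k (nome N z)"
    using cusp_primitive_at_cusp[OF F det] by blast
  obtain l where l: "l holomorphic_on ball 0 1" "\<And>z. z \<in> \<H> \<Longrightarrow> G (mob a b c d z) = l (nome N z)"
    using cusp_primitive_at_cusp[OF G det] by blast
  show "\<exists>k. k holomorphic_on ball 0 1 \<and> (\<forall>z\<in>\<H>. r * F (mob a b c d z) + G (mob a b c d z) = k (nome N z))"
    by (rule exI[of _ "\<lambda>q. r * k q + l q"]) (use k l in \<open>auto intro!: holomorphic_intros\<close>)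
next
  obtain k where k: "k holomorphic_on ball 0 1" "k 0 = 0" "\<And>z. z \<in> \<H> \<Longrightarrow> F z = k (nome N z)"
    using cusp_primitive_at_infinity[OF F] by blast
  obtain l where l: "l holomorphic_on ball 0 1" "l 0 = 0" "\<And>z. z \<in> \<H> \<Longrightarrow> G z = l (nome N z)"
    using cusp_primitive_at_infinity[OF G] by blast
  show "\<exists>k. k holomorphic_on ball 0 1 \<and> k 0 = 0 \<and> (\<forall>z\<in>\<H>. r * F z + G z = k (nome N z))"
    by (rule exI[of _ "\<lambda>q. r * k q + l q"]) (use k l in \<open>auto intro!: holomorphic_intros\<close>)
next
  fix a b c d :: int assume det: "a * d - b * c = 1" and dvd: "int N dvd c"
  obtain \<kappa> where "\<And>z. z \<in> \<H> \<Longrightarrow> F (mob a b c d z) = F z + \<kappa>"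
    using cusp_primitive_period[OF F det dvd] by blast
  moreover obtain \<kappa>' where "\<And>z. z \<in> \<H> \<Longrightarrow> G (mob a b c d z) = G z + \<kappa>'"
    using cusp_primitive_period[OF G det dvd] by blast
  ultimately have "r * F (mob a b c d z) + G (mob a b c d z) = r * F z + G z + (r * \<kappa> + \<kappa>')" if "z \<in> \<H>" for z
    using that by (simp add: algebra_simps)
  thus "\<exists>\<kappa>. \<forall>z\<in>\<H>. r * F (mob a b c d z) + G (mob a b c d z) = r * F z + G z + \<kappa>"
    by (intro exI ballI)
qed

lemma cusp_primitive_zero: "cusp_primitive N (\<lambda>z. 0)"
proof -
  have "\<exists>k. k holomorphic_on ball 0 1 \<and> k 0 = 0 \<and> (\<forall>z\<in>\<H>. (0::complex) = k (nome N z))"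
    by (intro exI[of _ "\<lambda>_. 0"]) auto
  moreover have "\<exists>\<kappa>. \<forall>z\<in>\<H>. (0::complex) = 0 + \<kappa>"
    by (intro exI[of _ 0]) auto
  ultimately show ?thesis
    unfolding cusp_primitive_def by blast
qed

lemma cusp_primitive_sum:
  assumes "\<And>i. i \<in> I \<Longrightarrow> cusp_primitive N (F i)"
  shows "cusp_primitive N (\<lambda>z. \<Sum>i\<in>I. r i * F i z)"
  using assms
proof (induction I rule: infinite_finite_induct)
  case (insert x I)
  hence "cusp_primitive N (\<lambda>z. r x * F x z + (\<Sum>i\<in>I. r i * F i z))"
    by (intro cusp_primitive_add) auto
  with insert show ?case by simp
qed (simp_all add: cusp_primitive_zero)

section \<open>Boundary values at the cusps\<close>

text \<open>
  A function on the cusps is given by its values at the rational numbers; its value at infinity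
  (the fraction \<open>a/0\<close>) is fixed to be 0. The pair of integers serves as a column vector on which
  matrices act.
\<close>
definition cusp_at :: "(rat \<Rightarrow> 'a::zero) \<Rightarrow> int \<Rightarrow> int \<Rightarrow> 'a" where
  "cusp_at C a c = (if c = 0 then 0 else C (of_int a / of_int c))"

text \<open>
  The approach is along vertical lines: these are mapped to vertical lines by the maps
  \<open>z \<mapsto> p z\<close> and \<open>z \<mapsto> (z + b) / p\<close> that make up \<open>T\<^sub>p\<close>.
\<close>
definition boundary_value :: "(complex \<Rightarrow> complex) \<Rightarrow> rat \<Rightarrow> complex" where
  "boundary_value F x = Lim (at_right 0) (\<lambda>y. F (of_real (of_rat x) + \<i> * of_real y))"

lemma tendsto_nome:
  assumes "N > 0" "filterlim (\<lambda>y. Im (g y)) at_top \<F>"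
  shows "((\<lambda>y. nome N (g y)) \<longlongrightarrow> 0) \<F>"
proof (rule tendsto_norm_zero_cancel)
  have "filterlim (\<lambda>y. (2 * pi / real N) * Im (g y)) at_top \<F>"
    using assms by (intro filterlim_tendsto_pos_mult_at_top[OF tendsto_const]) auto
  hence "filterlim (\<lambda>y. - ((2 * pi / real N) * Im (g y))) at_bot \<F>"
    by (simp add: filterlim_uminus_at_top[symmetric] filterlim_uminus_at_bot)
  hence "((\<lambda>y. exp (- ((2 * pi / real N) * Im (g y)))) \<longlongrightarrow> 0) \<F>"
    by (rule filterlim_compose[OF exp_at_bot])
  thus "((\<lambda>y. norm (nome N (g y))) \<longlongrightarrow> 0) \<F>"
    by (simp add: norm_nome)
qed

lemma holomorphic_on_ball_tendsto:
  assumes "k holomorphic_on ball 0 1" "(g \<longlongrightarrow> 0) \<F>"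
  shows "((\<lambda>y. k (g y)) \<longlongrightarrow> k (0::complex)) \<F>"
proof -
  have "isCont k 0"
    using holomorphic_on_imp_continuous_on[OF assms(1)] by (simp add: continuous_on_eq_continuous_at)
  thus ?thesis using assms(2) by (rule isCont_tendsto_compose)
qed

lemma filterlim_scale_at_right_0:
  assumes "r > (0::real)"
  shows "filterlim (\<lambda>y. r * y) (at_right 0) (at_right 0)"
  unfolding filterlim_at
proof
  show "eventually (\<lambda>y. r * y \<in> {0<..} \<and> r * y \<noteq> 0) (at_right 0)"
    by (rule eventually_at_rightI[of 0 1]) (use assms in auto)
  have "((\<lambda>y. r * y) \<longlongrightarrow> r * 0) (at_right 0)" by (intro tendsto_intros)
  thus "((\<lambda>y. r * y) \<longlongrightarrow> 0) (at_right 0)" by simp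
qed

text \<open>
  The matrix that moves infinity to \<open>a/c\<close> pulls the vertical line above \<open>a/c\<close> back to points whose
  imaginary part tends to infinity, so the limit is the value at \<open>q = 0\<close> of the expansion at this
  cusp.
\<close>
lemma boundary_value_tendsto_matrix:
  assumes N: "N > 0" and det: "a * d - b * c = 1" and c: "c \<noteq> 0" and k: "k holomorphic_on ball 0 1"
    and F: "\<And>z. z \<in> \<H> \<Longrightarrow> F (mob a b c d z) = k (nome N z)"
  shows "((\<lambda>y. F (of_real (of_rat (of_int a / of_int c)) + \<i> * of_real y)) \<longlongrightarrow> k 0) (at_right 0)"
proof -
  define u where "u = (\<lambda>y. of_real (of_rat (of_int a / of_int c)) + \<i> * complex_of_real y)"
  define w where "w = (\<lambda>y. mob d (-b) (-c) a (u y))"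
  have det': "d * a - (-b) * (-c) = 1" using det by (simp add: algebra_simps)
  have Im_w: "Im (w y) = inverse ((of_int c)\<^sup>2 * y)" if "y > 0" for y
  proof -
    have "of_int (-c) * u y + of_int a = - of_int c * \<i> * complex_of_real y"
      using c by (simp add: u_def of_rat_divide algebra_simps)
    hence "norm (of_int (-c) * u y + of_int a) = \<bar>of_int c\<bar> * y"
      using that by (simp add: norm_mult)
    with Im_mob[OF det', of "u y"] that show ?thesis
      by (simp add: w_def u_def power_mult_distrib power2_eq_square field_simps)
  qed
  have inH: "u y \<in> \<H>" if "y > 0" for y using that by (simp add: u_def in_uhp_iff)
  have eq: "F (u y) = k (nome N (w y))" if "y > 0" for y
    using F[OF mob_in_uhp[OF det' inH[OF that]]] mob_inverse[OF det inH[OF that]]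
    by (simp add: w_def)
  have "filterlim (\<lambda>y. inverse ((of_int c)\<^sup>2 * y)) at_top (at_right (0::real))"
    by (intro filterlim_compose[OF filterlim_inverse_at_top_right] filterlim_scale_at_right_0) (use c in auto)
  moreover have "eventually (\<lambda>y. inverse ((of_int c)\<^sup>2 * y) = Im (w y)) (at_right 0)"
    by (rule eventually_at_rightI[of 0 1]) (use Im_w in auto)
  ultimately have "filterlim (\<lambda>y. Im (w y)) at_top (at_right 0)"
    using filterlim_cong[OF refl refl] by fast
  from tendsto_nome[OF N this] have "((\<lambda>y. k (nome N (w y))) \<longlongrightarrow> k 0) (at_right 0)"
    by (rule holomorphic_on_ball_tendsto[OF k])
  moreover have "eventually (\<lambda>y. k (nome N (w y)) = F (u y)) (at_right 0)"
    by (rule eventually_at_rightI[of 0 1]) (use eq in auto)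
  ultimately have "((\<lambda>y. F (u y)) \<longlongrightarrow> k 0) (at_right 0)"
    by (rule Lim_transform_eventually)
  thus ?thesis by (simp add: u_def)
qed

lemma ex_SL2_first_column:
  assumes "coprime a (c::int)"
  obtains b d where "a * d - b * c = 1"
proof -
  obtain u v where "u * a + v * c = 1"
    using bezout_int[of a c] assms by auto
  with that[of u "-v"] show ?thesis by (simp add: algebra_simps)
qed

lemma rat_lowest_terms:
  fixes x :: rat
  obtains a c where "quotient_of x = (a, c)" "x = of_int a / of_int c" "c > 0" "coprime a c"
proof -
  obtain a c where ac: "quotient_of x = (a, c)" by (cases "quotient_of x")
  show ?thesis
    by (rule that[OF ac quotient_of_div[OF ac] quotient_of_denom_pos[OF ac] quotient_of_coprime[OF ac]])
qed

lemma boundary_value_tendsto: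
  assumes "N > 0" "cusp_primitive N F"
  shows "((\<lambda>y. F (of_real (of_rat x) + \<i> * of_real y)) \<longlongrightarrow> boundary_value F x) (at_right 0)"
proof -
  obtain a c where "quotient_of x = (a, c)" and x: "x = of_int a / of_int c" "c > 0" "coprime a c"
    by (rule rat_lowest_terms[of x])
  obtain b d where det: "a * d - b * c = 1" using ex_SL2_first_column[OF x(3)] .
  obtain k where k: "k holomorphic_on ball 0 1" "\<And>z. z \<in> \<H> \<Longrightarrow> F (mob a b c d z) = k (nome N z)"
    using cusp_primitive_at_cusp[OF assms(2) det] by blast
  from boundary_value_tendsto_matrix[OF assms(1) det _ k] x(2)
  have lim: "((\<lambda>y. F (of_real (of_rat x) + \<i> * of_real y)) \<longlongrightarrow> k 0) (at_right 0)"
    unfolding x(1)[symmetric] by simp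
  hence "boundary_value F x = k 0"
    unfolding boundary_value_def by (intro tendsto_Lim) auto
  with lim show ?thesis by simp
qed

lemma boundary_value_eqI:
  assumes "((\<lambda>y. F (of_real (of_rat x) + \<i> * of_real y)) \<longlongrightarrow> l) (at_right 0)"
  shows "boundary_value F x = l"
  using assms unfolding boundary_value_def by (intro tendsto_Lim) auto

text \<open>
  For \<open>c = 0\<close> the matrix is a translation up to sign, and the value is 0 because \<open>F\<close> vanishes
  at infinity.
\<close>
lemma cusp_at_boundary_value:
  assumes N: "N > 0" and F: "cusp_primitive N F" and det: "a * d - b * c = 1"
    and k: "k holomorphic_on ball 0 1" "\<And>z. z \<in> \<H> \<Longrightarrow> F (mob a b c d z) = k (nome N z)"
  shows "cusp_at (boundary_value F) a c = k 0"
proof (cases "c = 0")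
  case False
  from boundary_value_eqI[OF boundary_value_tendsto_matrix[OF N det False k]] False
  show ?thesis by (simp add: cusp_at_def)
next
  case True
  obtain k1 where k1: "k1 holomorphic_on ball 0 1" "k1 0 = 0" "\<And>z. z \<in> \<H> \<Longrightarrow> F z = k1 (nome N z)"
    using cusp_primitive_at_infinity[OF F] by blast
  have Im: "Im (mob a b c d (\<i> * of_real y)) = y" for y :: real
    using Im_mob[OF det, of "\<i> * of_real y"] True det
    by (auto simp: zmult_eq_1_iff)
  have id: "filterlim (\<lambda>y::real. y) at_top at_top" by (rule filterlim_ident)
  have "((\<lambda>y. k1 (nome N (mob a b c d (\<i> * of_real y)))) \<longlongrightarrow> k1 0) at_top"
    by (intro holomorphic_on_ball_tendsto[OF k1(1)] tendsto_nome[OF N]) (simp add: Im id)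
  moreover have "eventually (\<lambda>y. k1 (nome N (mob a b c d (\<i> * of_real y))) = k (nome N (\<i> * of_real y))) at_top"
    using eventually_gt_at_top[of "0::real"]
  proof eventually_elim
    case (elim y)
    hence "\<i> * of_real y \<in> \<H>" by (simp add: in_uhp_iff)
    with k1(3)[OF mob_in_uhp[OF det this]] k(2)[OF this] show ?case by simp
  qed
  ultimately have "((\<lambda>y. k (nome N (\<i> * of_real y))) \<longlongrightarrow> k1 0) at_top"
    by (rule Lim_transform_eventually)
  moreover have "((\<lambda>y. k (nome N (\<i> * of_real y))) \<longlongrightarrow> k 0) at_top"
    by (intro holomorphic_on_ball_tendsto[OF k(1)] tendsto_nome[OF N]) (simp add: id)
  ultimately have "k 0 = k1 0" by (intro tendsto_unique[of at_top]) auto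
  with True k1(2) show ?thesis by (simp add: cusp_at_def)
qed

text \<open>
  The period of a matrix in \<open>Gamma0 N\<close> is the boundary value at the image of infinity, as one
  sees by letting \<open>z\<close> tend to infinity.
\<close>
lemma cusp_primitive_period_eq:
  assumes N: "N > 0" and F: "cusp_primitive N F" and det: "a * d - b * c = 1" and dvd: "int N dvd c"
    and z: "z \<in> \<H>"
  shows "F (mob a b c d z) = F z + cusp_at (boundary_value F) a c"
proof -
  obtain \<kappa> where \<kappa>: "\<And>z. z \<in> \<H> \<Longrightarrow> F (mob a b c d z) = F z + \<kappa>"
    using cusp_primitive_period[OF F det dvd] by blast
  obtain k1 where k1: "k1 holomorphic_on ball 0 1" "k1 0 = 0" "\<And>z. z \<in> \<H> \<Longrightarrow> F z = k1 (nome N z)"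
    using cusp_primitive_at_infinity[OF F] by blast
  have "cusp_at (boundary_value F) a c = k1 0 + \<kappa>"
    by (rule cusp_at_boundary_value[OF N F det, of "\<lambda>q. k1 q + \<kappa>"])
       (use \<kappa> k1 in \<open>auto intro!: holomorphic_intros\<close>)
  with \<kappa>[OF z] k1(2) show ?thesis by simp
qed

text \<open>
  The increment of the function under a matrix in \<open>Gamma0 N\<close> is the same at all cusps. At infinity,
  where the value is 0, it is the value at the image \<open>a/c\<close>; this identifies the constant.
\<close>
definition quasi_periodic :: "nat \<Rightarrow> (rat \<Rightarrow> complex) \<Rightarrow> bool" where
  "quasi_periodic N C \<longleftrightarrow> (\<forall>a b c d x y. a * d - b * c = 1 \<longrightarrow> int N dvd c \<longrightarrow> coprime x y \<longrightarrow>
     cusp_at C (a * x + b * y) (c * x + d * y) = cusp_at C x y + cusp_at C a c)"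

lemma quasi_periodic_boundary_value:
  assumes N: "N > 0" and F: "cusp_primitive N F"
  shows "quasi_periodic N (boundary_value F)"
  unfolding quasi_periodic_def
proof (intro allI impI)
  fix a b c d x y :: int
  assume det: "a * d - b * c = 1" and dvd: "int N dvd c" and cop: "coprime x y"
  obtain u v where det': "x * v - u * y = 1" using ex_SL2_first_column[OF cop] .
  have det'': "(a * x + b * y) * (c * u + d * v) - (a * u + b * v) * (c * x + d * y) = 1"
  proof -
    have "(a * x + b * y) * (c * u + d * v) - (a * u + b * v) * (c * x + d * y) =
       (a * d - b * c) * (x * v - u * y)" by (simp add: algebra_simps)
    thus ?thesis using det det' by simp
  qed
  obtain k where k: "k holomorphic_on ball 0 1" "\<And>z. z \<in> \<H> \<Longrightarrow> F (mob x u y v z) = k (nome N z)"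
    using cusp_primitive_at_cusp[OF F det'] by blast
  let ?\<kappa> = "cusp_at (boundary_value F) a c"
  have "cusp_at (boundary_value F) (a * x + b * y) (c * x + d * y) = k 0 + ?\<kappa>"
  proof (rule cusp_at_boundary_value[OF N F det'', of "\<lambda>q. k q + ?\<kappa>"])
    fix z assume z: "z \<in> \<H>"
    show "F (mob (a * x + b * y) (a * u + b * v) (c * x + d * y) (c * u + d * v) z) = k (nome N z) + ?\<kappa>"
      using cusp_primitive_period_eq[OF N F det dvd mob_in_uhp[OF det' z]] k(2)[OF z]
      by (simp add: mob_mob[OF det' z])
  qed (use k in \<open>auto intro!: holomorphic_intros\<close>)
  also have "k 0 = cusp_at (boundary_value F) x y"
    using cusp_at_boundary_value[OF N F det' k] by simp
  finally show "cusp_at (boundary_value F) (a * x + b * y) (c * x + d * y) =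
    cusp_at (boundary_value F) x y + ?\<kappa>" .
qed

lemma boundary_value_sum:
  assumes N: "N > 0" and F: "\<And>i. i \<in> I \<Longrightarrow> cusp_primitive N (F i)"
  shows "boundary_value (\<lambda>z. \<Sum>i\<in>I. r i * F i z) x = (\<Sum>i\<in>I. r i * boundary_value (F i) x)"
  by (intro boundary_value_eqI tendsto_sum tendsto_mult tendsto_const boundary_value_tendsto[OF N F])

text \<open>
  The Hecke operator \<open>T\<^sub>p\<close> for functions on the cusps. In weight 2 it is a sum over the
  same maps as for the primitive \<open>F\<close>, without weights.
\<close>
definition hecke_cusps :: "nat \<Rightarrow> (rat \<Rightarrow> 'a::comm_monoid_add) \<Rightarrow> rat \<Rightarrow> 'a" where
  "hecke_cusps p C x = C (of_nat p * x) + (\<Sum>b<p. C ((x + of_nat b) / of_nat p))"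

lemma boundary_value_hecke:
  assumes N: "N > 0" and p: "p > 0" and F: "cusp_primitive N F"
    and eigen: "\<And>z. z \<in> \<H> \<Longrightarrow> l * F z = F (of_nat p * z) + (\<Sum>b<p. F ((z + of_nat b) / of_nat p))"
  shows "l * boundary_value F x = hecke_cusps p (boundary_value F) x"
proof -
  let ?u = "\<lambda>x y. of_real (of_rat x) + \<i> * complex_of_real y"
  note lim = boundary_value_tendsto[OF N F]
  have lim': "((\<lambda>y. F (?u x (r * y))) \<longlongrightarrow> boundary_value F x) (at_right 0)" if "r > 0" for r x
    by (rule filterlim_compose[OF lim filterlim_scale_at_right_0[OF that]])
  have "((\<lambda>y. F (?u (of_nat p * x) (real p * y)) + (\<Sum>b<p. F (?u ((x + of_nat b) / of_nat p) ((1 / real p) * y))))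
      \<longlongrightarrow> hecke_cusps p (boundary_value F) x) (at_right 0)"
    unfolding hecke_cusps_def
    by (rule tendsto_add; (rule tendsto_sum)?; rule lim') (use p in auto)
  moreover have "eventually (\<lambda>y. F (?u (of_nat p * x) (real p * y)) + (\<Sum>b<p. F (?u ((x + of_nat b) / of_nat p) ((1 / real p) * y)))
     = l * F (?u x y)) (at_right 0)"
  proof -
    have "F (?u (of_nat p * x) (real p * y)) + (\<Sum>b<p. F (?u ((x + of_nat b) / of_nat p) ((1 / real p) * y)))
     = l * F (?u x y)" if "y > 0" for y
    proof -
      have "?u x y \<in> \<H>" using that by (simp add: in_uhp_iff)
      from eigen[OF this] show ?thesis
        using p by (simp add: of_rat_mult of_rat_divide of_rat_add field_simps)
    qed
    thus ?thesis by (intro eventually_at_rightI[of 0 1]) auto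
  qed
  ultimately have "((\<lambda>y. l * F (?u x y)) \<longlongrightarrow> hecke_cusps p (boundary_value F) x) (at_right 0)"
    by (rule Lim_transform_eventually)
  moreover have "((\<lambda>y. l * F (?u x y)) \<longlongrightarrow> l * boundary_value F x) (at_right 0)"
    by (intro tendsto_mult tendsto_const lim)
  ultimately show ?thesis by (intro tendsto_unique[of "at_right 0"]) auto
qed

lemma hecke_prime:
  assumes "prime p" "coprime p N"
  shows "hecke 2 N p f z = of_nat p * f (of_nat p * z) + (\<Sum>b<p. f ((z + of_nat b) / of_nat p)) / of_nat p"
proof -
  have "{d. d dvd p \<and> coprime (p div d) N} = {1, p}"
    using assms by (auto simp: prime_nat_iff)
  moreover have "p \<noteq> 1" "p > 0" using assms(1) by (auto simp: prime_gt_0_nat)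
  ultimately show ?thesis
    by (simp add: hecke_def power_int_minus power2_eq_square field_simps)
qed

text \<open>
  Both sides are primitives of \<open>T\<^sub>p f\<close>, and both vanish at infinity.
\<close>
lemma primitive_hecke:
  assumes N: "N > 0" and p: "prime p" "coprime p N" and F: "cusp_primitive N F"
    and F': "\<And>z. z \<in> \<H> \<Longrightarrow> (F has_field_derivative f z) (at z)"
    and eigen: "hecke 2 N p f = fun_scale l f" and z: "z \<in> \<H>"
  shows "l * F z = F (of_nat p * z) + (\<Sum>b<p. F ((z + of_nat b) / of_nat p))"
proof -
  have p0: "p > 0" using p(1) by (simp add: prime_gt_0_nat)
  define G where "G = (\<lambda>z. F (of_nat p * z) + (\<Sum>b<p. F ((z + of_nat b) / of_nat p)))"
  have "(G has_field_derivative l * f z) (at z)" if z: "z \<in> \<H>" for z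
  proof -
    have H: "of_nat p * z \<in> \<H>" "(z + of_nat b) / of_nat p \<in> \<H>" for b
      using z p0 by (auto simp: in_uhp_iff)
    have "((\<lambda>z. F (of_nat p * z)) has_field_derivative f (of_nat p * z) * of_nat p) (at z)"
      by (rule DERIV_chain2[where f = F and g = "\<lambda>z. of_nat p * z", OF F'[OF H(1)]]) (auto intro!: derivative_eq_intros)
    moreover have "((\<lambda>z. F ((z + of_nat b) / of_nat p)) has_field_derivative f ((z + of_nat b) / of_nat p) * (1 / of_nat p)) (at z)" for b
      by (rule DERIV_chain2[where f = F and g = "\<lambda>z. (z + of_nat b) / of_nat p", OF F'[OF H(2)]]) (use p0 in \<open>auto intro!: derivative_eq_intros\<close>)
    ultimately have "(G has_field_derivative (f (of_nat p * z) * of_nat p + (\<Sum>b<p. f ((z + of_nat b) / of_nat p) * (1 / of_nat p)))) (at z)"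
      unfolding G_def by (intro DERIV_add DERIV_sum)
    also have "f (of_nat p * z) * of_nat p + (\<Sum>b<p. f ((z + of_nat b) / of_nat p) * (1 / of_nat p)) = hecke 2 N p f z"
      by (simp add: hecke_prime[OF p] sum_divide_distrib)
    finally show ?thesis by (simp add: eigen fun_scale_def)
  qed
  moreover have "((\<lambda>z. l * F z) has_field_derivative l * f z) (at z)" if "z \<in> \<H>" for z
    by (intro DERIV_cmult F' that)
  ultimately obtain \<kappa> where \<kappa>: "\<And>z. z \<in> \<H> \<Longrightarrow> G z = l * F z + \<kappa>"
    using constant_on_uhp[of G "\<lambda>z. l * f z" "\<lambda>z. l * F z"] by blast
  obtain k1 where k1: "k1 holomorphic_on ball 0 1" "k1 0 = 0" "\<And>z. z \<in> \<H> \<Longrightarrow> F z = k1 (nome N z)"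
    using cusp_primitive_at_infinity[OF F] by blast
  have lim: "((\<lambda>y. F (g y)) \<longlongrightarrow> 0) at_top" if "filterlim (\<lambda>y. Im (g y)) at_top at_top" for g :: "real \<Rightarrow> complex"
  proof -
    have "((\<lambda>y. k1 (nome N (g y))) \<longlongrightarrow> k1 0) at_top"
      by (intro holomorphic_on_ball_tendsto[OF k1(1)] tendsto_nome[OF N] that)
    moreover have "eventually (\<lambda>y. Im (g y) > 0) at_top"
      using that by (simp add: filterlim_at_top_dense)
    hence ev: "eventually (\<lambda>y. k1 (nome N (g y)) = F (g y)) at_top"
      by eventually_elim (simp add: k1(3) in_uhp_iff)
    ultimately have "((\<lambda>y. F (g y)) \<longlongrightarrow> k1 0) at_top"
      by (rule Lim_transform_eventually)
    thus ?thesis by (simp add: k1(2))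
  qed
  have "((\<lambda>y. F (of_nat p * (\<i> * of_real y))) \<longlongrightarrow> 0) at_top"
  proof (rule lim)
    have "filterlim (\<lambda>y. y * real p) at_top at_top"
      using p0 by (intro filterlim_at_top_mult_tendsto_pos[OF tendsto_const _ filterlim_ident]) auto
    thus "filterlim (\<lambda>y. Im (of_nat p * (\<i> * complex_of_real y))) at_top at_top"
      by (simp add: mult.commute)
  qed
  moreover have "((\<lambda>y. F ((\<i> * of_real y + of_nat b) / of_nat p)) \<longlongrightarrow> 0) at_top" for b
  proof (rule lim)
    have "filterlim (\<lambda>y. y * (1 / real p)) at_top at_top"
      using p0 by (intro filterlim_at_top_mult_tendsto_pos[OF tendsto_const _ filterlim_ident]) auto
    thus "filterlim (\<lambda>y. Im ((\<i> * complex_of_real y + of_nat b) / of_nat p)) at_top at_top"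
      by simp
  qed
  moreover have "((\<lambda>y. F (\<i> * of_real y)) \<longlongrightarrow> 0) at_top"
    by (rule lim) (simp add: filterlim_ident)
  ultimately have "((\<lambda>y. G (\<i> * of_real y) - l * F (\<i> * of_real y)) \<longlongrightarrow> (0 + (\<Sum>b<p. 0)) - l * 0) at_top"
    unfolding G_def by (intro tendsto_diff tendsto_add tendsto_sum tendsto_mult tendsto_const)
  moreover have "eventually (\<lambda>y. G (\<i> * of_real y) - l * F (\<i> * of_real y) = \<kappa>) at_top"
    using eventually_gt_at_top[of "0::real"] by eventually_elim (simp add: \<kappa> in_uhp_iff)
  ultimately have "((\<lambda>y::real. \<kappa>) \<longlongrightarrow> 0) at_top"
    using Lim_transform_eventually[of _ "0 + (\<Sum>b<p. 0) - l * 0" at_top "\<lambda>y. \<kappa>"] by simp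
  hence "\<kappa> = 0" by (simp add: tendsto_const_iff)
  with \<kappa>[OF z] show ?thesis by (simp add: G_def)
qed

section \<open>Fourier coefficients and Hecke eigenvalues\<close>

text \<open>
  The definition of cusp forms provides an expansion in the \<open>N\<close>-th root of \<open>q\<close>. Comparing it with
  the expansion of the translate by 1 shows that only exponents divisible by \<open>N\<close> occur.
\<close>
lemma cusp_form_q_expansion:
  assumes f: "f \<in> cusp_forms k N" and N: "N > 0"
  shows "\<exists>a. has_q_expansion f a"
proof -
  have one: "1 * 1 - 0 * 0 = (1::int)" by simp
  have "\<exists>u :: nat \<Rightarrow> complex. u 0 = 0 \<and> (\<forall>z\<in>\<H>. (\<lambda>m. u m * exp (2 * of_real pi * \<i> * z / of_nat N) ^ m) sums
     slash k f (vector [vector [1, 0], vector [0, 1]]) z)"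
    using f SL2Z_matrix[OF one] unfolding cusp_forms_def by blast
  then obtain u where u: "\<And>z. z \<in> \<H> \<Longrightarrow> (\<lambda>m. u m * nome N z ^ m) sums f z"
    unfolding slash_matrix nome_def[symmetric] mob_id by auto
  have per: "f (z + 1) = f z" if "z \<in> \<H>" for z
    using cusp_form_invariant[OF f, of 1 1 1 0 z] that by (simp add: mob_def)
  define h where "h = (\<lambda>z. f (of_nat N * z))"
  \<comment> \<open>Translation by 1 multiplies the coefficient of index \<open>m\<close> by \<open>\<zeta>\<^sup>m\<close>.\<close>
  define \<zeta> where "\<zeta> = exp (2 * of_real pi * \<i> / of_nat N)"
  have NH: "of_nat N * z \<in> \<H>" if "z \<in> \<H>" for z
    using that N by (simp add: in_uhp_iff)
  have nomeN: "nome N (of_nat N * z) = exp (2 * of_real pi * \<i> * z)" for z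
    using N by (simp add: nome_def mult.assoc)
  have "has_q_expansion h u"
    unfolding has_q_expansion_def h_def using u[OF NH] by (simp add: nomeN)
  moreover have "has_q_expansion h (\<lambda>m. u m * \<zeta> ^ m)"
    unfolding has_q_expansion_def
  proof
    fix z assume z: "z \<in> \<H>"
    hence "of_nat N * z + 1 \<in> \<H>" using N by (simp add: in_uhp_iff)
    from u[OF this] per[OF NH[OF z]] have "(\<lambda>m. u m * nome N (of_nat N * z + 1) ^ m) sums h z"
      by (simp add: h_def)
    also have "nome N (of_nat N * z + 1) = \<zeta> * exp (2 * of_real pi * \<i> * z)"
      using N by (simp add: nome_def \<zeta>_def exp_add[symmetric] field_simps)
    finally show "(\<lambda>m. u m * \<zeta> ^ m * exp (2 * of_real pi * \<i> * z) ^ m) sums h z"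
      by (simp add: power_mult_distrib mult.assoc)
  qed
  ultimately have "u = (\<lambda>m. u m * \<zeta> ^ m)" by (rule has_q_expansion_unique)
  hence eq: "u m = u m * \<zeta> ^ m" for m by (rule fun_cong)
  have zero: "u m = 0" if m: "\<not> N dvd m" for m
  proof (rule ccontr)
    assume "u m \<noteq> 0"
    hence "\<zeta> ^ m = 1" using eq[of m] by simp
    hence "exp (2 * of_real pi * \<i> * of_nat m / of_nat N) = 1"
      by (simp add: \<zeta>_def exp_of_nat_mult[symmetric] mult_ac)
    then obtain j :: int where "2 * pi * real m / real N = of_int (2 * j) * pi"
      by (auto simp: exp_eq_1)
    hence "real m = of_int j * real N" using N by (simp add: field_simps)
    hence "int m = j * int N" by (metis of_int_eq_iff of_int_mult of_int_of_nat_eq)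
    with m show False by (metis dvd_triv_right int_dvd_int_iff)
  qed
  have "has_q_expansion f (\<lambda>m. u (N * m))"
    unfolding has_q_expansion_def
  proof
    fix z assume z: "z \<in> \<H>"
    have "(\<lambda>m. u (N * m) * nome N z ^ (N * m)) sums f z"
    proof (subst sums_mono_reindex[of "\<lambda>m. N * m" "\<lambda>m. u m * nome N z ^ m"])
      show "strict_mono (\<lambda>m. N * m)" using N by (simp add: strict_mono_def)
      show "u m * nome N z ^ m = 0" if "m \<notin> range (\<lambda>m. N * m)" for m
        using that zero[of m] by (auto simp: dvd_def)
    qed (rule u[OF z])
    moreover have "nome N z ^ (N * m) = exp (2 * of_real pi * \<i> * z) ^ m" for m
      using N by (simp add: power_mult nome_def exp_of_nat_mult[symmetric])
    ultimately show "(\<lambda>m. u (N * m) * exp (2 * of_real pi * \<i> * z) ^ m) sums f z" by simp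
  qed
  thus ?thesis by blast
qed

lemma sum_roots_of_unity:
  assumes "p > 0"
  shows "(\<Sum>b<p. exp (2 * of_real pi * \<i> * of_nat b / of_nat p) ^ m) = (if p dvd m then of_nat p else 0 :: complex)"
proof -
  define \<zeta> :: complex where "\<zeta> = exp (2 * of_real pi * \<i> * of_nat m / of_nat p)"
  have eq: "exp (2 * of_real pi * \<i> * of_nat b / of_nat p) ^ m = \<zeta> ^ b" for b
    by (simp add: \<zeta>_def exp_of_nat_mult[symmetric] mult_ac)
  have "\<zeta> ^ p = exp (of_nat m * (2 * of_real pi * \<i>))"
    using assms by (simp add: \<zeta>_def exp_of_nat_mult[symmetric] mult_ac)
  hence 1: "\<zeta> ^ p = 1" by (simp add: exp_of_nat_mult)
  have 2: "\<zeta> = 1 \<longleftrightarrow> p dvd m"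
  proof
    assume "\<zeta> = 1"
    then obtain j :: int where "2 * pi * real m / real p = of_int (2 * j) * pi"
      by (auto simp: exp_eq_1 \<zeta>_def)
    hence "real m = of_int j * real p" using assms by (simp add: field_simps)
    hence "int m = j * int p" by (metis of_int_eq_iff of_int_mult of_int_of_nat_eq)
    thus "p dvd m" by (metis dvd_triv_right int_dvd_int_iff)
  next
    assume "p dvd m"
    then obtain j where "m = p * j" by blast
    hence "\<zeta> = exp (of_nat j * (2 * of_real pi * \<i>))" using assms by (simp add: \<zeta>_def mult_ac)
    thus "\<zeta> = 1" by (simp add: exp_of_nat_mult)
  qed
  show ?thesis
  proof (cases "\<zeta> = 1")
    case True
    thus ?thesis using 2 by (simp add: eq)
  next
    case False
    have "(\<Sum>b<p. \<zeta> ^ b) = 0" using geometric_sum[OF False, of p] 1 by simp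
    with False 2 show ?thesis by (simp add: eq)
  qed
qed

text \<open>
  The sum over \<open>b\<close> is a sum over roots of unity that selects the exponents divisible by \<open>p\<close>.
\<close>
lemma hecke_q_expansion:
  assumes p: "prime p" "coprime p N" and f: "has_q_expansion f a"
  shows "has_q_expansion (hecke 2 N p f) (\<lambda>m. a (p * m) + (if p dvd m then of_nat p * a (m div p) else 0))"
  unfolding has_q_expansion_def
proof
  have p0: "p > 0" using p(1) by (simp add: prime_gt_0_nat)
  fix z assume z: "z \<in> \<H>"
  let ?q = "exp (2 * of_real pi * \<i> * z)"
  have fz: "(\<lambda>m. a m * exp (2 * of_real pi * \<i> * z) ^ m) sums f z" if "z \<in> \<H>" for z
    using f that by (simp add: has_q_expansion_def)
  have smono: "strict_mono (\<lambda>m. p * m)" using p0 by (simp add: strict_mono_def)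
  have "(\<lambda>m. a (p * m) * ?q ^ m) sums ((\<Sum>b<p. f ((z + of_nat b) / of_nat p)) / of_nat p)"
  proof -
    let ?r = "exp (2 * of_real pi * \<i> * z / of_nat p)"
    have r: "?r ^ (p * m) = ?q ^ m" for m
      using p0 by (simp add: power_mult exp_of_nat_mult[symmetric])
    have "(z + of_nat b) / of_nat p \<in> \<H>" for b using z p0 by (simp add: in_uhp_iff)
    from fz[OF this] have "(\<lambda>m. (\<Sum>b<p. a m * exp (2 * of_real pi * \<i> * ((z + of_nat b) / of_nat p)) ^ m) / of_nat p)
      sums ((\<Sum>b<p. f ((z + of_nat b) / of_nat p)) / of_nat p)"
      by (intro sums_divide sums_sum)
    also have "(\<lambda>m. (\<Sum>b<p. a m * exp (2 * of_real pi * \<i> * ((z + of_nat b) / of_nat p)) ^ m) / of_nat p)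
      = (\<lambda>m. if p dvd m then a m * ?r ^ m else 0)"
    proof
      fix m
      have "exp (2 * of_real pi * \<i> * ((z + of_nat b) / of_nat p)) = ?r * exp (2 * of_real pi * \<i> * of_nat b / of_nat p)" for b
        by (simp add: exp_add[symmetric] add_divide_distrib algebra_simps)
      hence "(\<Sum>b<p. a m * exp (2 * of_real pi * \<i> * ((z + of_nat b) / of_nat p)) ^ m) =
          a m * ?r ^ m * (\<Sum>b<p. exp (2 * of_real pi * \<i> * of_nat b / of_nat p) ^ m)"
        by (simp add: power_mult_distrib sum_distrib_left mult.assoc)
      thus "(\<Sum>b<p. a m * exp (2 * of_real pi * \<i> * ((z + of_nat b) / of_nat p)) ^ m) / of_nat p =
        (if p dvd m then a m * ?r ^ m else 0)"
        using p0 by (simp add: sum_roots_of_unity)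
    qed
    finally have "(\<lambda>m. if p dvd m then a m * ?r ^ m else 0) sums ((\<Sum>b<p. f ((z + of_nat b) / of_nat p)) / of_nat p)" .
    hence "(\<lambda>m. if p dvd p * m then a (p * m) * ?r ^ (p * m) else 0) sums ((\<Sum>b<p. f ((z + of_nat b) / of_nat p)) / of_nat p)"
      by (subst sums_mono_reindex[OF smono, where f = "\<lambda>m. if p dvd m then a m * ?r ^ m else 0"]) (auto simp: dvd_def)
    thus ?thesis by (simp add: r)
  qed
  moreover have "(\<lambda>m. (if p dvd m then of_nat p * a (m div p) else 0) * ?q ^ m) sums (of_nat p * f (of_nat p * z))"
  proof -
    have "of_nat p * z \<in> \<H>" using z p0 by (simp add: in_uhp_iff)
    from sums_mult[OF fz[OF this], of "of_nat p"]
    have "(\<lambda>m. of_nat p * a m * ?q ^ (p * m)) sums (of_nat p * f (of_nat p * z))"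
      by (simp add: power_mult exp_of_nat_mult[symmetric] mult_ac)
    hence "(\<lambda>m. (if p dvd p * m then of_nat p * a (p * m div p) else 0) * ?q ^ (p * m)) sums (of_nat p * f (of_nat p * z))"
      using p0 by simp
    thus ?thesis
      by (subst (asm) sums_mono_reindex[OF smono, where f = "\<lambda>m. (if p dvd m then of_nat p * a (m div p) else 0) * ?q ^ m"]) (auto simp: dvd_def)
  qed
  ultimately have "(\<lambda>m. a (p * m) * ?q ^ m + (if p dvd m then of_nat p * a (m div p) else 0) * ?q ^ m) sums
     ((\<Sum>b<p. f ((z + of_nat b) / of_nat p)) / of_nat p + of_nat p * f (of_nat p * z))"
    by (rule sums_add)
  thus "(\<lambda>m. (a (p * m) + (if p dvd m then of_nat p * a (m div p) else 0)) * ?q ^ m) sums hecke 2 N p f z"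
    by (simp add: hecke_prime[OF p] algebra_simps)
qed

lemma normalized_hecke_eigenvalue:
  assumes f: "normalized_hecke_eigenform 2 N f" and N: "N > 0" and p: "prime p" "coprime p N"
  shows "hecke 2 N p f = fun_scale (fourier_coeff f p) f"
proof -
  have p0: "p > 1" using p(1) by (rule prime_gt_1_nat)
  obtain a where a: "has_q_expansion f a"
    using cusp_form_q_expansion N f unfolding normalized_hecke_eigenform_def hecke_eigenform_def by blast
  obtain l where l: "hecke 2 N p f = fun_scale l f"
    using f p0 unfolding normalized_hecke_eigenform_def hecke_eigenform_def by (meson less_imp_le)
  have "has_q_expansion (fun_scale l f) (\<lambda>m. l * a m)"
    using a unfolding has_q_expansion_def fun_scale_def by (simp add: mult.assoc sums_mult)
  with hecke_q_expansion[OF p a] l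
  have eq: "(\<lambda>m. a (p * m) + (if p dvd m then of_nat p * a (m div p) else 0)) = (\<lambda>m. l * a m)"
    by (intro has_q_expansion_unique[of "fun_scale l f"]) auto
  have "a 1 = 1" using f fourier_coeff_eqI[OF a] by (simp add: normalized_hecke_eigenform_def)
  with fun_cong[OF eq, of 1] p0 have "a p = l" by simp
  with l fourier_coeff_eqI[OF a] show ?thesis by simp
qed

section \<open>Even periods determine the cusp form\<close>

text \<open>
  A weak form of the reduction to the fundamental domain. If \<open>y = Im z\<close> is small, Dirichlet's
  approximation theorem for \<open>x = Re z\<close> with denominators up to \<open>1 / sqrt y\<close> gives coprime \<open>k\<close>
  and \<open>h\<close> for which \<open>(k x - h)\<^sup>2 + (k y)\<^sup>2 \<le> 5 y\<close>; these are the bottom row of the matrix.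
\<close>
lemma ex_mob_Im_ge:
  assumes "z \<in> \<H>"
  obtains a b c d :: int where "a * d - b * c = 1" "Im (mob a b c d z) \<ge> 1 / 5"
proof (cases "Im z \<ge> 1 / 5")
  case True
  thus ?thesis using that[of 1 1 0 0] by (simp add: mob_id)
next
  case False
  define x y where "x = Re z" and "y = Im z"
  have y: "0 < y" "y < 1 / 5" using False assms by (auto simp: y_def in_uhp_iff)
  \<comment> \<open>The bound \<open>1 / sqrt y\<close> balances the two squares in the norm of \<open>k z - h\<close>.\<close>
  define Q where "Q = nat \<lfloor>1 / sqrt y\<rfloor>"
  have sq: "0 < sqrt y" "sqrt y < 1" using y by auto
  hence "1 / sqrt y \<ge> 1" by simp
  hence Q1: "Q \<ge> 1" unfolding Q_def by (intro le_nat_floor) simp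
  have Q2: "real Q \<le> 1 / sqrt y" using sq by (simp add: Q_def)
  have "1 / sqrt y < real Q + 1" using sq unfolding Q_def by linarith
  also have "\<dots> \<le> 2 * real Q" using Q1 by simp
  finally have Q3: "1 / real Q < 2 * sqrt y" using sq Q1 by (simp add: field_simps)
  obtain h k where hk: "coprime h k" "0 < k" "k \<le> int Q" "\<bar>of_int k * x - of_int h\<bar> < 1 / real Q"
    using Dirichlet_approx_coprime[of Q x] Q1 by auto
  have "coprime (-k) h" using hk(1) by (simp add: coprime_commute)
  then obtain b d where bd: "(-k) * d - b * h = 1" by (rule ex_SL2_first_column)
  have det: "b * (-h) - d * k = 1" using bd by (simp add: algebra_simps)
  have "(norm (of_int k * z + of_int (-h)))\<^sup>2 = (of_int k * x - of_int h)\<^sup>2 + (of_int k * y)\<^sup>2"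
    by (simp add: cmod_power2 x_def y_def)
  also have "(of_int k * x - of_int h)\<^sup>2 \<le> (1 / real Q)\<^sup>2"
    using hk(4) by (intro abs_le_square_iff[THEN iffD1]) simp
  also have "\<dots> \<le> (2 * sqrt y)\<^sup>2" using Q3 by (intro power_mono) auto
  also have "\<dots> = 4 * y" using y by simp
  also have "(of_int k * y)\<^sup>2 \<le> (1 / sqrt y * y)\<^sup>2"
  proof (intro power_mono mult_right_mono)
    have "of_int k \<le> real Q" using hk(3) by linarith
    with Q2 show "of_int k \<le> 1 / sqrt y" by linarith
  qed (use hk(2) y in auto)
  also have "\<dots> = y" using y by (simp add: power_mult_distrib power_divide power2_eq_square)
  finally have le: "(norm (of_int k * z + of_int (-h)))\<^sup>2 \<le> 5 * y" by simp
  have "of_int k * z + of_int (-h) \<noteq> 0" by (rule mob_denom_nonzero[OF det assms])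
  hence pos: "(norm (of_int k * z + of_int (-h)))\<^sup>2 > 0" by simp
  have "Im (mob b d k (-h) z) = y / (norm (of_int k * z + of_int (-h)))\<^sup>2"
    by (simp only: Im_mob[OF det] y_def)
  also have "\<dots> \<ge> y / (5 * y)" using le pos y by (intro divide_left_mono) auto
  also have "y / (5 * y) = 1 / 5" using y by simp
  finally show ?thesis using that[OF det] by simp
qed

text \<open>
  The maximum modulus principle for \<open>exp (k q)\<close>, whose modulus is \<open>exp (Re (k q))\<close>.
\<close>
lemma constant_if_Re_attains_max:
  assumes k: "k holomorphic_on ball 0 1" and q0: "q0 \<in> ball 0 1"
    and max: "\<And>q. q \<in> ball 0 1 \<Longrightarrow> Re (k q) \<le> Re (k q0)"
  obtains \<kappa> where "\<And>q. q \<in> ball 0 1 \<Longrightarrow> k q = \<kappa>"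
proof -
  have "(\<lambda>q. exp (k q)) constant_on ball 0 1"
    by (rule maximum_modulus_principle[where U = "ball 0 1" and \<xi> = q0])
       (use k q0 max in \<open>auto intro!: holomorphic_intros\<close>)
  then obtain e where e: "\<And>q. q \<in> ball 0 1 \<Longrightarrow> exp (k q) = e" by (auto simp: constant_on_def)
  have "(k has_field_derivative 0) (at q within ball 0 1)" if q: "q \<in> ball 0 1" for q
  proof -
    have "(k has_field_derivative deriv k q) (at q)"
      using holomorphic_derivI[OF k open_ball q] .
    hence "((\<lambda>q. exp (k q)) has_field_derivative exp (k q) * deriv k q) (at q)"
      by (auto intro!: derivative_eq_intros)
    moreover have "((\<lambda>q. exp (k q)) has_field_derivative 0) (at q)"
      by (rule has_field_derivative_transform_within_open[OF DERIV_const open_ball q]) (simp add: e)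
    ultimately have "deriv k q = 0" using DERIV_unique by fastforce
    thus ?thesis using holomorphic_derivI[OF k open_ball q] by (simp add: has_field_derivative_at_within)
  qed
  then obtain \<kappa> where "\<And>q. q \<in> ball 0 1 \<Longrightarrow> k q = \<kappa>"
    using has_field_derivative_zero_constant[OF convex_ball] by blast
  thus ?thesis using that by blast
qed

text \<open>
  The maximum principle on the compactified quotient of the upper half plane. The functions
  \<open>Re (K (A z))\<close>, with \<open>A\<close> a matrix of determinant 1, depend only on the residue class of the
  bottom row of \<open>A\<close>, so finitely many matrices \<open>A\<close> suffice. For each of them the points with
  \<open>Im z \<ge> 1/5\<close> correspond to a compact disc in the variable \<open>nome N z\<close> including the cusp,
  and by \<open>ex_mob_Im_ge\<close> these discs cover everything. Hence the real part attains its maximum at an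
  interior point of one of the unit discs.
\<close>
lemma invariant_Re_imp_constant:
  fixes K :: "complex \<Rightarrow> complex"
  assumes N: "N > 0"
    and cusps: "\<And>a b c d. a * d - b * c = (1::int) \<Longrightarrow>
        \<exists>k. k holomorphic_on ball 0 1 \<and> (\<forall>z\<in>\<H>. K (mob a b c d z) = k (nome N z))"
    and inv: "\<And>a b c d z. a * d - b * c = (1::int) \<Longrightarrow> int N dvd c \<Longrightarrow> z \<in> \<H> \<Longrightarrow>
        Re (K (mob a b c d z)) = Re (K z)"
  obtains \<kappa> where "\<And>z. z \<in> \<H> \<Longrightarrow> K z = \<kappa>"
proof -
  define Mats where "Mats = {(a, b, c, d). a * d - b * c = (1::int)}"
  define act where "act = (\<lambda>(a, b, c, d). mob a b c d)"
  define res where "res = (\<lambda>(a :: int, b :: int, c :: int, d :: int). (c mod int N, d mod int N))"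
  have "\<forall>A. A \<in> Mats \<longrightarrow> (\<exists>k. k holomorphic_on ball 0 1 \<and> (\<forall>z\<in>\<H>. K (act A z) = k (nome N z)))"
    using cusps by (auto simp: Mats_def act_def)
  then obtain k where "\<forall>A. A \<in> Mats \<longrightarrow> k A holomorphic_on ball 0 1 \<and> (\<forall>z\<in>\<H>. K (act A z) = k A (nome N z))"
    by (subst (asm) choice_iff') blast
  hence k: "\<And>A. A \<in> Mats \<Longrightarrow> k A holomorphic_on ball 0 1"
     "\<And>A z. A \<in> Mats \<Longrightarrow> z \<in> \<H> \<Longrightarrow> K (act A z) = k A (nome N z)"
    by blast+
  have same: "Re (K (act A z)) = Re (K (act A' z))"
    if A: "A \<in> Mats" "A' \<in> Mats" "res A = res A'" and z: "z \<in> \<H>" for A A' z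
  proof -
    obtain a b c d where A_eq: "A = (a, b, c, d)" by (cases A)
    obtain a' b' c' d' where A'_eq: "A' = (a', b', c', d')" by (cases A')
    have det: "a * d - b * c = 1" "a' * d' - b' * c' = 1" using A by (auto simp: Mats_def A_eq A'_eq)
    let ?g1 = "a * d' - b * c'" and ?g2 = "b * a' - a * b'" and ?g3 = "c * d' - d * c'" and ?g4 = "d * a' - c * b'"
    have "?g1 * ?g4 - ?g2 * ?g3 = (a * d - b * c) * (a' * d' - b' * c')"
      by (simp add: algebra_simps)
    hence g: "?g1 * ?g4 - ?g2 * ?g3 = 1" using det by simp
    have "[c = c'] (mod int N)" "[d' = d] (mod int N)" using A(3) by (auto simp: A_eq A'_eq res_def cong_def)
    hence "[c * d' = c' * d] (mod int N)" by (rule cong_mult)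
    hence dvd: "int N dvd ?g3" by (simp add: cong_iff_dvd_diff mult.commute)
    have "act A z = mob ?g1 ?g2 ?g3 ?g4 (act A' z)"
    proof -
      have e1: "?g1 * a' + ?g2 * c' = a * (a' * d' - b' * c')" by (simp add: algebra_simps)
      have e2: "?g1 * b' + ?g2 * d' = b * (a' * d' - b' * c')" by (simp add: algebra_simps)
      have e3: "?g3 * a' + ?g4 * c' = c * (a' * d' - b' * c')" by (simp add: algebra_simps)
      have e4: "?g3 * b' + ?g4 * d' = d * (a' * d' - b' * c')" by (simp add: algebra_simps)
      show ?thesis unfolding A_eq A'_eq act_def prod.case mob_mob[OF det(2) z] e1 e2 e3 e4 det(2) by simp
    qed
    moreover have "act A' z \<in> \<H>" using mob_in_uhp[OF det(2) z] by (simp add: A'_eq act_def)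
    ultimately show ?thesis using inv[OF g dvd] by simp
  qed
  define rep where "rep = (\<lambda>r. SOME A. A \<in> Mats \<and> res A = r)"
  have rep: "rep (res A) \<in> Mats" "res (rep (res A)) = res A" if "A \<in> Mats" for A
    using someI[of "\<lambda>A'. A' \<in> Mats \<and> res A' = res A" A] that by (auto simp: rep_def)
  define R where "R = rep ` res ` Mats"
  have "res ` Mats \<subseteq> {0..<int N} \<times> {0..<int N}" using N by (auto simp: res_def)
  hence fin: "finite R" unfolding R_def by (meson finite_SigmaI finite_atLeastLessThan_int finite_imageI finite_subset)
  have RM: "R \<subseteq> Mats" using rep by (auto simp: R_def)
  have "(1, 0, 0, 1) \<in> Mats" by (simp add: Mats_def)
  hence ne: "R \<noteq> {}" by (auto simp: R_def)
  \<comment> \<open>The disc of radius \<open>r\<close> is the image of the points with \<open>Im z \<ge> 1/5\<close>, with the cusp added.\<close>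
  define r where "r = exp (- 2 * pi * (1 / 5) / real N)"
  have r: "0 \<le> r" "r < 1" using N by (auto simp: r_def)
  hence sub: "cball 0 r \<subseteq> ball (0::complex) 1" by auto
  have "\<forall>A. A \<in> Mats \<longrightarrow> (\<exists>q\<in>cball 0 r. \<forall>q'\<in>cball 0 r. Re (k A q') \<le> Re (k A q))"
  proof (intro allI impI continuous_attains_sup)
    fix A assume "A \<in> Mats"
    from holomorphic_on_subset[OF k(1)[OF this] sub] show "continuous_on (cball 0 r) (\<lambda>q. Re (k A q))"
      by (intro continuous_on_Re holomorphic_on_imp_continuous_on)
  qed (use r in auto)
  then obtain m where "\<forall>A. A \<in> Mats \<longrightarrow> m A \<in> cball 0 r \<and> (\<forall>q'\<in>cball 0 r. Re (k A q') \<le> Re (k A (m A)))"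
    unfolding Bex_def by (subst (asm) choice_iff') blast
  hence m: "\<And>A. A \<in> Mats \<Longrightarrow> m A \<in> cball 0 r"
    "\<And>A q'. A \<in> Mats \<Longrightarrow> q' \<in> cball 0 r \<Longrightarrow> Re (k A q') \<le> Re (k A (m A))"
    by blast+
  obtain A0 where A0: "A0 \<in> R" "\<And>A. A \<in> R \<Longrightarrow> Re (k A (m A)) \<le> Re (k A0 (m A0))"
  proof -
    have "Max ((\<lambda>A. Re (k A (m A))) ` R) \<in> (\<lambda>A. Re (k A (m A))) ` R"
      using fin ne by (intro Max_in) auto
    then obtain A0 where "A0 \<in> R" "Max ((\<lambda>A. Re (k A (m A))) ` R) = Re (k A0 (m A0))" by auto
    moreover have "Re (k A (m A)) \<le> Max ((\<lambda>A. Re (k A (m A))) ` R)" if "A \<in> R" for A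
      using fin that by (intro Max_ge) auto
    ultimately show ?thesis using that[of A0] by simp
  qed
  have A0M: "A0 \<in> Mats" using A0(1) RM by blast
  have bound: "Re (k A0 q) \<le> Re (k A0 (m A0))" if q: "q \<in> ball 0 1" for q
  proof (cases "q = 0")
    case True
    thus ?thesis using m(2)[OF A0M, of 0] r by simp
  next
    case False
    then obtain z where z: "z \<in> \<H>" "nome N z = q" using ex_nome[OF N False] q by auto
    obtain a b c d :: int where B: "a * d - b * c = 1" "Im (mob a b c d z) \<ge> 1 / 5"
      using ex_mob_Im_ge[OF z(1)] .
    define w where "w = mob a b c d z"
    have w: "w \<in> \<H>" using mob_in_uhp[OF B(1) z(1)] by (simp add: w_def)
    have B': "d * a - (-b) * (-c) = 1" using B(1) by (simp add: algebra_simps)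
    have zw: "z = mob d (-b) (-c) a w" using mob_inverse[OF B' z(1)] by (simp add: w_def)
    obtain a0 b0 c0 d0 where A0_eq: "A0 = (a0, b0, c0, d0)" by (cases A0)
    \<comment> \<open>The product of \<open>A0\<close> and the inverse of the matrix that moves \<open>z\<close> to \<open>w\<close>.\<close>
    define A where "A = (a0 * d + b0 * (-c), a0 * (-b) + b0 * a, c0 * d + d0 * (-c), c0 * (-b) + d0 * a)"
    have det0: "a0 * d0 - b0 * c0 = 1" using A0M by (simp add: A0_eq Mats_def)
    have "(a0 * d + b0 * (-c)) * (c0 * (-b) + d0 * a) - (a0 * (-b) + b0 * a) * (c0 * d + d0 * (-c))
       = (a0 * d0 - b0 * c0) * (a * d - b * c)" by (simp add: algebra_simps)
    hence A: "A \<in> Mats" using det0 B(1) by (simp add: A_def Mats_def)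
    have Aw: "act A0 z = act A w" unfolding zw act_def A0_eq A_def prod.case by (rule mob_mob[OF B' w])
    let ?A' = "rep (res A)"
    have A': "?A' \<in> R" using A by (simp add: R_def)
    hence A'M: "?A' \<in> Mats" using RM by blast
    have "norm (nome N w) \<le> r"
      unfolding norm_nome r_def using B(2) N by (simp add: w_def field_simps)
    hence nw: "nome N w \<in> cball 0 r" by simp
    have "Re (k A0 q) = Re (K (act A0 z))" using k(2)[OF A0M z(1)] z(2) by simp
    also have "\<dots> = Re (K (act ?A' w))" unfolding Aw using rep[OF A] by (intro same[OF A A'M _ w]) simp
    also have "\<dots> = Re (k ?A' (nome N w))" using k(2)[OF A'M w] by simp
    also have "\<dots> \<le> Re (k ?A' (m ?A'))" by (rule m(2)[OF A'M nw])
    also have "\<dots> \<le> Re (k A0 (m A0))" by (rule A0(2)[OF A'])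
    finally show ?thesis .
  qed
  obtain \<kappa> where \<kappa>: "\<And>q. q \<in> ball 0 1 \<Longrightarrow> k A0 q = \<kappa>"
    using constant_if_Re_attains_max[OF k(1)[OF A0M] _ bound] m(1)[OF A0M] sub by blast
  show ?thesis
  proof (rule that[of \<kappa>])
    fix z assume z: "z \<in> \<H>"
    obtain a b c d where A0_eq: "A0 = (a, b, c, d)" by (cases A0)
    have det: "a * d - b * c = 1" using A0M by (simp add: A0_eq Mats_def)
    hence det': "d * a - (-b) * (-c) = 1" by (simp add: algebra_simps)
    have w: "mob d (-b) (-c) a z \<in> \<H>" by (rule mob_in_uhp[OF det' z])
    have "K z = K (act A0 (mob d (-b) (-c) a z))" using mob_inverse[OF det z] by (simp add: act_def A0_eq)
    also have "\<dots> = \<kappa>" using k(2)[OF A0M w] \<kappa>[OF nome_in_ball[OF N w]] by simp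
    finally show "K z = \<kappa>" .
  qed
qed

lemma mob_reflect:
  "- cnj (mob a b c d z) = mob a (-b) (-c) d (- cnj z)"
  by (simp add: mob_def divide_simps)

lemma nome_reflect: "nome N (- cnj z) = cnj (nome N z)"
  by (simp add: nome_def exp_cnj)

text \<open>
  With \<open>G(z) = cnj (F(-cnj z))\<close> the function \<open>H(z) = F(z) + F(-cnj z)\<close> has real part
  \<open>Re (F + G)\<close> and imaginary part \<open>Re (-\<i> F + \<i> G)\<close>. By assumption the periods of \<open>F\<close> at a
  matrix and at its conjugate under \<open>z \<mapsto> -cnj z\<close> cancel, so \<open>H\<close> is invariant under
  \<open>Gamma0 N\<close>. Therefore \<open>F + G\<close> and \<open>-\<i> F + \<i> G\<close> are constant, and with them \<open>F\<close>.
\<close>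
lemma even_boundary_value_zero:
  assumes N: "N > 0" and F: "cusp_primitive N F"
    and zero: "\<And>a b c d. a * d - b * c = 1 \<Longrightarrow> int N dvd c \<Longrightarrow>
      cusp_at (boundary_value F) a c + cusp_at (boundary_value F) a (-c) = 0"
    and z: "z \<in> \<H>"
  shows "F z = 0"
proof -
  define G where "G = (\<lambda>z. cnj (F (- cnj z)))"
  have refl: "- cnj z \<in> \<H>" if "z \<in> \<H>" for z using that by (simp add: in_uhp_iff)
  have cusp: "\<exists>k. k holomorphic_on ball 0 1 \<and> (\<forall>z\<in>\<H>. r * F (mob a b c d z) + s * G (mob a b c d z) = k (nome N z))"
    if det: "a * d - b * c = 1" for a b c d r s
  proof -
    have det': "a * d - (-b) * (-c) = 1" using det by simp
    obtain k where k: "k holomorphic_on ball 0 1" "\<And>z. z \<in> \<H> \<Longrightarrow> F (mob a b c d z) = k (nome N z)"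
      using cusp_primitive_at_cusp[OF F det] by blast
    obtain l where l: "l holomorphic_on ball 0 1" "\<And>z. z \<in> \<H> \<Longrightarrow> F (mob a (-b) (-c) d z) = l (nome N z)"
      using cusp_primitive_at_cusp[OF F det'] by blast
    have "(cnj \<circ> l \<circ> cnj) holomorphic_on ball 0 1"
      using l(1) by (subst holomorphic_on_compose_cnj_cnj) (auto simp: image_iff)
    moreover have "G (mob a b c d z) = (cnj \<circ> l \<circ> cnj) (nome N z)" if "z \<in> \<H>" for z
      using l(2)[OF refl[OF that]] by (simp add: G_def mob_reflect nome_reflect)
    ultimately obtain l' where l': "l' holomorphic_on ball 0 1" "\<And>z. z \<in> \<H> \<Longrightarrow> G (mob a b c d z) = l' (nome N z)"
      by blast
    show ?thesis
      by (rule exI[of _ "\<lambda>q. r * k q + s * l' q"]) (use k l' in \<open>auto intro!: holomorphic_intros\<close>)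
  qed
  have inv: "F (mob a b c d z) + F (- cnj (mob a b c d z)) = F z + F (- cnj z)"
    if det: "a * d - b * c = 1" and dvd: "int N dvd c" and z: "z \<in> \<H>" for a b c d z
  proof -
    have det': "a * d - (-b) * (-c) = 1" and dvd': "int N dvd - c" using det dvd by simp_all
    show ?thesis
      using cusp_primitive_period_eq[OF N F det dvd z] cusp_primitive_period_eq[OF N F det' dvd' refl[OF z]]
        zero[OF det dvd] by (simp add: mob_reflect)
  qed
  have ReIm: "Re (1 * F z + 1 * G z) = Re (F z + F (- cnj z))" "Re ((-\<i>) * F z + \<i> * G z) = Im (F z + F (- cnj z))" for z
    by (simp_all add: G_def)
  obtain \<kappa>1 where \<kappa>1: "\<And>z. z \<in> \<H> \<Longrightarrow> 1 * F z + 1 * G z = \<kappa>1"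
    by (rule invariant_Re_imp_constant[OF N, of "\<lambda>z. 1 * F z + 1 * G z"])
       (use cusp inv in \<open>simp_all only: ReIm\<close>)
  obtain \<kappa>2 where \<kappa>2: "\<And>z. z \<in> \<H> \<Longrightarrow> (-\<i>) * F z + \<i> * G z = \<kappa>2"
    by (rule invariant_Re_imp_constant[OF N, of "\<lambda>z. (-\<i>) * F z + \<i> * G z"])
       (use cusp inv in \<open>simp_all only: ReIm\<close>)
  have const: "F z = (\<kappa>1 + \<i> * \<kappa>2) / 2" if "z \<in> \<H>" for z
  proof -
    have "\<i> * \<kappa>2 = F z - G z" by (simp add: \<kappa>2[OF that, symmetric] algebra_simps)
    thus ?thesis by (simp add: \<kappa>1[OF that, symmetric])
  qed
  obtain k1 where k1: "k1 holomorphic_on ball 0 1" "k1 0 = 0" "\<And>z. z \<in> \<H> \<Longrightarrow> F z = k1 (nome N z)"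
    using cusp_primitive_at_infinity[OF F] by blast
  have "((\<lambda>y. k1 (nome N (\<i> * of_real y))) \<longlongrightarrow> k1 0) at_top"
    by (intro holomorphic_on_ball_tendsto[OF k1(1)] tendsto_nome[OF N]) (simp add: filterlim_ident)
  moreover have "eventually (\<lambda>y. k1 (nome N (\<i> * of_real y)) = (\<kappa>1 + \<i> * \<kappa>2) / 2) at_top"
    using eventually_gt_at_top[of "0::real"]
  proof eventually_elim
    case (elim y)
    hence "\<i> * of_real y \<in> \<H>" by (simp add: in_uhp_iff)
    with k1(3)[OF this] const[OF this] show ?case by simp
  qed
  ultimately have "((\<lambda>y::real. (\<kappa>1 + \<i> * \<kappa>2) / 2) \<longlongrightarrow> k1 0) at_top"
    by (rule Lim_transform_eventually)
  hence "(\<kappa>1 + \<i> * \<kappa>2) / 2 = 0" by (simp add: k1(2) tendsto_const_iff)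
  with const[OF z] show ?thesis by simp
qed

section \<open>Symbols modulo a prime and their relations\<close>

lemma coprime_bezout_mod:
  assumes "coprime a (c::int)"
  shows "[a * (fst (bezout_coefficients a c) mod c) = 1] (mod c)"
proof -
  have "fst (bezout_coefficients a c) * a + snd (bezout_coefficients a c) * c = 1"
    using bezout_coefficients_fst_snd[of a c] assms by simp
  hence "fst (bezout_coefficients a c) * a = 1 - snd (bezout_coefficients a c) * c" by simp
  hence "[fst (bezout_coefficients a c) * a = 1] (mod c)"
    by (simp add: cong_iff_dvd_diff)
  thus ?thesis by (simp add: cong_def mod_mult_right_eq mult.commute)
qed

locale prime_level =
  fixes N :: nat
  assumes prime_N: "prime N" and N_ge: "N > 3"
begin

lemma int_prime: "prime (int N)" using prime_N by simp

text \<open>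
  The inverse modulo \<open>N\<close> by Fermat's theorem; as a polynomial it is defined for all integers and
  sends multiples of \<open>N\<close> to multiples of \<open>N\<close>.
\<close>
definition invr :: "int \<Rightarrow> int" where "invr t = t ^ (N - 2)"

lemma invr:
  assumes "\<not> int N dvd t"
  shows "[t * invr t = 1] (mod int N)"
proof -
  define m where "m = nat (t mod int N)"
  have m: "int m = t mod int N" using N_ge by (simp add: m_def)
  have "\<not> N dvd m"
  proof
    assume "N dvd m"
    hence "int N dvd t mod int N" by (simp only: m[symmetric] int_dvd_int_iff)
    with assms show False by (simp add: dvd_mod_iff)
  qed
  hence "[m ^ (N - 1) = 1] (mod N)" by (intro fermat_theorem prime_N)
  hence "[int m ^ (N - 1) = 1] (mod int N)" by (metis cong_int_iff of_nat_1 of_nat_power)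
  moreover have "[int m ^ (N - 1) = t ^ (N - 1)] (mod int N)" by (simp add: m cong_def power_mod)
  ultimately have "[t ^ (N - 1) = 1] (mod int N)" by (metis cong_sym cong_trans)
  also have "N - 1 = Suc (N - 2)" using N_ge by simp
  finally show ?thesis by (simp add: invr_def)
qed

lemma invr_dvd: "int N dvd t \<Longrightarrow> int N dvd invr t"
  using N_ge unfolding invr_def by (intro dvd_trans[OF _ dvd_power]) auto

lemma prime_dvd_mult_N: "int N dvd a * b \<longleftrightarrow> int N dvd a \<or> int N dvd b"
  using prime_dvd_mult_iff[OF int_prime] .

lemma cong_mult_cancel_N:
  assumes "\<not> int N dvd a"
  shows "[a * x = a * y] (mod int N) \<longleftrightarrow> [x = y] (mod int N)"
  using prime_dvd_mult_N[of a "x - y"] assms by (simp add: cong_iff_dvd_diff right_diff_distrib)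

lemma quotient_cong:
  assumes "\<not> int N dvd d"
  shows "[c * invr d * d = c] (mod int N)"
proof -
  have "c * invr d * d = c * (d * invr d)" by (simp add: mult_ac)
  also have "[\<dots> = c * 1] (mod int N)" by (intro cong_mult invr assms cong_refl)
  finally show ?thesis by simp
qed

lemma quotient_not_dvd:
  assumes "\<not> int N dvd c" "\<not> int N dvd d"
  shows "\<not> int N dvd c * invr d"
proof
  assume "int N dvd c * invr d"
  hence "int N dvd c * invr d * d" by (rule dvd_mult2)
  thus False using cong_dvd_iff[OF quotient_cong[OF assms(2), of c]] assms(1) by simp
qed

lemma not_dvd_1 [simp]: "\<not> int N dvd 1" "\<not> int N dvd -1"
  using N_ge by auto

text \<open>
  Functions on the projective line over the field with \<open>N\<close> elements with the symmetries of an even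
  modular symbol: \<open>y t\<close> is the symbol of the point \<open>t\<close>. The value at 0 (and, implicitly,
  at infinity) is normalized to 0, which amounts to subtracting a function that is constant on each
  of the two classes of cusps.
\<close>
definition symbol_fn :: "(int \<Rightarrow> 'a::ring_1) \<Rightarrow> bool" where
  "symbol_fn y \<longleftrightarrow> (\<forall>s t. [s = t] (mod int N) \<longrightarrow> y s = y t) \<and> (\<forall>t. int N dvd t \<longrightarrow> y t = 0) \<and>
     (\<forall>t. y (-t) = y t) \<and> (\<forall>s t. [s * t = 1] (mod int N) \<longrightarrow> y s = - y t)"

lemma symbol_fn_cong: "symbol_fn y \<Longrightarrow> [s = t] (mod int N) \<Longrightarrow> y s = y t"
  and symbol_fn_dvd: "symbol_fn y \<Longrightarrow> int N dvd t \<Longrightarrow> y t = 0"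
  and symbol_fn_minus: "symbol_fn y \<Longrightarrow> y (-t) = y t"
  and symbol_fn_inverse: "symbol_fn y \<Longrightarrow> [s * t = 1] (mod int N) \<Longrightarrow> y s = - y t"
  unfolding symbol_fn_def by blast+

lemma eq_uminus_self_imp_zero: "x = - x \<Longrightarrow> x = (0 :: 'a :: {idom, ring_char_0})"
proof -
  assume "x = - x"
  hence "2 * x = 0" by (metis eq_neg_iff_add_eq_0 mult_2)
  thus "x = 0" by simp
qed

lemma symbol_fn_one:
  assumes "symbol_fn (y :: int \<Rightarrow> 'a :: {idom, ring_char_0})" "[t = 1] (mod int N) \<or> [t = -1] (mod int N)"
  shows "y t = 0"
proof -
  have "y 1 = - y 1" by (rule symbol_fn_inverse[OF assms(1)]) simp
  hence "y 1 = 0" by (rule eq_uminus_self_imp_zero)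
  with assms symbol_fn_cong[OF assms(1)] symbol_fn_minus[OF assms(1), of 1] show ?thesis by metis
qed

text \<open>
  The defect of the three-term relation of the points \<open>t\<close>, \<open>1/(1 - t)\<close>, \<open>(t - 1)/t\<close>.
\<close>
definition tri :: "(int \<Rightarrow> 'a::ring_1) \<Rightarrow> int \<Rightarrow> 'a" where
  "tri y t = y t - y (t - 1) + y ((t - 1) * invr t)"

definition manin :: "(int \<Rightarrow> 'a::ring_1) \<Rightarrow> bool" where
  "manin y \<longleftrightarrow> symbol_fn y \<and> (\<forall>t. \<not> int N dvd t \<longrightarrow> tri y t = 0)"

text \<open>
  The symbol of an edge of the Farey tessellation: the edge between the two columns of a matrix
  of determinant 1 with bottom row \<open>(c, d)\<close>. It takes the value 0 if \<open>N\<close> divides \<open>c\<close> or \<open>d\<close>.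
\<close>
definition edge :: "(int \<Rightarrow> 'a) \<Rightarrow> int \<Rightarrow> int \<Rightarrow> 'a" where
  "edge y c d = y (c * invr d)"

lemma edge_zero:
  assumes "symbol_fn y" "int N dvd c \<or> int N dvd d"
  shows "edge y c d = 0"
proof -
  from assms(2) have "int N dvd c * invr d"
  proof
    assume "int N dvd d"
    from invr_dvd[OF this] show ?thesis by (rule dvd_mult)
  qed (rule dvd_mult2)
  thus ?thesis unfolding edge_def by (rule symbol_fn_dvd[OF assms(1)])
qed

lemma edge_swap:
  assumes y: "symbol_fn y"
  shows "edge y d c = - edge y c d"
proof (cases "int N dvd c \<or> int N dvd d")
  case True
  thus ?thesis using edge_zero[OF y, of c d] edge_zero[OF y, of d c] by auto
next
  case False
  hence "[(d * invr d) * (c * invr c) = 1 * 1] (mod int N)" by (intro cong_mult invr) auto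
  thus ?thesis unfolding edge_def by (intro symbol_fn_inverse[OF y]) (simp add: mult_ac)
qed

lemma edge_minus_left: "symbol_fn y \<Longrightarrow> edge y (-c) d = edge y c d"
  by (simp add: edge_def symbol_fn_minus)

lemma edge_minus_right: "symbol_fn y \<Longrightarrow> edge y c (-d) = edge y c d"
  using edge_swap[of y c "-d"] edge_swap[of y c d] edge_minus_left[of y d c] by simp

lemma edge_cong:
  assumes y: "symbol_fn y" and d: "\<not> int N dvd d" and eq: "[c = t * d] (mod int N)"
  shows "edge y c d = y t"
  unfolding edge_def
proof (rule symbol_fn_cong[OF y])
  have "[c * invr d = (t * d) * invr d] (mod int N)" by (intro cong_mult eq) simp
  also have "(t * d) * invr d = t * (d * invr d)" by simp
  also have "[t * (d * invr d) = t * 1] (mod int N)" by (intro cong_mult invr d) simp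
  finally show "[c * invr d = t] (mod int N)" by simp
qed

text \<open>
  The three-term relation for the Farey triangle with vertices \<open>(a, c)\<close>, \<open>(b, d)\<close> and
  \<open>(a + b, c + d)\<close>. The degenerate cases, in which \<open>N\<close> divides one of the lower entries, hold since
  \<open>y 1 = 0\<close>.
\<close>
lemma edge_triangle:
  assumes y: "manin (y :: int \<Rightarrow> 'a :: {idom, ring_char_0})"
  shows "edge y c d = edge y c (c + d) + edge y (c + d) d"
proof -
  have s: "symbol_fn y" using y by (simp add: manin_def)
  consider "int N dvd c" "int N dvd d" | "int N dvd c" "\<not> int N dvd d" | "\<not> int N dvd c" "int N dvd d"
    | "\<not> int N dvd c" "\<not> int N dvd d" "int N dvd c + d"
    | "\<not> int N dvd c" "\<not> int N dvd d" "\<not> int N dvd c + d" by blast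
  thus ?thesis
  proof cases
    case 1
    thus ?thesis using edge_zero[OF s, of c] edge_zero[OF s, of "c + d" d] by simp
  next
    case 2
    have "edge y (c + d) d = y 1" using 2 by (intro edge_cong[OF s]) (auto simp: cong_iff_dvd_diff)
    also have "y 1 = 0" by (rule symbol_fn_one[OF s]) simp
    finally show ?thesis using edge_zero[OF s, of c] 2 by simp
  next
    case 3
    have nd: "\<not> int N dvd c + d" using 3 by (metis dvd_add_left_iff)
    have "edge y c (c + d) = y 1" using 3 nd by (intro edge_cong[OF s]) (auto simp: cong_iff_dvd_diff)
    also have "y 1 = 0" by (rule symbol_fn_one[OF s]) simp
    finally show ?thesis using edge_zero[OF s, of _ d] 3 by simp
  next
    case 4
    have "edge y c d = y (-1)" using 4 by (intro edge_cong[OF s]) (auto simp: cong_iff_dvd_diff)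
    also have "y (-1) = 0" by (rule symbol_fn_one[OF s]) simp
    finally show ?thesis using edge_zero[OF s, of c "c + d"] edge_zero[OF s, of "c + d" d] 4 by simp
  next
    case 5
    define t where "t = (c + d) * invr d"
    have td: "[t * d = c + d] (mod int N)" unfolding t_def by (rule quotient_cong[OF 5(2)])
    have nt: "\<not> int N dvd t" unfolding t_def by (rule quotient_not_dvd[OF 5(3,2)])
    have e1: "edge y c d = y (t - 1)"
      by (rule edge_cong[OF s 5(2)]) (use td in \<open>simp add: cong_iff_dvd_diff algebra_simps dvd_diff_commute\<close>)
    have e2: "edge y (c + d) d = y t" by (simp add: edge_def t_def)
    have e3: "edge y c (c + d) = y ((t - 1) * invr t)"
    proof (rule edge_cong[OF s 5(3)])
      have "[(t - 1) * invr t * (c + d) = (t - 1) * invr t * (t * d)] (mod int N)"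
        by (intro cong_mult cong_sym[OF td]) auto
      also have "(t - 1) * invr t * (t * d) = (t * d - d) * (t * invr t)" by (simp add: algebra_simps)
      also have "[\<dots> = ((c + d) - d) * 1] (mod int N)" by (intro cong_mult cong_diff td invr nt) simp
      finally show "[c = (t - 1) * invr t * (c + d)] (mod int N)" by (simp add: cong_sym_eq)
    qed
    have "tri y t = 0" using y nt by (simp add: manin_def)
    thus ?thesis unfolding e1 e2 e3 tri_def by (simp add: algebra_simps)
  qed
qed

text \<open>
  Integration of a symbol along Farey edges from infinity to \<open>a/c\<close>: the next cusp \<open>b/d\<close> on the path
  is the neighbour of \<open>a/c\<close> with the denominator \<open>0 \<le> d < c\<close>. Integers get the value 0, as the
  edges from infinity to integers have symbol 0.
\<close>
function recon :: "(int \<Rightarrow> 'a::ring_1) \<Rightarrow> int \<Rightarrow> int \<Rightarrow> 'a" where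
  "recon y a c = (if c \<le> 1 then 0 else
     let d = fst (bezout_coefficients a c) mod c
     in recon y ((a * d - 1) div c) d + edge y c d)"
  by auto
termination by (relation "Wellfounded.measure (\<lambda>(y, a, c). nat c)") auto

declare recon.simps [simp del]

lemma recon_small: "c \<le> 1 \<Longrightarrow> recon y a c = 0"
  by (simp add: recon.simps)

lemma recon_step:
  assumes "a * d - b * c = 1" "1 < c" "0 \<le> d" "d < c"
  shows "recon y a c = recon y b d + edge y c d"
proof -
  let ?d = "fst (bezout_coefficients a c) mod c"
  have "coprime a c"
  proof (rule coprimeI)
    fix g assume "g dvd a" "g dvd c"
    hence "g dvd a * d - b * c" by (intro dvd_diff) auto
    with assms(1) show "is_unit g" by simp
  qed
  from coprime_bezout_mod[OF this] have 1: "[a * ?d = 1] (mod c)" .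
  have 2: "[a * d = 1] (mod c)" using assms(1) by (simp add: cong_iff_dvd_diff algebra_simps)
  have "[a * ?d = a * d] (mod c)" using 1 2 by (metis cong_sym cong_trans)
  hence "[?d = d] (mod c)" using \<open>coprime a c\<close> by (simp add: cong_mult_lcancel)
  hence "?d = d" using assms by (simp add: cong_def)
  moreover have "(a * d - 1) div c = b"
  proof -
    have "a * d - 1 = b * c" using assms(1) by simp
    thus ?thesis using assms(2) by simp
  qed
  ultimately show ?thesis using assms(2) by (subst recon.simps) (simp add: Let_def)
qed

text \<open>
  Euclid's algorithm. For \<open>d < c\<close> this is the recursion itself. For \<open>c < d\<close> the vector
  \<open>(b, d)\<close> is the sum of \<open>(a, c)\<close> and its own predecessor \<open>(b - a, d - c)\<close>, and the assertion
  follows from the relation for the triangle that they span.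
\<close>
lemma recon_edge:
  assumes y: "manin (y :: int \<Rightarrow> 'a :: {idom, ring_char_0})"
  shows "a * d - b * c = 1 \<Longrightarrow> 0 \<le> c \<Longrightarrow> 0 \<le> d \<Longrightarrow> recon y a c - recon y b d = edge y c d"
proof (induction "nat (c + d)" arbitrary: a b c d rule: less_induct)
  case less
  note det = less.prems(1)
  have s: "symbol_fn y" using y by (simp add: manin_def)
  consider "c = 0" | "d = 0" | "c > 0" "d > 0" "c = d" | "0 < d" "d < c" | "0 < c" "c < d"
    using less.prems by linarith
  thus ?case
  proof cases
    case 1
    hence "d = 1" using det less.prems by (auto simp: zmult_eq_1_iff)
    thus ?thesis using 1 edge_zero[OF s] by (simp add: recon_small)
  next
    case 2
    hence "1 = c * (-b)" using det by (simp add: mult.commute)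
    hence "c dvd 1" by (rule dvdI)
    hence "c = 1" using less.prems(2) by simp
    thus ?thesis using 2 edge_zero[OF s] by (simp add: recon_small)
  next
    case 3
    hence "c * (a - b) = 1" using det by (simp add: algebra_simps)
    hence "c = 1" using 3 by (auto simp: zmult_eq_1_iff)
    moreover have "edge y 1 1 = 0" unfolding edge_def by (rule symbol_fn_one[OF s]) (simp add: invr_def)
    ultimately show ?thesis using 3 by (simp add: recon_small)
  next
    case 4
    have "recon y a c = recon y b d + edge y c d" by (rule recon_step[OF det]) (use 4 in auto)
    thus ?thesis by simp
  next
    case 5
    have det': "b * (d - c) - (b - a) * d = 1" "a * (d - c) - (b - a) * c = 1"
      using det by (simp_all add: algebra_simps)
    have "recon y b d = recon y (b - a) (d - c) + edge y d (d - c)"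
      by (rule recon_step[OF det'(1)]) (use 5 in auto)
    moreover have "recon y a c - recon y (b - a) (d - c) = edge y c (d - c)"
      by (rule less.hyps[OF _ det'(2)]) (use 5 in auto)
    moreover have "edge y c (d - c) = edge y c d + edge y d (d - c)"
      using edge_triangle[OF y, of c "d - c"] by simp
    ultimately show ?thesis by (simp add: algebra_simps)
  qed
qed

definition cusp_fn :: "(int \<Rightarrow> 'a::ring_1) \<Rightarrow> rat \<Rightarrow> 'a" where
  "cusp_fn y x = (case quotient_of x of (a, c) \<Rightarrow> recon y a c)"

end

lemma quotient_of_coprime_frac:
  assumes "coprime a c" "c > 0"
  shows "quotient_of (of_int a / of_int c) = (a, c)"
  using assms by (simp add: Fract_of_int_quotient[symmetric] quotient_of_Fract Rat.normalize_def)

lemma cusp_at_minus: "cusp_at C (-a) (-c) = cusp_at C a c"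
  by (simp add: cusp_at_def)

lemma det_imp_coprime:
  assumes "a * d - b * c = (1::int)"
  shows "coprime a c" "coprime b d" "coprime c d"
proof -
  have *: "is_unit g" if "g dvd a * d - b * c" for g using that assms by simp
  show "coprime a c" "coprime b d" "coprime c d"
    by (rule coprimeI, rule *, intro dvd_diff, simp_all)+
qed

text \<open>
  Any two cusps are connected by a path of Farey edges.
\<close>
lemma cusp_induct:
  fixes P :: "int \<Rightarrow> int \<Rightarrow> bool"
  assumes base: "P 1 0" and step: "\<And>a b c d. a * d - b * c = 1 \<Longrightarrow> P a c \<Longrightarrow> P b d"
    and cop: "coprime a c"
  shows "P a c"
  using cop
proof (induction "nat \<bar>c\<bar>" arbitrary: a c rule: less_induct)
  case less
  show ?case
  proof (cases "c = 0")
    case True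
    hence "a = 1 \<or> a = -1" using less.prems by auto
    moreover have "P 0 1" by (rule step[OF _ base, of 1 0]) simp
    hence "P (-1) 0" by (rule step[rotated]) simp
    ultimately show ?thesis using base True by auto
  next
    case False
    \<comment> \<open>A neighbour of \<open>a/c\<close> with smaller denominator, placed in the first column so that it precedes \<open>a/c\<close>.\<close>
    let ?d = "- (fst (bezout_coefficients a \<bar>c\<bar>) mod \<bar>c\<bar>)"
    have "[a * (fst (bezout_coefficients a \<bar>c\<bar>) mod \<bar>c\<bar>) = 1] (mod \<bar>c\<bar>)"
      using less.prems by (intro coprime_bezout_mod) simp
    hence "c dvd a * ?d + 1" by (simp add: cong_iff_dvd_diff dvd_diff_commute)
    then obtain b where "a * ?d + 1 = c * b" by blast
    hence det: "b * c - a * ?d = 1" by (simp add: algebra_simps)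
    have "nat \<bar>?d\<bar> < nat \<bar>c\<bar>" using False by simp
    from less.hyps[OF this] det_imp_coprime(1)[OF det] have "P b ?d" by blast
    thus ?thesis by (rule step[OF det])
  qed
qed

context prime_level
begin

lemma cusp_at_cusp_fn:
  assumes "coprime a c" "c \<ge> 0"
  shows "cusp_at (cusp_fn y) a c = recon y a c"
proof (cases "c = 0")
  case False
  with assms have "quotient_of (of_int a / of_int c) = (a, c)" by (intro quotient_of_coprime_frac) auto
  with False show ?thesis by (simp add: cusp_at_def cusp_fn_def)
qed (simp add: cusp_at_def recon_small)

lemma cusp_fn_edge:
  assumes y: "manin (y :: int \<Rightarrow> 'a :: {idom, ring_char_0})" and det: "a * d - b * c = 1"
  shows "cusp_at (cusp_fn y) a c - cusp_at (cusp_fn y) b d = edge y c d"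
proof -
  have s: "symbol_fn y" using y by (simp add: manin_def)
  have pos: "cusp_at (cusp_fn y) a c - cusp_at (cusp_fn y) b d = edge y c d"
    if "a * d - b * c = 1" "0 \<le> c" "0 \<le> d" for a b c d
    unfolding cusp_at_cusp_fn[OF det_imp_coprime(1)[OF that(1)] that(2)]
      cusp_at_cusp_fn[OF det_imp_coprime(2)[OF that(1)] that(3)]
    by (rule recon_edge[OF y that])
  have half: "cusp_at (cusp_fn y) a c - cusp_at (cusp_fn y) b d = edge y c d"
    if det: "a * d - b * c = 1" and "0 \<le> c" for a b c d
  proof (cases "d \<ge> 0")
    case False
    have "(-b) * c - a * (-d) = 1" using det by (simp add: algebra_simps)
    from pos[OF this] False that(2)
    have "cusp_at (cusp_fn y) b d - cusp_at (cusp_fn y) a c = edge y d c"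
      using cusp_at_minus[of "cusp_fn y" b d] edge_minus_left[OF s] by simp
    thus ?thesis using edge_swap[OF s, of d c] by (simp add: algebra_simps)
  qed (use that pos in auto)
  show ?thesis
  proof (cases "c \<ge> 0")
    case False
    have "(-a) * (-d) - (-b) * (-c) = 1" using det by simp
    from half[OF this] False show ?thesis
      by (simp add: cusp_at_minus edge_minus_left[OF s] edge_minus_right[OF s])
  qed (use half[OF det] in auto)
qed

lemma cusp_fn_unique:
  assumes y: "manin (y :: int \<Rightarrow> 'a :: {idom, ring_char_0})"
    and C: "\<And>a b c d. a * d - b * c = 1 \<Longrightarrow> cusp_at C a c - cusp_at C b d = edge y c d"
  shows "C = cusp_fn y"
proof
  fix x
  obtain a c where "quotient_of x = (a, c)" and x: "x = of_int a / of_int c" "c > 0" "coprime a c"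
    by (rule rat_lowest_terms[of x])
  have "cusp_at C a c = cusp_at (cusp_fn y) a c"
    using x(3)
  proof (rule cusp_induct[rotated 2])
    fix a b c d :: int assume det: "a * d - b * c = 1" and IH: "cusp_at C a c = cusp_at (cusp_fn y) a c"
    have "cusp_at C a c - cusp_at C b d = cusp_at C a c - cusp_at (cusp_fn y) b d"
      using C[OF det] cusp_fn_edge[OF y det] IH by simp
    thus "cusp_at C b d = cusp_at (cusp_fn y) b d" by simp
  qed (simp add: cusp_at_def)
  with x show "C x = cusp_fn y x" by (simp add: cusp_at_def)
qed

lemma recon_sum:
  "recon (\<lambda>t. \<Sum>i\<in>I. r i * y i t :: 'a::comm_ring_1) a c = (\<Sum>i\<in>I. r i * recon (y i) a c)"
proof (induction "nat c" arbitrary: a c rule: less_induct)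
  case less
  show ?case
  proof (cases "c \<le> 1")
    case False
    let ?d = "fst (bezout_coefficients a c) mod c"
    have "nat ?d < nat c" using False by simp
    note IH = less.hyps[OF this]
    have rec: "recon y a c = recon y ((a * ?d - 1) div c) ?d + edge y c ?d" for y :: "int \<Rightarrow> 'a"
      using False by (subst recon.simps) (simp add: Let_def)
    show ?thesis
      by (simp only: rec IH edge_def distrib_left sum.distrib)
  qed (simp add: recon_small)
qed

lemma recon_of_int: "recon (\<lambda>t. of_int (y t)) a c = of_int (recon y a c)"
proof (induction "nat c" arbitrary: a c rule: less_induct)
  case less
  show ?case
  proof (cases "c \<le> 1")
    case False
    let ?d = "fst (bezout_coefficients a c) mod c"
    have "nat ?d < nat c" using False by simp
    note IH = less.hyps[OF this]
    have rec: "recon z a c = recon z ((a * ?d - 1) div c) ?d + edge z c ?d" for z :: "int \<Rightarrow> 'x::ring_1"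
      using False by (subst recon.simps) (simp add: Let_def)
    show ?thesis
      by (simp only: rec IH edge_def of_int_add)
  qed (simp add: recon_small)
qed

lemma cusp_fn_sum: "cusp_fn (\<lambda>t. \<Sum>i\<in>I. r i * y i t :: 'a::comm_ring_1) x = (\<Sum>i\<in>I. r i * cusp_fn (y i) x)"
  by (simp add: cusp_fn_def recon_sum split: prod.splits)

lemma cusp_fn_of_int: "cusp_fn (\<lambda>t. of_int (y t)) x = of_int (cusp_fn y x)"
  by (simp add: cusp_fn_def recon_of_int split: prod.splits)

end

section \<open>Symbols of quasi-periodic functions\<close>

context prime_level
begin

text \<open>
  Two matrices of determinant 1 with proportional bottom rows modulo \<open>N\<close> differ by a factor in
  \<open>Gamma0 N\<close> on the left.
\<close>
lemma quasi_periodic_edge: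
  assumes C: "quasi_periodic N C" and det: "a * d - b * c = 1" and det': "a' * d' - b' * c' = 1"
    and eq: "[c' * d = d' * c] (mod int N)"
  shows "cusp_at C a c - cusp_at C b d = cusp_at C a' c' - cusp_at C b' d'"
proof -
  \<comment> \<open>The quotient of the two matrices; \<open>?g3\<close> is its lower left entry.\<close>
  let ?g1 = "a' * d - b' * c" and ?g2 = "b' * a - a' * b" and ?g3 = "c' * d - d' * c" and ?g4 = "d' * a - c' * b"
  have "?g1 * ?g4 - ?g2 * ?g3 = (a * d - b * c) * (a' * d' - b' * c')" by (simp add: algebra_simps)
  hence g: "?g1 * ?g4 - ?g2 * ?g3 = 1" using det det' by simp
  have dvd: "int N dvd ?g3" using eq by (simp add: cong_iff_dvd_diff)
  have act: "cusp_at C (?g1 * x + ?g2 * y) (?g3 * x + ?g4 * y) = cusp_at C x y + cusp_at C ?g1 ?g3"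
    if "coprime x y" for x y
    using C g dvd that unfolding quasi_periodic_def by blast
  have e1: "?g1 * a + ?g2 * c = a' * (a * d - b * c)" "?g3 * a + ?g4 * c = c' * (a * d - b * c)"
    and e2: "?g1 * b + ?g2 * d = b' * (a * d - b * c)" "?g3 * b + ?g4 * d = d' * (a * d - b * c)"
    by (simp_all add: algebra_simps)
  show ?thesis
    using act[OF det_imp_coprime(1)[OF det]] act[OF det_imp_coprime(2)[OF det]]
    unfolding e1 e2 det by simp
qed

definition symbol_of :: "(rat \<Rightarrow> complex) \<Rightarrow> int \<Rightarrow> complex" where
  "symbol_of C t = (if int N dvd t then 0 else C (1 / of_int t) - C 0)"

lemma symbol_of_eq: "\<not> int N dvd t \<Longrightarrow> symbol_of C t = cusp_at C 1 t - cusp_at C 0 1"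
  by (auto simp: symbol_of_def cusp_at_def)

lemma even_cusp_at:
  assumes "\<And>x. C (-x) = C x"
  shows "cusp_at C (-a) c = cusp_at C a c" "cusp_at C a (-c) = cusp_at C a c"
  using assms[of "of_int a / of_int c"] by (simp_all add: cusp_at_def)

text \<open>
  Each relation compares two matrices of determinant 1 with proportional bottom rows: the
  identity for the inverse uses the matrix with rows \<open>(0, -1)\<close> and \<open>(1, -t)\<close>, and the three-term
  relation the matrix with columns \<open>(1, t - 1)\<close> and \<open>(1, t)\<close>.
\<close>
lemma manin_symbol_of:
  assumes C: "quasi_periodic N C" and even: "\<And>x. C (-x) = C x"
  shows "manin (symbol_of C)"
proof -
  note ev = even_cusp_at[of C, OF even]
  have S: "symbol_fn (symbol_of C)"
    unfolding symbol_fn_def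
  proof (intro conjI allI impI)
    fix s t assume st: "[s = t] (mod int N)"
    hence iff: "int N dvd s \<longleftrightarrow> int N dvd t" by (rule cong_dvd_iff)
    show "symbol_of C s = symbol_of C t"
    proof (cases "int N dvd t")
      case False
      have "cusp_at C 1 s - cusp_at C 0 1 = cusp_at C 1 t - cusp_at C 0 1"
        by (rule quasi_periodic_edge[OF C]) (use st in \<open>auto simp: cong_sym_eq\<close>)
      thus ?thesis using False iff by (simp add: symbol_of_eq)
    qed (simp add: symbol_of_def iff)
  next
    fix t assume "int N dvd t"
    thus "symbol_of C t = 0" by (simp add: symbol_of_def)
  next
    fix t
    show "symbol_of C (-t) = symbol_of C t"
      using even[of "1 / of_int t"] by (simp add: symbol_of_def)
  next
    fix s t assume st: "[s * t = 1] (mod int N)"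
    have nd: "\<not> int N dvd s" "\<not> int N dvd t"
      using st not_dvd_1(1) by (metis cong_dvd_iff dvd_mult dvd_mult2)+
    have "cusp_at C 0 1 - cusp_at C (-1) (-t) = cusp_at C 1 (-s) - cusp_at C 0 1"
      by (rule quasi_periodic_edge[OF C]) (use st in auto)
    thus "symbol_of C s = - symbol_of C t"
      using nd by (simp add: symbol_of_eq ev)
  qed
  moreover have "tri (symbol_of C) t = 0" if t: "\<not> int N dvd t" for t
  proof (cases "int N dvd t - 1")
    case True
    have "symbol_of C t = 0" by (rule symbol_fn_one[OF S]) (use True in \<open>simp add: cong_iff_dvd_diff\<close>)
    moreover have "symbol_of C (t - 1) = 0" "symbol_of C ((t - 1) * invr t) = 0"
      using True by (simp_all add: symbol_of_def)
    ultimately show ?thesis by (simp add: tri_def)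
  next
    case False
    let ?s = "(t - 1) * invr t"
    have st: "[t * ?s = t - 1] (mod int N)" using quotient_cong[OF t, of "t - 1"] by (simp add: mult.commute)
    have ns: "\<not> int N dvd ?s" by (rule quotient_not_dvd[OF False t])
    have "cusp_at C 1 ?s - cusp_at C 0 1 = cusp_at C 1 (t - 1) - cusp_at C 1 t"
      by (rule quasi_periodic_edge[OF C]) (use st in \<open>auto simp: cong_sym_eq\<close>)
    thus ?thesis unfolding tri_def using t False ns by (simp add: symbol_of_eq)
  qed
  ultimately show ?thesis by (simp add: manin_def)
qed

text \<open>
  The correction on the cusps with denominator prime to \<open>N\<close> accounts for the normalization of
  symbols at 0 and infinity.
\<close>
lemma cusp_fn_symbol_of:
  assumes C: "quasi_periodic N C" and even: "\<And>x. C (-x) = C x"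
  shows "cusp_fn (symbol_of C) x = C x - (if int N dvd snd (quotient_of x) then 0 else C 0)"
proof -
  define D where "D = (\<lambda>x. C x - (if int N dvd snd (quotient_of x) then 0 else C 0))"
  have D: "cusp_at D a c = cusp_at C a c - (if int N dvd c then 0 else C 0)" if "coprime a c" for a c
  proof -
    consider "c = 0" | "c > 0" | "c < 0" by linarith
    thus ?thesis
    proof cases
      case 2
      thus ?thesis using quotient_of_coprime_frac[OF that 2] by (simp add: cusp_at_def D_def)
    next
      case 3
      have "quotient_of (of_int (-a) / of_int (-c)) = (-a, -c)"
        using 3 that by (intro quotient_of_coprime_frac) auto
      thus ?thesis using 3 by (simp add: cusp_at_def D_def)
    qed (simp add: cusp_at_def)
  qed
  have S: "symbol_fn (symbol_of C)" using manin_symbol_of[OF assms] by (simp add: manin_def)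
  have "D = cusp_fn (symbol_of C)"
  proof (rule cusp_fn_unique[OF manin_symbol_of[OF assms]])
    fix a b c d :: int assume det: "a * d - b * c = 1"
    note cop = det_imp_coprime[OF det]
    have not_both: "\<not> (int N dvd c \<and> int N dvd d)"
      using cop(3) not_dvd_1(1) coprime_common_divisor by blast
    have vals: "cusp_at C 1 0 = 0" "cusp_at C (-1) 0 = 0" "cusp_at C 0 1 = C 0"
      by (simp_all add: cusp_at_def)
    consider "int N dvd c" "\<not> int N dvd d" | "int N dvd d" "\<not> int N dvd c" | "\<not> int N dvd c" "\<not> int N dvd d"
      using not_both by blast
    thus "cusp_at D a c - cusp_at D b d = edge (symbol_of C) c d"
    proof cases
      case 1
      have "cusp_at C a c - cusp_at C b d = cusp_at C 1 0 - cusp_at C 0 1"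
        by (rule quasi_periodic_edge[OF C det]) (use 1 in \<open>auto simp: cong_iff_dvd_diff\<close>)
      hence "cusp_at C b d = cusp_at C a c + C 0" by (simp add: vals algebra_simps)
      thus ?thesis using 1 D[OF cop(1)] D[OF cop(2)] edge_zero[OF S, of c d] by simp
    next
      case 2
      have "cusp_at C a c - cusp_at C b d = cusp_at C 0 1 - cusp_at C (-1) 0"
        by (rule quasi_periodic_edge[OF C det]) (use 2 in \<open>auto simp: cong_iff_dvd_diff\<close>)
      thus ?thesis using 2 D[OF cop(1)] D[OF cop(2)] edge_zero[OF S, of c d] by (simp add: vals algebra_simps)
    next
      case 3
      let ?t = "c * invr d"
      have td: "[?t * d = c] (mod int N)" by (rule quotient_cong[OF 3(2)])
      have nt: "\<not> int N dvd ?t" by (rule quotient_not_dvd[OF 3])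
      have "cusp_at C a c - cusp_at C b d = cusp_at C 1 ?t - cusp_at C 0 1"
        by (rule quasi_periodic_edge[OF C det]) (use td in auto)
      thus ?thesis using 3 D[OF cop(1)] D[OF cop(2)] nt by (simp add: edge_def symbol_of_eq)
    qed
  qed
  thus ?thesis by (metis D_def)
qed

end

section \<open>Failures of the three-term relations\<close>

lemma dvd_cong_pm: "X = Y \<or> X = - Y \<Longrightarrow> (m::int) dvd X \<longleftrightarrow> m dvd Y"
  by auto

context prime_level
begin

text \<open>
  The sum of the signed indicator functions of the points \<open>j\<close>, \<open>-j\<close>, \<open>1/j\<close>, \<open>-1/j\<close>. Coinciding
  points are counted with multiplicity; this makes the identities below hold without exceptions.
\<close>
definition unit_sym :: "int \<Rightarrow> int \<Rightarrow> int" where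
  "unit_sym j t = of_bool [t = j] (mod int N) + of_bool [t = -j] (mod int N)
     - of_bool [t * j = 1] (mod int N) - of_bool [t * j = -1] (mod int N)"

text \<open>
  The signed indicator function of the orbit of \<open>j\<close> under the anharmonic group generated by
  \<open>t \<mapsto> 1/t\<close> and \<open>t \<mapsto> 1 - t\<close>, again with multiplicities. The elements
  \<open>j\<close>, \<open>1/(1 - j)\<close>, \<open>(j - 1)/j\<close> have sign 1.
\<close>
definition tri_unit :: "int \<Rightarrow> int \<Rightarrow> int" where
  "tri_unit j t = of_bool [t = j] (mod int N) + of_bool [t * (1 - j) = 1] (mod int N) + of_bool [t * j = j - 1] (mod int N)
     - of_bool [t * j = 1] (mod int N) - of_bool [t = 1 - j] (mod int N) - of_bool [t * (j - 1) = j] (mod int N)"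

lemma symbol_fn_unit_sym:
  assumes j: "\<not> int N dvd j"
  shows "symbol_fn (unit_sym j)"
  unfolding symbol_fn_def
proof (intro conjI allI impI)
  fix s t assume st: "[s = t] (mod int N)"
  have "[s * j = t * j] (mod int N)" by (intro cong_mult st) simp
  hence "[s * j = x] (mod int N) \<longleftrightarrow> [t * j = x] (mod int N)" "[s = x] (mod int N) \<longleftrightarrow> [t = x] (mod int N)" for x
    using st by (simp_all add: cong_def)
  thus "unit_sym j s = unit_sym j t" by (simp add: unit_sym_def)
next
  fix t assume t: "int N dvd t"
  hence "[t = 0] (mod int N)" "[t * j = 0] (mod int N)" by (simp_all add: cong_0_iff)
  hence *: "[t * j = x] (mod int N) \<longleftrightarrow> int N dvd x" "[t = x] (mod int N) \<longleftrightarrow> int N dvd x" for x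
    by (metis cong_0_iff cong_sym_eq cong_trans)+
  show "unit_sym j t = 0" unfolding unit_sym_def * using j N_ge by simp
next
  fix t
  have "[-t = j] (mod int N) \<longleftrightarrow> [t = -j] (mod int N)" "[-t = -j] (mod int N) \<longleftrightarrow> [t = j] (mod int N)"
    "[-t * j = 1] (mod int N) \<longleftrightarrow> [t * j = -1] (mod int N)" "[-t * j = -1] (mod int N) \<longleftrightarrow> [t * j = 1] (mod int N)"
    unfolding cong_iff_dvd_diff by (rule dvd_cong_pm, simp)+
  thus "unit_sym j (-t) = unit_sym j t" by (simp add: unit_sym_def)
next
  fix s t assume st: "[s * t = 1] (mod int N)"
  hence ts: "[t * s = 1] (mod int N)" by (simp add: mult.commute)
  have nd: "\<not> int N dvd s" "\<not> int N dvd t"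
    using st not_dvd_1(1) by (metis cong_dvd_iff dvd_mult dvd_mult2)+
  have *: "[s = x] (mod int N) \<longleftrightarrow> [t * x = 1] (mod int N)"
    if "[t * s = 1] (mod int N)" "\<not> int N dvd t" for s t x
    using cong_mult_cancel_N[OF that(2), of s x] that(1) by (metis cong_sym_eq cong_trans)
  have m1: "[t * - x = 1] (mod int N) \<longleftrightarrow> [t * x = -1] (mod int N)" for t x
    unfolding cong_iff_dvd_diff by (rule dvd_cong_pm) simp
  show "unit_sym j s = - unit_sym j t"
    unfolding unit_sym_def *[OF ts nd(2)] *[OF st nd(1)] m1 by simp
qed

text \<open>
  An edge orbit \<open>\<plusminus>j, \<plusminus>1/j\<close> belongs to two triangle orbits: that of \<open>j\<close>, and that of \<open>-j\<close>,
  which is also the orbit of \<open>1 - (-j) = j + 1\<close> but with the opposite sign. That the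
  neighbour of \<open>j\<close> is \<open>j + 1\<close> makes the next sums telescope.
\<close>
lemma tri_unit_sym:
  assumes t: "\<not> int N dvd t"
  shows "tri (unit_sym j) t = tri_unit j t - tri_unit (j + 1) t"
proof -
  let ?x = "(t - 1) * invr t"
  have tx: "[t * ?x = t - 1] (mod int N)" using quotient_cong[OF t, of "t - 1"] by (simp add: mult.commute)
  have x1: "[?x = y] (mod int N) \<longleftrightarrow> [t - 1 = t * y] (mod int N)" for y
    using cong_mult_cancel_N[OF t, of ?x y] tx by (metis cong_sym_eq cong_trans)
  have x2: "[?x * j = y] (mod int N) \<longleftrightarrow> [(t - 1) * j = t * y] (mod int N)" for y
  proof -
    have "[t * ?x * j = (t - 1) * j] (mod int N)" by (intro cong_mult tx) simp
    hence "[t * (?x * j) = (t - 1) * j] (mod int N)" by (simp add: mult.assoc)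
    thus ?thesis using cong_mult_cancel_N[OF t, of "?x * j" y] by (metis cong_sym_eq cong_trans)
  qed
  have e: "[t - 1 = j] (mod int N) \<longleftrightarrow> [t = j + 1] (mod int N)"
    "[t - 1 = -j] (mod int N) \<longleftrightarrow> [t = 1 - j] (mod int N)"
    "[(t - 1) * j = 1] (mod int N) \<longleftrightarrow> [t * j = j + 1] (mod int N)"
    "[(t - 1) * j = -1] (mod int N) \<longleftrightarrow> [t * j = j - 1] (mod int N)"
    "[t - 1 = t * j] (mod int N) \<longleftrightarrow> [t * (1 - j) = 1] (mod int N)"
    "[t - 1 = t * - j] (mod int N) \<longleftrightarrow> [t * (1 + j) = 1] (mod int N)"
    "[(t - 1) * j = t * 1] (mod int N) \<longleftrightarrow> [t * (j - 1) = j] (mod int N)"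
    "[(t - 1) * j = t * - 1] (mod int N) \<longleftrightarrow> [t * (j + 1) = j] (mod int N)"
    "[t * (1 - (j + 1)) = 1] (mod int N) \<longleftrightarrow> [t * j = -1] (mod int N)"
    unfolding cong_iff_dvd_diff by (rule dvd_cong_pm, simp add: algebra_simps)+
  show ?thesis
    unfolding tri_def unit_sym_def tri_unit_def x1 x2 e
    by (simp add: algebra_simps)
qed

lemma tri_unit_1: "\<not> int N dvd t \<Longrightarrow> tri_unit 1 t = 0"
  using N_ge by (simp add: tri_unit_def cong_iff_dvd_diff)

text \<open>
  A path of edges from the triangle orbit of 1 to that of \<open>k\<close>. Since \<open>tri_unit 1\<close> is zero, the
  only triangle orbit at which the relation fails is that of \<open>k\<close>.
\<close>
definition path_sym :: "nat \<Rightarrow> int \<Rightarrow> int" where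
  "path_sym k t = - (\<Sum>j = 1..<k. unit_sym (int j) t)"

lemma tri_sum: "tri (\<lambda>t. \<Sum>i\<in>I. r i * y i t) t = (\<Sum>i\<in>I. r i * tri (y i) t)" for r :: "_ \<Rightarrow> 'a :: comm_ring_1"
  by (simp add: tri_def sum.distrib sum_subtractf algebra_simps)

lemma tri_diff: "tri (\<lambda>t. y t - z t) t = tri y t - tri z t"
  by (simp add: tri_def)

lemma tri_of_int: "tri (\<lambda>t. of_int (y t)) t = of_int (tri y t)"
  by (simp add: tri_def)

lemma symbol_fn_sum:
  assumes "\<And>i. i \<in> I \<Longrightarrow> symbol_fn (y i)"
  shows "symbol_fn (\<lambda>t. \<Sum>i\<in>I. r i * y i t :: 'a :: comm_ring_1)"
  using assms unfolding symbol_fn_def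
  by (auto intro!: sum.cong sum.neutral simp: sum_negf[symmetric])

lemma symbol_fn_diff: "symbol_fn y \<Longrightarrow> symbol_fn z \<Longrightarrow> symbol_fn (\<lambda>t. y t - z t)"
  unfolding symbol_fn_def by auto

lemma symbol_fn_of_int: "symbol_fn y \<Longrightarrow> symbol_fn (\<lambda>t. of_int (y t) :: 'a :: comm_ring_1)"
  unfolding symbol_fn_def by auto

lemma not_dvd_small: "0 < j \<Longrightarrow> j < N \<Longrightarrow> \<not> int N dvd int j"
  by (auto dest: nat_dvd_not_less simp: int_dvd_int_iff)

lemma symbol_fn_path_sym: "k \<le> N \<Longrightarrow> symbol_fn (path_sym k)"
proof -
  assume "k \<le> N"
  hence "symbol_fn (\<lambda>t. \<Sum>j = 1..<k. (-1) * unit_sym (int j) t)"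
    by (intro symbol_fn_sum symbol_fn_unit_sym not_dvd_small) auto
  thus ?thesis by (simp add: path_sym_def[abs_def] sum_negf)
qed

lemma tri_path_sym:
  assumes "\<not> int N dvd t" "k \<ge> 1"
  shows "tri (path_sym k) t = tri_unit (int k) t"
proof -
  have "tri (path_sym k) t = tri (\<lambda>t. \<Sum>j = 1..<k. (-1) * unit_sym (int j) t) t"
    by (simp add: path_sym_def[abs_def] sum_negf)
  also have "\<dots> = (\<Sum>j = 1..<k. - (tri_unit (int j) t - tri_unit (int (Suc j)) t))"
    unfolding tri_sum by (simp add: tri_unit_sym[OF assms(1)] add.commute)
  also have "\<dots> = tri_unit (int k) t - tri_unit (int 1) t"
    using assms(2) by (induction k rule: dec_induct) auto
  finally show ?thesis using tri_unit_1[OF assms(1)] by simp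
qed

definition vanishes_at_cube_roots :: "(int \<Rightarrow> 'a::zero) \<Rightarrow> bool" where
  "vanishes_at_cube_roots y \<longleftrightarrow> (\<forall>t. int N dvd t\<^sup>2 + t + 1 \<longrightarrow> y t = 0)"

lemma cube_root_not_dvd:
  assumes "int N dvd t\<^sup>2 + t + 1"
  shows "\<not> int N dvd t" "\<not> int N dvd t + 1"
proof -
  have "\<not> int N dvd t * (t + 1)"
  proof
    assume "int N dvd t * (t + 1)"
    hence "int N dvd (t\<^sup>2 + t + 1) - t * (t + 1)" by (intro dvd_diff assms)
    thus False using N_ge by (simp add: power2_eq_square algebra_simps)
  qed
  thus "\<not> int N dvd t" "\<not> int N dvd t + 1" by (auto simp: prime_dvd_mult_N)
qed

text \<open>
  The points whose orbit under the anharmonic group has six elements. At the others the three-term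
  relation follows from the symmetries and the vanishing at the cube roots of unity; compare
  \<open>tri_non_generic\<close>.
\<close>
definition generic :: "nat set" where
  "generic = {v\<in>{1..<N}. \<not> int N dvd (int v)\<^sup>2 - int v + 1 \<and> \<not> int N dvd (int v)\<^sup>2 - 1 \<and>
     \<not> int N dvd 2 * int v - 1 \<and> \<not> int N dvd int v - 2}"

definition related :: "int \<Rightarrow> int \<Rightarrow> bool" where
  "related j t \<longleftrightarrow> [t = j] (mod int N) \<or> [t * (1 - j) = 1] (mod int N) \<or> [t * j = j - 1] (mod int N)
     \<or> [t * j = 1] (mod int N) \<or> [t = 1 - j] (mod int N) \<or> [t * (j - 1) = j] (mod int N)"

lemma tri_unit_unrelated: "\<not> related j t \<Longrightarrow> tri_unit j t = 0"
  by (simp add: related_def tri_unit_def)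

lemma tri_unit_self:
  assumes "v \<in> generic"
  shows "tri_unit (int v) (int v) = 1"
proof -
  let ?v = "int v"
  have nd: "\<not> int N dvd ?v" using assms by (auto simp: generic_def intro!: not_dvd_small)
  have "[?v * (1 - ?v) = 1] (mod int N) \<longleftrightarrow> int N dvd ?v\<^sup>2 - ?v + 1"
    "[?v * ?v = ?v - 1] (mod int N) \<longleftrightarrow> int N dvd ?v\<^sup>2 - ?v + 1"
    "[?v * ?v = 1] (mod int N) \<longleftrightarrow> int N dvd ?v\<^sup>2 - 1"
    "[?v = 1 - ?v] (mod int N) \<longleftrightarrow> int N dvd 2 * ?v - 1"
    "[?v * (?v - 1) = ?v] (mod int N) \<longleftrightarrow> int N dvd ?v * (?v - 2)"
    unfolding cong_iff_dvd_diff by (rule dvd_cong_pm, simp add: algebra_simps power2_eq_square)+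
  thus ?thesis using assms nd by (simp add: tri_unit_def generic_def prime_dvd_mult_N)
qed

lemma related_refl: "related t t"
  by (simp add: related_def)

lemma related_sym: "related s t \<Longrightarrow> related t s"
proof -
  have "[t = s] (mod int N) \<longleftrightarrow> [s = t] (mod int N)"
    "[t * (1 - s) = 1] (mod int N) \<longleftrightarrow> [s * t = t - 1] (mod int N)"
    "[t * s = s - 1] (mod int N) \<longleftrightarrow> [s * (1 - t) = 1] (mod int N)"
    "[t * s = 1] (mod int N) \<longleftrightarrow> [s * t = 1] (mod int N)"
    "[t = 1 - s] (mod int N) \<longleftrightarrow> [s = 1 - t] (mod int N)"
    "[t * (s - 1) = s] (mod int N) \<longleftrightarrow> [s * (t - 1) = t] (mod int N)"
    unfolding cong_iff_dvd_diff by (rule dvd_cong_pm, simp add: algebra_simps)+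
  thus "related s t \<Longrightarrow> related t s" unfolding related_def by blast
qed

lemma invr_cong: "[s = t] (mod int N) \<Longrightarrow> [invr s = invr t] (mod int N)"
  unfolding invr_def by (rule cong_pow)

lemma tri_eq_edge: "tri y t = y t - y (t - 1) + edge y (t - 1) t"
  by (simp add: tri_def edge_def)

lemma tri_cong:
  assumes y: "symbol_fn y" and st: "[s = t] (mod int N)"
  shows "tri y s = tri y t"
proof -
  have "y s = y t" by (rule symbol_fn_cong[OF y st])
  moreover have "y (s - 1) = y (t - 1)" by (rule symbol_fn_cong[OF y]) (intro cong_diff st cong_refl)
  moreover have "y ((s - 1) * invr s) = y ((t - 1) * invr t)"
    by (rule symbol_fn_cong[OF y]) (intro cong_mult invr_cong cong_diff st cong_refl)
  ultimately show ?thesis by (simp add: tri_def)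
qed

lemma tri_inverse:
  assumes y: "symbol_fn y" and st: "[s * t = 1] (mod int N)"
  shows "tri y s = - tri y t"
proof -
  have nd: "\<not> int N dvd s" "\<not> int N dvd t"
    using st not_dvd_1(1) by (metis cong_dvd_iff dvd_mult dvd_mult2)+
  have "y s = - y t" by (rule symbol_fn_inverse[OF y st])
  moreover have "edge y (s - 1) s = y (1 - t)"
    by (rule edge_cong[OF y nd(1)]) (use st in \<open>simp add: cong_iff_dvd_diff algebra_simps dvd_diff_commute\<close>)
  moreover have "edge y (t - 1) t = y (1 - s)"
    by (rule edge_cong[OF y nd(2)]) (use st in \<open>simp add: cong_iff_dvd_diff algebra_simps dvd_diff_commute\<close>)
  moreover have "y (s - 1) = y (1 - s)" "y (t - 1) = y (1 - t)"
    using symbol_fn_minus[OF y, of "1 - s"] symbol_fn_minus[OF y, of "1 - t"] by simp_all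
  ultimately show ?thesis by (simp add: tri_eq_edge)
qed

lemma tri_one_minus:
  assumes y: "symbol_fn y"
  shows "tri y (1 - t) = - tri y t"
proof -
  have "edge y (1 - t - 1) (1 - t) = edge y (- t) (- (t - 1))" by simp
  also have "\<dots> = edge y t (t - 1)"
    by (simp only: edge_minus_left[OF y] edge_minus_right[OF y])
  also have "\<dots> = - edge y (t - 1) t" by (rule edge_swap[OF y])
  finally have "edge y (1 - t - 1) (1 - t) = - edge y (t - 1) t" .
  moreover have "y (1 - t) = y (t - 1)" "y (1 - t - 1) = y t"
    using symbol_fn_minus[OF y, of "t - 1"] symbol_fn_minus[OF y, of t] by simp_all
  ultimately show ?thesis unfolding tri_eq_edge by simp
qed

text \<open>
  The defect is a multiple of the sign character along each orbit.
\<close>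
lemma tri_related:
  assumes y: "symbol_fn y" and "related v t"
  shows "tri y t = tri y v \<or> tri y t = - tri y v"
proof -
  have sub: "tri y t = - tri y (1 - t)" "tri y v = - tri y (1 - v)" using tri_one_minus[OF y] by simp_all
  from assms(2) consider "[t = v] (mod int N)" | "[t * (1 - v) = 1] (mod int N)" | "[t * v = v - 1] (mod int N)"
    | "[t * v = 1] (mod int N)" | "[t = 1 - v] (mod int N)" | "[t * (v - 1) = v] (mod int N)"
    unfolding related_def by blast
  thus ?thesis
  proof cases
    case 3
    hence "[(1 - t) * v = 1] (mod int N)"
      unfolding cong_iff_dvd_diff by (subst dvd_cong_pm[of _ "t * v - (v - 1)"]) (auto simp: algebra_simps)
    from tri_inverse[OF y this] sub show ?thesis by simp
  next
    case 6
    hence "[(1 - t) * (1 - v) = 1] (mod int N)"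
      unfolding cong_iff_dvd_diff by (subst dvd_cong_pm[of _ "t * (v - 1) - v"]) (auto simp: algebra_simps)
    from tri_inverse[OF y this] sub show ?thesis by simp
  qed (use tri_cong[OF y] tri_inverse[OF y] sub in \<open>metis minus_minus\<close>)+
qed

text \<open>
  Points with \<open>t\<^sup>2 = 1\<close>, \<open>2 t = 1\<close> or \<open>t = 2\<close> are fixed by an element of sign -1. The remaining
  ones are primitive sixth roots of unity, where all three terms vanish.
\<close>
lemma tri_non_generic:
  assumes y: "symbol_fn (y :: int \<Rightarrow> 'a :: {idom, ring_char_0})" "vanishes_at_cube_roots y"
    and t: "t \<in> {1..<N}" "t \<notin> generic"
  shows "tri y (int t) = 0"
proof -
  let ?t = "int t"
  note neg = eq_uminus_self_imp_zero[of "tri y ?t"]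
  have nd: "\<not> int N dvd ?t" using t by (auto intro!: not_dvd_small)
  from t consider "int N dvd ?t\<^sup>2 - ?t + 1" | "int N dvd ?t\<^sup>2 - 1" | "int N dvd 2 * ?t - 1" | "int N dvd ?t - 2"
    by (auto simp: generic_def)
  thus ?thesis
  proof cases
    case 1
    have y0: "y ?t = 0"
      using 1 y(2) symbol_fn_minus[OF y(1), of ?t] by (auto simp: vanishes_at_cube_roots_def dest: spec[of _ "-?t"])
    have "(?t - 1)\<^sup>2 + (?t - 1) + 1 = ?t\<^sup>2 - ?t + 1" by (simp add: power2_eq_square algebra_simps)
    hence y1: "y (?t - 1) = 0" using 1 y(2) unfolding vanishes_at_cube_roots_def by metis
    have "edge y (?t - 1) ?t = y ?t"
      by (rule edge_cong[OF y(1) nd])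
         (use 1 in \<open>simp add: cong_iff_dvd_diff algebra_simps power2_eq_square dvd_diff_commute\<close>)
    with y0 y1 show ?thesis by (simp add: tri_eq_edge)
  next
    case 2
    hence "[?t * ?t = 1] (mod int N)" by (simp add: cong_iff_dvd_diff power2_eq_square)
    from tri_inverse[OF y(1) this] show ?thesis by (rule neg)
  next
    case 3
    hence "[?t = 1 - ?t] (mod int N)" by (simp add: cong_iff_dvd_diff)
    from tri_cong[OF y(1) this] tri_one_minus[OF y(1), of ?t] show ?thesis by (intro neg) simp
  next
    case 4
    have "int N dvd ?t * (?t - 2)" using 4 by simp
    hence "[(1 - ?t) * (1 - ?t) = 1] (mod int N)"
      unfolding cong_iff_dvd_diff by (subst dvd_cong_pm[of _ "?t * (?t - 2)"]) (auto simp: algebra_simps)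
    from tri_inverse[OF y(1) this] tri_one_minus[OF y(1), of ?t] show ?thesis by (intro neg) simp
  qed
qed

end

section \<open>The projection onto solutions of the relations\<close>

lemma ex_maximal_independent:
  assumes "finite Y" "\<And>x. r x x" "\<And>x y. r x y \<Longrightarrow> r y x"
  shows "\<exists>R\<subseteq>Y. (\<forall>v\<in>R. \<forall>w\<in>R. v \<noteq> w \<longrightarrow> \<not> r v w) \<and> (\<forall>t\<in>Y. \<exists>v\<in>R. r v t)"
  using assms(1)
proof induction
  case empty
  show ?case by (rule exI[of _ "{}"]) simp
next
  case (insert x Y)
  from insert.IH obtain R where "R \<subseteq> Y \<and> (\<forall>v\<in>R. \<forall>w\<in>R. v \<noteq> w \<longrightarrow> \<not> r v w) \<and> (\<forall>t\<in>Y. \<exists>v\<in>R. r v t)" ..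
  hence R: "R \<subseteq> Y" "\<forall>v\<in>R. \<forall>w\<in>R. v \<noteq> w \<longrightarrow> \<not> r v w" "\<forall>t\<in>Y. \<exists>v\<in>R. r v t" by simp_all
  show ?case
  proof (cases "\<exists>v\<in>R. r v x")
    case True
    show ?thesis by (rule exI[of _ R]) (use R True in auto)
  next
    case False
    hence "\<not> r v x" "\<not> r x v" if "v \<in> R" for v using assms(3) that by metis+
    moreover have "r x x" by (rule assms(2))
    ultimately show ?thesis by (intro exI[of _ "insert x R"]) (use R in auto)
  qed
qed

context prime_level
begin

lemma small_cong_iff:
  assumes "i < N" "j < N"
  shows "[int i = int j] (mod int N) \<longleftrightarrow> i = j"
  unfolding cong_int_iff using assms by (simp add: cong_def)

lemma card_linear:
  assumes "\<not> int N dvd x"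
  shows "card {t\<in>{1..<N}. [int t * x = y] (mod int N)} \<le> 1"
proof -
  have "s = t" if "s \<in> {t\<in>{1..<N}. [int t * x = y] (mod int N)}" "t \<in> {t\<in>{1..<N}. [int t * x = y] (mod int N)}" for s t
  proof -
    have "[int s * x = y] (mod int N)" "[int t * x = y] (mod int N)" using that by simp_all
    hence "[x * int s = x * int t] (mod int N)"
      by (metis cong_sym cong_trans mult.commute)
    hence "[int s = int t] (mod int N)" using cong_mult_cancel_N[OF assms] by blast
    thus ?thesis using that by (simp add: small_cong_iff)
  qed
  thus ?thesis by (simp add: card_le_Suc0_iff_eq)
qed

lemma card_value: "card {t\<in>{1..<N}. [int t = y] (mod int N)} \<le> 1"
  using card_linear[OF not_dvd_1(1), of y] by simp

lemma card_quadratic: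
  "card {t\<in>{1..<N}. int N dvd (int t)\<^sup>2 - b * int t + c} \<le> 2"
proof (cases "{t\<in>{1..<N}. int N dvd (int t)\<^sup>2 - b * int t + c} = {}")
  case False
  then obtain s where s: "s \<in> {1..<N}" "int N dvd (int s)\<^sup>2 - b * int s + c" by auto
  have "{t\<in>{1..<N}. int N dvd (int t)\<^sup>2 - b * int t + c} \<subseteq>
     {t\<in>{1..<N}. [int t = int s] (mod int N)} \<union> {t\<in>{1..<N}. [int t = b - int s] (mod int N)}"
  proof safe
    fix t assume t: "t \<in> {1..<N}" "int N dvd (int t)\<^sup>2 - b * int t + c" "\<not> [int t = b - int s] (mod int N)"
    have "int N dvd ((int t)\<^sup>2 - b * int t + c) - ((int s)\<^sup>2 - b * int s + c)" by (intro dvd_diff t s)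
    also have "\<dots> = (int t - int s) * (int t - (b - int s))" by (simp add: power2_eq_square algebra_simps)
    finally show "[int t = int s] (mod int N)" using t(3) by (simp add: prime_dvd_mult_N cong_iff_dvd_diff)
  qed
  from card_mono[OF _ this] have "card {t\<in>{1..<N}. int N dvd (int t)\<^sup>2 - b * int t + c} \<le>
    card ({t\<in>{1..<N}. [int t = int s] (mod int N)} \<union> {t\<in>{1..<N}. [int t = b - int s] (mod int N)})" by simp
  also have "\<dots> \<le> card {t\<in>{1..<N}. [int t = int s] (mod int N)} + card {t\<in>{1..<N}. [int t = b - int s] (mod int N)}"
    by (rule card_Un_le)
  also have "\<dots> \<le> 1 + 1" by (intro add_mono card_value)
  finally show ?thesis by simp
next
  case True
  show ?thesis unfolding True by simp
qed

lemma not_dvd_2: "\<not> int N dvd 2"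
  using N_ge by (auto dest: zdvd_imp_le)

text \<open>
  The excluded points are the roots of two quadratic and two linear polynomials, and 0.
\<close>
lemma card_generic: "N \<le> card generic + 7"
proof -
  let ?A = "{t\<in>{1..<N}. int N dvd (int t)\<^sup>2 - 1 * int t + 1}"
  let ?B = "{t\<in>{1..<N}. int N dvd (int t)\<^sup>2 - 0 * int t + (-1)}"
  let ?C = "{t\<in>{1..<N}. [int t * 2 = 1] (mod int N)}"
  let ?D = "{t\<in>{1..<N}. [int t = 2] (mod int N)}"
  have "{1..<N} \<subseteq> generic \<union> (?A \<union> ?B \<union> (?C \<union> ?D))"
    by (auto simp: generic_def cong_iff_dvd_diff mult.commute)
  hence "card {1..<N} \<le> card (generic \<union> (?A \<union> ?B \<union> (?C \<union> ?D)))"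
    by (intro card_mono) (auto simp: generic_def)
  also have "\<dots> \<le> card generic + (card ?A + card ?B + (card ?C + card ?D))"
    by (intro order.trans[OF card_Un_le] add_mono order.refl)
  also have "\<dots> \<le> card generic + (2 + 2 + (1 + 1))"
    by (intro add_mono card_quadratic card_linear card_value not_dvd_2 order.refl)
  finally show ?thesis by simp
qed

lemma card_related:
  assumes v: "v \<in> generic"
  shows "card {t\<in>{1..<N}. related (int v) (int t)} \<le> 6"
proof -
  let ?v = "int v"
  have nd: "\<not> int N dvd ?v" using v by (auto simp: generic_def intro!: not_dvd_small)
  have "?v\<^sup>2 - 1 = (?v - 1) * (?v + 1)" by (simp add: power2_eq_square algebra_simps)
  hence nd1: "\<not> int N dvd ?v - 1" using v by (auto simp: generic_def)
  hence nd1': "\<not> int N dvd 1 - ?v" by (simp add: dvd_diff_commute)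
  let ?S = "\<lambda>x y. {t\<in>{1..<N}. [int t * x = y] (mod int N)}"
  have "{t\<in>{1..<N}. related ?v (int t)} \<subseteq> ?S 1 ?v \<union> ?S (1 - ?v) 1 \<union> ?S ?v (?v - 1) \<union> ?S ?v 1 \<union> ?S 1 (1 - ?v) \<union> ?S (?v - 1) ?v"
    by (auto simp: related_def)
  hence "card {t\<in>{1..<N}. related ?v (int t)} \<le> card (?S 1 ?v \<union> ?S (1 - ?v) 1 \<union> ?S ?v (?v - 1) \<union> ?S ?v 1 \<union> ?S 1 (1 - ?v) \<union> ?S (?v - 1) ?v)"
    by (intro card_mono) auto
  also have "\<dots> \<le> card (?S 1 ?v) + card (?S (1 - ?v) 1) + card (?S ?v (?v - 1)) + card (?S ?v 1) + card (?S 1 (1 - ?v)) + card (?S (?v - 1) ?v)"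
    by (intro order.trans[OF card_Un_le] add_mono order.refl)
  also have "\<dots> \<le> 1 + 1 + 1 + 1 + 1 + 1"
    by (intro add_mono card_linear nd nd1 nd1' not_dvd_1)
  finally show ?thesis by simp
qed

text \<open>
  A system of representatives of the generic orbits, obtained as a maximal set of points in
  different orbits.
\<close>
definition reps :: "nat set" where
  "reps = (SOME R. R \<subseteq> generic \<and> (\<forall>v\<in>R. \<forall>w\<in>R. v \<noteq> w \<longrightarrow> \<not> related (int v) (int w)) \<and>
     (\<forall>t\<in>generic. \<exists>v\<in>R. related (int v) (int t)))"

lemma reps:
  "reps \<subseteq> generic"
  "v \<in> reps \<Longrightarrow> w \<in> reps \<Longrightarrow> v \<noteq> w \<Longrightarrow> \<not> related (int v) (int w)"
  "t \<in> generic \<Longrightarrow> \<exists>v\<in>reps. related (int v) (int t)"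
proof -
  have fin: "finite generic" by (simp add: generic_def)
  have "\<exists>R\<subseteq>generic. (\<forall>v\<in>R. \<forall>w\<in>R. v \<noteq> w \<longrightarrow> \<not> related (int v) (int w)) \<and>
     (\<forall>t\<in>generic. \<exists>v\<in>R. related (int v) (int t))"
    by (rule ex_maximal_independent[OF fin]) (fact related_refl, fact related_sym)
  hence *: "reps \<subseteq> generic \<and> (\<forall>v\<in>reps. \<forall>w\<in>reps. v \<noteq> w \<longrightarrow> \<not> related (int v) (int w)) \<and>
     (\<forall>t\<in>generic. \<exists>v\<in>reps. related (int v) (int t))"
    unfolding reps_def by (rule someI_ex)
  show "reps \<subseteq> generic" using * by simp
  show "v \<in> reps \<Longrightarrow> w \<in> reps \<Longrightarrow> v \<noteq> w \<Longrightarrow> \<not> related (int v) (int w)" using * by simp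
  show "t \<in> generic \<Longrightarrow> \<exists>v\<in>reps. related (int v) (int t)" using * by simp
qed

lemma finite_reps: "finite reps"
  using reps(1) finite_subset[of reps generic] by (simp add: generic_def)

lemma reps_range: "v \<in> reps \<Longrightarrow> 1 \<le> v \<and> v < N"
  using reps(1) by (auto simp: generic_def)

text \<open>
  For \<open>N = 12 n + 1\<close> this gives at least \<open>2 n - 1\<close> orbits.
\<close>
lemma card_reps: "N \<le> 6 * card reps + 7"
proof -
  have "generic \<subseteq> (\<Union>v\<in>reps. {t\<in>{1..<N}. related (int v) (int t)})"
    using reps(3) by (auto simp: generic_def)
  hence "card generic \<le> card (\<Union>v\<in>reps. {t\<in>{1..<N}. related (int v) (int t)})"
    by (intro card_mono) (auto simp: finite_reps)
  also have "\<dots> \<le> (\<Sum>v\<in>reps. card {t\<in>{1..<N}. related (int v) (int t)})"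
    by (rule card_UN_le[OF finite_reps])
  also have "\<dots> \<le> (\<Sum>v\<in>reps. 6)" using reps(1) by (intro sum_mono card_related) auto
  finally show ?thesis using card_generic by simp
qed

lemma tri_path_sym_reps:
  assumes "v \<in> reps" "w \<in> reps"
  shows "tri (path_sym v) (int w) = of_bool (v = w)"
proof -
  have "tri (path_sym v) (int w) = tri_unit (int v) (int w)"
    using reps_range[OF assms(1)] reps_range[OF assms(2)] by (intro tri_path_sym not_dvd_small) auto
  thus ?thesis using tri_unit_self[of v] tri_unit_unrelated[OF reps(2)[OF assms]] reps(1) assms by auto
qed

text \<open>
  If \<open>t\<close> is a primitive cube root of unity with representative \<open>r\<close>, then
  the points \<open>t, -t, 1/t, -1/t\<close> are represented by \<open>r\<close>, \<open>N - r\<close>, \<open>N - 1 - r\<close> and \<open>r + 1\<close>. These are two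
  pairs of consecutive numbers carrying opposite signs, so the path picks up 0 unless it ends between
  the members of a pair, and then its end is a sixth root of unity.
\<close>
lemma path_sym_vanishes:
  assumes k: "k \<in> generic"
  shows "vanishes_at_cube_roots (path_sym k)"
  unfolding vanishes_at_cube_roots_def
proof (intro allI impI)
  fix t :: int assume t: "int N dvd t\<^sup>2 + t + 1"
  define r where "r = nat (t mod int N)"
  have "int r = t mod int N" using N_ge by (simp add: r_def)
  hence rt: "[int r = t] (mod int N)" by (simp only: cong_mod_left cong_refl)
  have rN: "r < N" using N_ge by (simp add: r_def nat_less_iff)
  note nt = cube_root_not_dvd(1)[OF t]
  note nt1 = cube_root_not_dvd(2)[OF t]
  have r0: "r \<noteq> 0"
  proof
    assume "r = 0"
    hence "[t = 0] (mod int N)" using rt by (simp add: cong_sym_eq)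
    thus False using nt by (simp add: cong_0_iff)
  qed
  have "r + 1 \<noteq> N"
  proof
    assume "r + 1 = N"
    hence "[int N = t + 1] (mod int N)" using rt cong_add_rcancel[of "int r" 1 t "int N"] by (metis of_nat_1 of_nat_add)
    hence "[t + 1 = 0] (mod int N)" by (metis cong_0_iff cong_sym cong_trans dvd_refl)
    thus False using nt1 by (simp add: cong_0_iff)
  qed
  hence r1: "r + 1 < N" using rN by simp
  have u: "unit_sym (int j) t = of_bool (j = r) + of_bool (j = N - r) - of_bool (j = N - 1 - r) - of_bool (j = r + 1)"
    if j: "j \<in> {1..<k}" for j
  proof -
    have jN: "j < N" using j k by (auto simp: generic_def)
    have shift: "[t = x] (mod int N) \<longleftrightarrow> [int r = x] (mod int N)" "[x = t] (mod int N) \<longleftrightarrow> [x = int r] (mod int N)" for x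
      using rt by (metis cong_sym cong_trans)+
    have 1: "[t = int j] (mod int N) \<longleftrightarrow> j = r"
      unfolding shift using jN rN by (auto simp: small_cong_iff)
    have 2: "[t = - int j] (mod int N) \<longleftrightarrow> j = N - r"
    proof -
      have "[int r = - int j] (mod int N) \<longleftrightarrow> [int j = int (N - r)] (mod int N)"
      proof -
        have "int j - int (N - r) = (int r - (- int j)) + (-1) * int N" using rN by (simp add: of_nat_diff)
        thus ?thesis by (simp only: cong_iff_dvd_diff dvd_add_times_triv_right_iff)
      qed
      also have "\<dots> \<longleftrightarrow> j = N - r" using jN r0 by (intro small_cong_iff) auto
      finally show ?thesis unfolding shift .
    qed
    have tt: "[t * (t + 1) = -1] (mod int N)" using t by (simp add: cong_iff_dvd_diff power2_eq_square algebra_simps)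
    have 4: "[t * int j = -1] (mod int N) \<longleftrightarrow> j = r + 1"
    proof -
      have "[t * int j = -1] (mod int N) \<longleftrightarrow> [t * int j = t * (t + 1)] (mod int N)"
        using tt by (metis cong_sym cong_trans)
      also have "\<dots> \<longleftrightarrow> [int j = t + 1] (mod int N)" by (rule cong_mult_cancel_N[OF nt])
      also have "\<dots> \<longleftrightarrow> [int j - 1 = t] (mod int N)" by (simp add: cong_iff_dvd_diff algebra_simps)
      also have "\<dots> \<longleftrightarrow> [int (j - 1) = int r] (mod int N)" unfolding shift using j by (simp add: of_nat_diff)
      also have "\<dots> \<longleftrightarrow> j - 1 = r" using jN rN by (intro small_cong_iff) auto
      finally show ?thesis using j by auto
    qed
    have 3: "[t * int j = 1] (mod int N) \<longleftrightarrow> j = N - 1 - r"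
    proof -
      have "[t * int j = 1] (mod int N) \<longleftrightarrow> [t * int (N - j) = -1] (mod int N)"
      proof -
        have "int N dvd t * int j - 1 \<longleftrightarrow> int N dvd - (t * int j - 1)" by (rule dvd_cong_pm) simp
        also have "\<dots> \<longleftrightarrow> int N dvd t * int N + - (t * int j - 1)"
          by (simp only: dvd_add_times_triv_left_iff)
        also have "t * int N + - (t * int j - 1) = t * int (N - j) - (-1)"
          using jN by (simp add: of_nat_diff algebra_simps)
        finally show ?thesis by (simp add: cong_iff_dvd_diff)
      qed
      also have "\<dots> \<longleftrightarrow> [t * int (N - j) = t * (t + 1)] (mod int N)"
        using tt by (metis cong_sym cong_trans)
      also have "\<dots> \<longleftrightarrow> [int (N - j) = t + 1] (mod int N)" by (rule cong_mult_cancel_N[OF nt])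
      also have "\<dots> \<longleftrightarrow> [int (N - j) - 1 = t] (mod int N)" by (simp add: cong_iff_dvd_diff algebra_simps)
      also have "\<dots> \<longleftrightarrow> [int (N - j - 1) = int r] (mod int N)" unfolding shift using jN by (simp add: of_nat_diff algebra_simps)
      also have "\<dots> \<longleftrightarrow> N - j - 1 = r" using jN rN by (intro small_cong_iff) auto
      finally show ?thesis using jN r1 by auto
    qed
    show ?thesis by (simp only: unit_sym_def 1 2 3 4)
  qed
  have knot: "k \<noteq> r + 1" "k \<noteq> N - r"
  proof -
    have rr: "[(int r)\<^sup>2 + int r + 1 = t\<^sup>2 + t + 1] (mod int N)"
      by (intro cong_add cong_pow rt cong_refl)
    hence rr': "int N dvd (int r)\<^sup>2 + int r + 1" using t by (simp add: cong_dvd_iff)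
    show "k \<noteq> r + 1"
    proof
      assume "k = r + 1"
      hence "(int k)\<^sup>2 - int k + 1 = (int r)\<^sup>2 + int r + 1" by (simp add: power2_eq_square algebra_simps)
      with rr' k show False by (simp add: generic_def)
    qed
    show "k \<noteq> N - r"
    proof
      assume "k = N - r"
      hence "(int k)\<^sup>2 - int k + 1 = int N * (int N - 2 * int r - 1) + ((int r)\<^sup>2 + int r + 1)"
        using rN by (simp add: power2_eq_square algebra_simps of_nat_diff)
      with rr' k show False by (simp add: generic_def dvd_add_right_iff)
    qed
  qed
  have "(\<Sum>j = 1..<k. unit_sym (int j) t) =
     (\<Sum>j = 1..<k. of_bool (j = r) + of_bool (j = N - r) - of_bool (j = N - 1 - r) - of_bool (j = r + 1))"
    by (rule sum.cong) (use u in auto)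
  also have "\<dots> = of_bool (r < k) + of_bool (N - r < k) - of_bool (N - 1 - r < k) - of_bool (r + 1 < k)"
  proof -
    have "(\<Sum>j = 1..<k. of_bool (j = c)) = (of_bool (c < k) :: int)" if "c \<ge> 1" for c
      using that by (simp add: of_bool_def sum.delta)
    thus ?thesis using r0 r1 by (simp add: sum.distrib sum_subtractf)
  qed
  also have "\<dots> = 0" using knot rN r1 by auto
  finally show "path_sym k t = 0" by (simp add: path_sym_def)
qed

text \<open>
  Removes the defect of \<open>y\<close> at each generic orbit, with integral coefficients.
\<close>
definition proj :: "(int \<Rightarrow> 'a::ring_1) \<Rightarrow> int \<Rightarrow> 'a" where
  "proj y t = y t - (\<Sum>v\<in>reps. tri y (int v) * of_int (path_sym v t))"

lemma manin_proj:
  assumes y: "symbol_fn (y :: int \<Rightarrow> 'a :: {idom, ring_char_0})" "vanishes_at_cube_roots y"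
  shows "manin (proj y)"
proof -
  have S: "symbol_fn (\<lambda>t. of_int (path_sym v t) :: 'a)" if "v \<in> reps" for v
    using reps_range[OF that] by (intro symbol_fn_of_int symbol_fn_path_sym) auto
  have S': "symbol_fn (proj y)"
    unfolding proj_def[abs_def] by (intro symbol_fn_diff y symbol_fn_sum S)
  have V: "vanishes_at_cube_roots (proj y)"
    using y(2) path_sym_vanishes reps(1) unfolding vanishes_at_cube_roots_def proj_def
    by (auto intro!: sum.neutral)
  have tri_reps: "tri (proj y) (int v) = 0" if v: "v \<in> reps" for v
  proof -
    have "tri (proj y) (int v) = tri y (int v) - (\<Sum>w\<in>reps. tri y (int w) * of_bool (w = v))"
      unfolding proj_def[abs_def] tri_diff tri_sum tri_of_int
      using v by (simp add: tri_path_sym_reps)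
    also have "(\<Sum>w\<in>reps. tri y (int w) * of_bool (w = v)) = tri y (int v)"
      using v finite_reps by (simp add: of_bool_def if_distrib sum.delta cong: if_cong)
    finally show ?thesis by simp
  qed
  have "tri (proj y) t = 0" if t: "\<not> int N dvd t" for t
  proof -
    define s where "s = nat (t mod int N)"
    have "int s = t mod int N" using N_ge by (simp add: s_def)
    hence st: "[t = int s] (mod int N)" by (simp only: cong_mod_right cong_refl)
    have "s < N" using N_ge by (simp add: s_def nat_less_iff)
    moreover have "s \<noteq> 0" using st t by (metis cong_0_iff of_nat_0)
    ultimately have s: "s \<in> {1..<N}" by simp
    have "tri (proj y) (int s) = 0"
    proof (cases "s \<in> generic")
      case True
      then obtain v where "v \<in> reps" "related (int v) (int s)" using reps(3) by blast
      thus ?thesis using tri_related[OF S'] tri_reps by fastforce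
    qed (rule tri_non_generic[OF S' V s])
    thus ?thesis using tri_cong[OF S' st] by simp
  qed
  with S' show ?thesis by (simp add: manin_def)
qed

lemma proj_manin:
  assumes "manin y"
  shows "proj y = y"
proof
  fix t
  have "tri y (int v) = 0" if "v \<in> reps" for v
    using assms reps_range[OF that] not_dvd_small[of v] by (auto simp: manin_def)
  thus "proj y t = y t" by (simp add: proj_def)
qed

text \<open>
  At the primitive sixth root of unity \<open>-t\<close> the three terms of the relation are equal, so
  \<open>3 y(t) = 0\<close>.
\<close>
lemma manin_vanishes:
  assumes y: "manin (y :: int \<Rightarrow> 'a :: {idom, ring_char_0})"
  shows "vanishes_at_cube_roots y"
  unfolding vanishes_at_cube_roots_def
proof (intro allI impI)
  fix t :: int assume t: "int N dvd t\<^sup>2 + t + 1"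
  have S: "symbol_fn y" using y by (simp add: manin_def)
  note nt = cube_root_not_dvd(1)[OF t]
  have "y (1 + t) = - y (- t)"
    by (rule symbol_fn_inverse[OF S])
       (use t in \<open>simp add: cong_iff_dvd_diff power2_eq_square algebra_simps dvd_diff_commute\<close>,
        use t in \<open>subst dvd_cong_pm[of _ "t\<^sup>2 + t + 1"], simp_all add: power2_eq_square algebra_simps\<close>)
  moreover have "edge y (- t - 1) (- t) = y (- t)"
    by (rule edge_cong[OF S]) (use nt t in \<open>simp_all add: cong_iff_dvd_diff power2_eq_square\<close>,
        use t in \<open>subst dvd_cong_pm[of _ "t\<^sup>2 + t + 1"], simp_all add: power2_eq_square algebra_simps\<close>)
  moreover have "tri y (- t) = 0" using y nt by (simp add: manin_def)
  moreover have "y (- t - 1) = y (1 + t)"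
  proof -
    have "- t - 1 = - (1 + t)" by simp
    thus ?thesis by (simp only: symbol_fn_minus[OF S])
  qed
  ultimately have "2 * y t = - y t"
    using symbol_fn_minus[OF S, of t] by (simp add: tri_eq_edge)
  hence sum0: "2 * y t + y t = 0" by simp
  have "3 * y t = (2 + 1) * y t" by simp
  also have "\<dots> = 2 * y t + y t" by (simp only: distrib_right mult_1_left)
  also note sum0
  finally have "3 * y t = 0" .
  thus "y t = 0" by simp
qed

end

section \<open>The Hecke operator on symbols, and coordinates\<close>

lemma hecke_cusps_sum:
  "hecke_cusps p (\<lambda>x. \<Sum>i\<in>I. r i * C i x) x = (\<Sum>i\<in>I. r i * hecke_cusps p (C i) x)" for r :: "_ \<Rightarrow> 'a :: comm_ring_1"
proof -
  have "(\<Sum>b<p. \<Sum>i\<in>I. r i * C i ((x + of_nat b) / of_nat p)) = (\<Sum>i\<in>I. \<Sum>b<p. r i * C i ((x + of_nat b) / of_nat p))"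
    by (rule sum.swap)
  thus ?thesis by (simp add: hecke_cusps_def sum.distrib distrib_left sum_distrib_left)
qed

lemma hecke_cusps_of_int: "hecke_cusps p (\<lambda>x. of_int (C x)) x = of_int (hecke_cusps p C x)"
  by (simp add: hecke_cusps_def)

context prime_level
begin

lemma proj_sum: "proj (\<lambda>t. \<Sum>i\<in>I. r i * y i t) t = (\<Sum>i\<in>I. r i * proj (y i) t)" for r :: "_ \<Rightarrow> 'a :: comm_ring_1"
proof -
  have "(\<Sum>v\<in>reps. (\<Sum>i\<in>I. r i * tri (y i) (int v)) * of_int (path_sym v t)) =
    (\<Sum>v\<in>reps. \<Sum>i\<in>I. r i * (tri (y i) (int v) * of_int (path_sym v t)))"
    by (simp add: sum_distrib_right mult.assoc)
  also have "\<dots> = (\<Sum>i\<in>I. \<Sum>v\<in>reps. r i * (tri (y i) (int v) * of_int (path_sym v t)))"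
    by (rule sum.swap)
  finally show ?thesis
    by (simp add: proj_def tri_sum right_diff_distrib sum_subtractf sum_distrib_left)
qed

lemma proj_of_int: "proj (\<lambda>t. of_int (y t) :: 'a :: comm_ring_1) t = of_int (proj y t)"
  by (simp add: proj_def tri_of_int)

lemma proj_path_sym:
  assumes "v \<in> reps"
  shows "proj (\<lambda>t. of_int (path_sym v t) :: 'a :: comm_ring_1) t = 0"
proof -
  have "(\<Sum>w\<in>reps. tri (path_sym v) (int w) * path_sym w t) = (\<Sum>w\<in>reps. (if v = w then path_sym w t else 0))"
    using assms by (intro sum.cong) (auto simp: tri_path_sym_reps)
  also have "\<dots> = path_sym v t" using assms finite_reps by simp
  finally have "proj (path_sym v) t = 0" by (simp add: proj_def)
  thus ?thesis by (simp add: proj_of_int)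
qed

text \<open>
  The operator \<open>T\<^sub>p\<close> on the image of \<open>proj\<close>, extended by the identity on its kernel. The
  subtraction of the value at 0 returns from functions on cusps to symbols.
\<close>
definition hecke_sym :: "nat \<Rightarrow> (int \<Rightarrow> 'a::comm_ring_1) \<Rightarrow> int \<Rightarrow> 'a" where
  "hecke_sym p y t = hecke_cusps p (cusp_fn (proj y)) (1 / of_int t) - hecke_cusps p (cusp_fn (proj y)) 0 + (y t - proj y t)"

lemma hecke_sym_sum:
  "hecke_sym p (\<lambda>t. \<Sum>i\<in>I. r i * y i t) t = (\<Sum>i\<in>I. r i * hecke_sym p (y i) t)" for r :: "_ \<Rightarrow> 'a :: comm_ring_1"
proof -
  have "cusp_fn (proj (\<lambda>t. \<Sum>i\<in>I. r i * y i t)) = (\<lambda>x. \<Sum>i\<in>I. r i * cusp_fn (proj (y i)) x)"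
    by (simp add: proj_sum[abs_def] cusp_fn_sum[abs_def] fun_eq_iff)
  thus ?thesis
    by (simp add: hecke_sym_def hecke_cusps_sum proj_sum sum.distrib sum_subtractf algebra_simps)
qed

lemma hecke_sym_of_int: "hecke_sym p (\<lambda>t. of_int (y t) :: 'a :: comm_ring_1) t = of_int (hecke_sym p y t)"
proof -
  have "proj (\<lambda>t. of_int (y t) :: 'a) = (\<lambda>t. of_int (proj y t))" by (simp add: proj_of_int fun_eq_iff)
  moreover have "cusp_fn (\<lambda>t. of_int (proj y t) :: 'a) = (\<lambda>x. of_int (cusp_fn (proj y) x))"
    by (simp add: cusp_fn_of_int fun_eq_iff)
  ultimately show ?thesis by (simp add: hecke_sym_def hecke_cusps_of_int)
qed

end

text \<open>
  The level \<open>N = 12 n + 1\<close> with a primitive root \<open>w\<close>. The powers of \<open>w\<close> turn the symmetries of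
  symbols into \<open>k \<mapsto> k + 6 n\<close> and \<open>k \<mapsto> -k\<close> on exponents.
\<close>
locale primitive_root_level = prime_level +
  fixes n w :: nat
  assumes N_eq: "N = 12 * n + 1"
    and pow_cong_iff: "\<And>i j. [int w ^ i = int w ^ j] (mod int N) \<longleftrightarrow> [i = j] (mod (12 * n))"
    and ex_pow: "\<And>t. \<not> int N dvd t \<Longrightarrow> \<exists>j. [t = int w ^ j] (mod int N)"
begin

lemma n_pos: "n > 0" using N_eq N_ge by simp

lemma pow_not_dvd: "\<not> int N dvd int w ^ k"
proof
  assume "int N dvd int w ^ k"
  hence "int N dvd int w" using int_prime prime_dvd_power by blast
  hence *: "int N dvd int w ^ Suc i" for i by simp
  have "[int w ^ Suc 0 = int w ^ Suc 1] (mod int N)"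
    using *[of 0] *[of 1] by (simp add: cong_iff_dvd_diff)
  hence "[Suc 0 = Suc 1] (mod (12 * n))" by (simp only: pow_cong_iff)
  thus False using n_pos by (simp add: cong_def)
qed

lemma pow_half: "[int w ^ (6 * n) = -1] (mod int N)"
proof -
  have "[int w ^ (12 * n) = int w ^ 0] (mod int N)" unfolding pow_cong_iff by (simp add: cong_def)
  hence "int N dvd int w ^ (12 * n) - 1" by (simp add: cong_iff_dvd_diff)
  also have "int w ^ (12 * n) - 1 = (int w ^ (6 * n) - 1) * (int w ^ (6 * n) + 1)"
    by (simp add: algebra_simps power_add[symmetric])
  finally consider "int N dvd int w ^ (6 * n) - 1" | "int N dvd int w ^ (6 * n) + 1"
    by (auto simp: prime_dvd_mult_N)
  thus ?thesis
  proof cases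
    case 1
    hence "[int w ^ (6 * n) = int w ^ 0] (mod int N)" by (simp add: cong_iff_dvd_diff)
    hence "[6 * n = 0] (mod (12 * n))" by (simp only: pow_cong_iff)
    thus ?thesis using n_pos by (simp add: cong_def)
  qed (simp add: cong_iff_dvd_diff)
qed

lemma pow_add_half: "[int w ^ (j + 6 * n) = - (int w ^ j)] (mod int N)"
proof -
  have "[int w ^ j * int w ^ (6 * n) = int w ^ j * (-1)] (mod int N)" by (intro cong_mult pow_half cong_refl)
  thus ?thesis by (simp add: power_add)
qed

lemma pow_neg_iff: "[int w ^ i = - (int w ^ j)] (mod int N) \<longleftrightarrow> [i = j + 6 * n] (mod (12 * n))"
  unfolding pow_cong_iff[symmetric] using pow_add_half[of j] by (metis cong_sym cong_trans)

lemma ex_pow_half_range: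
  assumes "\<not> int N dvd t"
  obtains j where "j < 6 * n" "[t = int w ^ j] (mod int N) \<or> [t = - (int w ^ j)] (mod int N)"
    "\<And>i. [t = int w ^ i] (mod int N) \<Longrightarrow> [i = j] (mod n)"
proof -
  obtain i where i: "[t = int w ^ i] (mod int N)" using ex_pow[OF assms] by blast
  define i' where "i' = i mod (12 * n)"
  have "[i = i'] (mod (12 * n))" by (simp add: i'_def cong_def)
  hence i': "[t = int w ^ i'] (mod int N)" using i pow_cong_iff by (metis cong_trans)
  have lt: "i' < 12 * n" using n_pos by (simp add: i'_def)
  have uniq: "[k = i'] (mod n)" if "[t = int w ^ k] (mod int N)" for k
  proof -
    have "[int w ^ k = int w ^ i'] (mod int N)" using that i' by (metis cong_sym cong_trans)
    hence "[k = i'] (mod (12 * n))" by (simp only: pow_cong_iff)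
    thus ?thesis by (rule cong_dvd_modulus_nat) simp
  qed
  show ?thesis
  proof (cases "i' < 6 * n")
    case True
    show ?thesis by (rule that[of i']) (use True i' uniq in auto)
  next
    case False
    show ?thesis
    proof (rule that[of "i' - 6 * n"])
      show "i' - 6 * n < 6 * n" using lt False by simp
      have "[int w ^ i' = - (int w ^ (i' - 6 * n))] (mod int N)"
        using pow_add_half[of "i' - 6 * n"] False by simp
      thus "[t = int w ^ (i' - 6 * n)] (mod int N) \<or> [t = - (int w ^ (i' - 6 * n))] (mod int N)"
        using i' by (metis cong_trans)
      have "[i' = i' - 6 * n] (mod n)"
      proof -
        have "[i' - 6 * n + n * 6 = i' - 6 * n + 0] (mod n)" by (intro cong_add cong_refl) (simp add: cong_0_iff)
        thus ?thesis using False by (simp add: mult.commute)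
      qed
      thus "[k = i' - 6 * n] (mod n)" if "[t = int w ^ k] (mod int N)" for k
        using uniq[OF that] by (rule cong_trans[rotated])
    qed
  qed
qed

text \<open>
  Representatives of the exponents modulo \<open>6 n\<close> up to sign. The exponents 0 and \<open>3 n\<close> are left out
  because the symmetries force the value 0 there, and \<open>2 n\<close> because \<open>w\<close> to the power \<open>2 n\<close> is the
  negative of a primitive cube root of unity.
\<close>
definition idx :: "nat set" where "idx = {1..<3 * n} - {2 * n}"

lemma finite_idx: "finite idx" by (simp add: idx_def)

lemma card_idx: "card idx = 3 * n - 2"
  using n_pos by (simp add: idx_def)

definition coord :: "nat \<Rightarrow> int \<Rightarrow> int" where "coord k = unit_sym (int w ^ k)"

lemma symbol_fn_coord: "symbol_fn (coord k)"
  unfolding coord_def by (intro symbol_fn_unit_sym pow_not_dvd)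

lemma coord_pow:
  assumes "k \<in> idx" "j < 6 * n"
  shows "coord k (int w ^ j) = of_bool (j = k) - of_bool (j + k = 6 * n)"
proof -
  have k: "0 < k" "k < 3 * n" using assms(1) by (auto simp: idx_def)
  have 1: "[int w ^ j = int w ^ k] (mod int N) \<longleftrightarrow> j = k"
    unfolding pow_cong_iff using k assms(2) by (auto simp: cong_def)
  have 2: "\<not> [int w ^ j = - (int w ^ k)] (mod int N)"
    unfolding pow_neg_iff using k assms(2) by (auto simp: cong_def)
  have 3: "\<not> [int w ^ (j + k) = int w ^ 0] (mod int N)"
    unfolding pow_cong_iff using k assms(2) by (auto simp: cong_def)
  have 4: "[int w ^ (j + k) = - (int w ^ 0)] (mod int N) \<longleftrightarrow> j + k = 6 * n"
    unfolding pow_neg_iff using k assms(2) by (auto simp: cong_def)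
  show ?thesis using 1 2 3 4 by (simp add: coord_def unit_sym_def power_add)
qed

lemma symbol_fn_pow_zero:
  assumes y: "symbol_fn (y :: int \<Rightarrow> 'a :: {idom, ring_char_0})" "vanishes_at_cube_roots y"
    and j: "j < 6 * n" "j \<notin> idx" "6 * n - j \<notin> idx"
  shows "y (int w ^ j) = 0"
proof -
  consider "j = 0" | "j = 3 * n" | "j = 2 * n" | "j = 4 * n"
    using j by (fastforce simp: idx_def)
  thus ?thesis
  proof cases
    case 1
    thus ?thesis using symbol_fn_one[OF y(1), of 1] by simp
  next
    case 2
    let ?x = "int w ^ (3 * n)"
    have "[int w ^ (3 * n + 3 * n) = -1] (mod int N)" using pow_half by (simp add: mult_2[symmetric])
    hence "[?x * ?x = -1] (mod int N)" by (simp only: power_add)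
    hence "[(- ?x) * ?x = 1] (mod int N)"
      unfolding cong_iff_dvd_diff by (subst dvd_cong_pm[of _ "?x * ?x - (-1)"]) auto
    from symbol_fn_inverse[OF y(1) this] have "y ?x = - y ?x" by (simp add: symbol_fn_minus[OF y(1)])
    thus ?thesis unfolding 2 by (rule eq_uminus_self_imp_zero)
  next
    case 3
    let ?x = "int w ^ (2 * n)"
    have "int N dvd int w ^ (6 * n) + 1" using pow_half by (simp add: cong_iff_dvd_diff)
    also have "6 * n = 2 * n + 2 * n + 2 * n" by simp
    also have "int w ^ (2 * n + 2 * n + 2 * n) + 1 = (?x + 1) * (?x\<^sup>2 - ?x + 1)"
      unfolding power_add by (simp add: algebra_simps power2_eq_square)
    finally consider "int N dvd ?x + 1" | "int N dvd ?x\<^sup>2 - ?x + 1" by (auto simp: prime_dvd_mult_N)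
    thus ?thesis
    proof cases
      case 1
      hence "[?x = - (int w ^ 0)] (mod int N)" by (simp add: cong_iff_dvd_diff)
      hence "[2 * n = 0 + 6 * n] (mod (12 * n))" by (simp only: pow_neg_iff)
      thus ?thesis using n_pos by (simp add: cong_def)
    next
      case 2
      hence "int N dvd (- ?x)\<^sup>2 + (- ?x) + 1" by simp
      hence "y (- ?x) = 0" using y(2) unfolding vanishes_at_cube_roots_def by blast
      thus ?thesis using 3 by (simp add: symbol_fn_minus[OF y(1)])
    qed
  next
    case 4
    let ?x = "int w ^ (4 * n)"
    have "[int w ^ (12 * n) = int w ^ 0] (mod int N)" unfolding pow_cong_iff by (simp add: cong_def)
    hence "int N dvd int w ^ (12 * n) - 1" by (simp add: cong_iff_dvd_diff)
    also have "12 * n = 4 * n + 4 * n + 4 * n" by simp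
    also have "int w ^ (4 * n + 4 * n + 4 * n) - 1 = (?x - 1) * (?x\<^sup>2 + ?x + 1)"
      unfolding power_add by (simp add: algebra_simps power2_eq_square)
    finally consider "int N dvd ?x - 1" | "int N dvd ?x\<^sup>2 + ?x + 1" by (auto simp: prime_dvd_mult_N)
    thus ?thesis
    proof cases
      case 1
      hence "[?x = int w ^ 0] (mod int N)" by (simp add: cong_iff_dvd_diff)
      hence "[4 * n = 0] (mod (12 * n))" by (simp only: pow_cong_iff)
      thus ?thesis using n_pos by (simp add: cong_def)
    next
      case 2
      thus ?thesis using y(2) 4 unfolding vanishes_at_cube_roots_def by blast
    qed
  qed
qed

lemma sum_coord_pow:
  assumes "j < 6 * n"
  shows "(\<Sum>k\<in>idx. r k * of_int (coord k (int w ^ j)) :: 'a :: comm_ring_1) =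
    (if j \<in> idx then r j else 0) - (if 6 * n - j \<in> idx then r (6 * n - j) else 0)"
proof -
  have "(\<Sum>k\<in>idx. r k * of_int (coord k (int w ^ j))) =
    (\<Sum>k\<in>idx. (if j = k then r k else 0) - (if 6 * n - j = k then r k else 0))"
  proof (rule sum.cong)
    fix k assume k: "k \<in> idx"
    have "j + k = 6 * n \<longleftrightarrow> 6 * n - j = k" using assms by auto
    thus "r k * of_int (coord k (int w ^ j)) = (if j = k then r k else 0) - (if 6 * n - j = k then r k else 0)"
      using coord_pow[OF k assms] by auto
  qed simp
  thus ?thesis by (simp add: sum_subtractf finite_idx)
qed

text \<open>
  The functions \<open>coord k\<close> form a basis of the symmetric functions that vanish at the cube roots
  of unity, and the coordinates are the values at \<open>w\<^sup>k\<close>.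
\<close>
lemma symbol_fn_expansion:
  assumes y: "symbol_fn (y :: int \<Rightarrow> 'a :: {idom, ring_char_0})" "vanishes_at_cube_roots y"
  shows "y t = (\<Sum>k\<in>idx. y (int w ^ k) * of_int (coord k t))"
proof -
  define z where "z = (\<lambda>t. \<Sum>k\<in>idx. y (int w ^ k) * of_int (coord k t))"
  have z: "symbol_fn z"
    unfolding z_def by (intro symbol_fn_sum symbol_fn_of_int symbol_fn_coord)
  have eq: "y (int w ^ j) = z (int w ^ j)" if j: "j < 6 * n" for j
  proof -
    have zj: "z (int w ^ j) = (if j \<in> idx then y (int w ^ j) else 0) - (if 6 * n - j \<in> idx then y (int w ^ (6 * n - j)) else 0)"
      unfolding z_def by (rule sum_coord_pow[OF j])
    have "\<not> (j \<in> idx \<and> 6 * n - j \<in> idx)" by (auto simp: idx_def)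
    then consider "j \<in> idx" "6 * n - j \<notin> idx" | "j \<notin> idx" "6 * n - j \<in> idx" | "j \<notin> idx" "6 * n - j \<notin> idx"
      by blast
    thus ?thesis
    proof cases
      case 2
      have "[int w ^ (j + (6 * n - j)) = -1] (mod int N)" using pow_half j by simp
      hence "[(int w ^ j) * int w ^ (6 * n - j) = -1] (mod int N)" by (simp only: power_add)
      hence "[(- (int w ^ j)) * int w ^ (6 * n - j) = 1] (mod int N)"
        unfolding cong_iff_dvd_diff by (subst dvd_cong_pm[of _ "int w ^ j * int w ^ (6 * n - j) - (-1)"]) auto
      from symbol_fn_inverse[OF y(1) this] show ?thesis using 2 zj by (simp add: symbol_fn_minus[OF y(1)])
    qed (use zj symbol_fn_pow_zero[OF y j] in auto)
  qed
  have "y t = z t"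
  proof (cases "int N dvd t")
    case True
    thus ?thesis using symbol_fn_dvd[OF y(1)] symbol_fn_dvd[OF z] by simp
  next
    case False
    then obtain j where j: "j < 6 * n" "[t = int w ^ j] (mod int N) \<or> [t = - (int w ^ j)] (mod int N)"
      using ex_pow_half_range by blast
    from j(2) show ?thesis
    proof
      assume t: "[t = int w ^ j] (mod int N)"
      show ?thesis using symbol_fn_cong[OF y(1) t] symbol_fn_cong[OF z t] eq[OF j(1)] by simp
    next
      assume t: "[t = - (int w ^ j)] (mod int N)"
      show ?thesis using symbol_fn_cong[OF y(1) t] symbol_fn_cong[OF z t] eq[OF j(1)]
        by (simp add: symbol_fn_minus[OF y(1)] symbol_fn_minus[OF z])
    qed
  qed
  thus ?thesis by (simp add: z_def)
qed

lemma vanishes_coord: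
  assumes k: "k \<in> idx"
  shows "vanishes_at_cube_roots (coord k)"
  unfolding vanishes_at_cube_roots_def
proof (intro allI impI)
  fix t :: int assume t: "int N dvd t\<^sup>2 + t + 1"
  note nt = cube_root_not_dvd(1)[OF t]
  obtain j where j: "j < 6 * n" "[t = int w ^ j] (mod int N) \<or> [t = - (int w ^ j)] (mod int N)"
    using ex_pow_half_range[OF nt] by blast
  have "coord k t = coord k (int w ^ j)"
    using j(2) symbol_fn_cong[OF symbol_fn_coord] symbol_fn_minus[OF symbol_fn_coord] by metis
  moreover have "[int w ^ (6 * j) = int w ^ 0] (mod int N)"
  proof -
    have "[t ^ 6 = (int w ^ j) ^ 6] (mod int N)"
      using j(2)
    proof
      assume "[t = - (int w ^ j)] (mod int N)"
      from cong_pow[OF this, of 6] show ?thesis by simp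
    qed (rule cong_pow)
    moreover have "[t ^ 6 = 1] (mod int N)"
    proof -
      have "t ^ 6 - 1 = (t\<^sup>2 + t + 1) * ((t - 1) * (t ^ 3 + 1))"
        by (simp add: algebra_simps power2_eq_square power3_eq_cube eval_nat_numeral)
      thus ?thesis using t by (simp add: cong_iff_dvd_diff)
    qed
    ultimately have "[(int w ^ j) ^ 6 = 1] (mod int N)" by (metis cong_sym cong_trans)
    thus ?thesis by (simp add: power_mult[symmetric] mult.commute)
  qed
  hence "[6 * j = 0] (mod (12 * n))" by (simp only: pow_cong_iff)
  hence "2 * n dvd j" by (auto simp: cong_0_iff)
  then obtain i where i: "j = 2 * n * i" by blast
  have "i < 3" using j(1) i n_pos by simp
  hence "j = 0 \<or> j = 2 * n \<or> j = 4 * n" using i by (auto simp: less_Suc_eq eval_nat_numeral)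
  moreover have "coord k (int w ^ j) = of_bool (j = k) - of_bool (j + k = 6 * n)"
    by (rule coord_pow[OF k j(1)])
  ultimately show "coord k t = 0" using k by (auto simp: idx_def)
qed

end

section \<open>The discrete logarithm as a symbol modulo n\<close>

context primitive_root_level
begin

definition ind :: "int \<Rightarrow> int" where "ind t = int (SOME j. [t = int w ^ j] (mod int N))"

lemma ind_nat:
  assumes "\<not> int N dvd t"
  obtains j where "ind t = int j" "[t = int w ^ j] (mod int N)"
  using someI_ex[OF ex_pow[OF assms]] by (simp add: ind_def)

lemma ind_unique:
  assumes "[t = int w ^ j] (mod int N)"
  shows "[ind t = int j] (mod int n)"
proof -
  have "\<not> int N dvd t" using assms pow_not_dvd[of j] by (metis cong_dvd_iff)
  then obtain i where i: "ind t = int i" "[t = int w ^ i] (mod int N)" by (rule ind_nat)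
  have "[int w ^ i = int w ^ j] (mod int N)" using i(2) assms by (metis cong_sym cong_trans)
  hence "[i = j] (mod (12 * n))" by (simp only: pow_cong_iff)
  hence "[i = j] (mod n)" by (rule cong_dvd_modulus_nat) simp
  thus ?thesis unfolding i(1) cong_int_iff .
qed

lemma ind_mult:
  assumes "\<not> int N dvd s" "\<not> int N dvd t" "[u = s * t] (mod int N)"
  shows "[ind u = ind s + ind t] (mod int n)"
proof -
  obtain i where i: "ind s = int i" "[s = int w ^ i] (mod int N)" using ind_nat[OF assms(1)] .
  obtain j where j: "ind t = int j" "[t = int w ^ j] (mod int N)" using ind_nat[OF assms(2)] .
  have "[s * t = int w ^ (i + j)] (mod int N)"
    unfolding power_add by (intro cong_mult i j)
  with assms(3) have "[u = int w ^ (i + j)] (mod int N)" by (metis cong_trans)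
  from ind_unique[OF this] show ?thesis by (simp add: i j)
qed

lemma ind_1: "[ind 1 = 0] (mod int n)"
  using ind_unique[of 1 0] by simp

lemma ind_minus_1: "[ind (-1) = 0] (mod int n)"
proof -
  have "[-1 = int w ^ (6 * n)] (mod int N)" using pow_half by (rule cong_sym)
  from ind_unique[OF this] have "[ind (-1) = int (6 * n)] (mod int n)" .
  also have "[int (6 * n) = 0] (mod int n)" by (simp add: cong_0_iff)
  finally show ?thesis .
qed

text \<open>
  An integral function with the symmetries of a symbol that is congruent to the discrete logarithm
  modulo \<open>n\<close>: the logarithms of \<open>-1\<close> and of the roots of unity of order 3 and 4 are divisible by \<open>n\<close>.
\<close>
definition log_lift0 :: "int \<Rightarrow> int" where
  "log_lift0 t = (\<Sum>k\<in>idx. int k * coord k t)"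

definition log_lift :: "int \<Rightarrow> int" where "log_lift = proj log_lift0"

lemma symbol_fn_log_lift0: "symbol_fn log_lift0"
  unfolding log_lift0_def[abs_def] by (intro symbol_fn_sum symbol_fn_coord)

lemma vanishes_log_lift0: "vanishes_at_cube_roots log_lift0"
  using vanishes_coord unfolding vanishes_at_cube_roots_def log_lift0_def
  by (auto intro!: sum.neutral)

lemma log_lift0_cong:
  assumes "\<not> int N dvd t"
  shows "[log_lift0 t = ind t] (mod int n)"
proof -
  obtain j where j: "j < 6 * n" "[t = int w ^ j] (mod int N) \<or> [t = - (int w ^ j)] (mod int N)"
    "\<And>i. [t = int w ^ i] (mod int N) \<Longrightarrow> [i = j] (mod n)"
    using ex_pow_half_range[OF assms] by blast
  have "log_lift0 t = log_lift0 (int w ^ j)"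
    using j(2) symbol_fn_cong[OF symbol_fn_log_lift0] symbol_fn_minus[OF symbol_fn_log_lift0] by metis
  also have "\<dots> = (if j \<in> idx then int j else 0) - (if 6 * n - j \<in> idx then int (6 * n - j) else 0)"
    using sum_coord_pow[OF j(1), of int] by (simp add: log_lift0_def)
  also have "[\<dots> = int j] (mod int n)"
  proof -
    have "\<not> (j \<in> idx \<and> 6 * n - j \<in> idx)" by (auto simp: idx_def)
    then consider "j \<in> idx" "6 * n - j \<notin> idx" | "j \<notin> idx" "6 * n - j \<in> idx" | "j \<notin> idx" "6 * n - j \<notin> idx"
      by blast
    thus ?thesis
    proof cases
      case 2
      have "- int (6 * n - j) = int j + (-6) * int n" using j(1) by (simp add: of_nat_diff)
      thus ?thesis using 2 by (simp add: cong_iff_dvd_diff)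
    next
      case 3
      have "j = 0 \<or> j = 3 * n \<or> j = 2 * n \<or> j = 4 * n"
        using 3 j(1) by (fastforce simp: idx_def)
      hence "n dvd j" by auto
      thus ?thesis using 3 by (simp add: cong_iff_dvd_diff int_dvd_int_iff)
    qed (simp add: cong_refl)
  qed
  also have "[int j = ind t] (mod int n)"
  proof -
    obtain i where i: "ind t = int i" "[t = int w ^ i] (mod int N)" using ind_nat[OF assms] .
    from j(3)[OF i(2)] have "[j = i] (mod n)" by (rule cong_sym)
    thus ?thesis unfolding i(1) cong_int_iff .
  qed
  finally show ?thesis .
qed

lemma manin_log_lift: "manin log_lift"
  unfolding log_lift_def by (rule manin_proj[OF symbol_fn_log_lift0 vanishes_log_lift0])

lemma generic_pred_not_dvd:
  assumes "v \<in> generic"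
  shows "\<not> int N dvd int v" "\<not> int N dvd int v - 1"
proof -
  show "\<not> int N dvd int v" using assms by (auto simp: generic_def intro!: not_dvd_small)
  have "(int v)\<^sup>2 - 1 = (int v - 1) * (int v + 1)" by (simp add: power2_eq_square algebra_simps)
  thus "\<not> int N dvd int v - 1" using assms by (auto simp: generic_def)
qed

text \<open>
  The defect of the discrete logarithm in the three-term relation at \<open>v\<close> is the logarithm of
  \<open>v / (v - 1) \<cdot> (v - 1)/v = 1\<close>, so the projection changes the lift only by multiples of \<open>n\<close>.
\<close>
lemma log_lift_cong:
  assumes t: "\<not> int N dvd t"
  shows "[log_lift t = ind t] (mod int n)"
proof -
  have "int n dvd tri log_lift0 (int v)" if v: "v \<in> reps" for v
  proof -
    have v': "v \<in> generic" using v reps(1) by blast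
    note nd = generic_pred_not_dvd[OF v']
    let ?x = "(int v - 1) * invr (int v)"
    have vx: "[int v - 1 = int v * ?x] (mod int N)"
      using cong_sym[OF quotient_cong[OF nd(1), of "int v - 1"]] by (simp add: mult.commute)
    have nx: "\<not> int N dvd ?x" by (rule quotient_not_dvd[OF nd(2,1)])
    have "[ind (int v - 1) = ind (int v) + ind ?x] (mod int n)" by (rule ind_mult[OF nd(1) nx vx])
    hence "[ind (int v) - ind (int v - 1) + ind ?x = ind (int v) - (ind (int v) + ind ?x) + ind ?x] (mod int n)"
      by (intro cong_add cong_diff cong_refl)
    moreover have "[tri log_lift0 (int v) = ind (int v) - ind (int v - 1) + ind ?x] (mod int n)"
      unfolding tri_def by (intro cong_add cong_diff log_lift0_cong nd nx)
    ultimately have "[tri log_lift0 (int v) = ind (int v) - (ind (int v) + ind ?x) + ind ?x] (mod int n)"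
      by (rule cong_trans[rotated])
    thus ?thesis by (simp add: cong_0_iff)
  qed
  hence "int n dvd (\<Sum>v\<in>reps. tri log_lift0 (int v) * of_int (path_sym v t))"
    by (intro dvd_sum) auto
  hence "[log_lift0 t - (\<Sum>v\<in>reps. tri log_lift0 (int v) * of_int (path_sym v t)) = ind t - 0] (mod int n)"
    by (intro cong_diff log_lift0_cong t) (simp add: cong_0_iff)
  thus ?thesis by (simp add: log_lift_def proj_def)
qed

text \<open>
  The function on the cusps on the right-hand side has the discrete logarithm as its symbol, so
  it agrees with the integral of \<open>log_lift\<close> modulo \<open>n\<close>. For \<open>N\<close> dividing \<open>c\<close> or \<open>d\<close> the relation
  \<open>a d - b c = 1\<close> gives \<open>a d = 1\<close> or \<open>b c = -1\<close> modulo \<open>N\<close>.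
\<close>
lemma cusp_log_lift_cong:
  assumes "coprime a c"
  shows "[cusp_at (cusp_fn log_lift) a c = (if int N dvd c then - ind a else ind c)] (mod int n)"
proof -
  let ?C = "cusp_fn log_lift"
  have S: "symbol_fn log_lift" using manin_log_lift by (simp add: manin_def)
  show ?thesis
  proof (rule cusp_induct[where P = "\<lambda>a c. [cusp_at ?C a c = (if int N dvd c then - ind a else ind c)] (mod int n)", OF _ _ assms])
    have "[- 0 = - ind 1] (mod int n)" by (simp only: cong_minus_minus_iff) (rule cong_sym[OF ind_1])
    thus "[cusp_at ?C 1 0 = (if int N dvd 0 then - ind 1 else ind 0)] (mod int n)"
      by (simp add: cusp_at_def)
  next
    fix a b c d :: int
    assume det: "a * d - b * c = 1" and IH: "[cusp_at ?C a c = (if int N dvd c then - ind a else ind c)] (mod int n)"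
    have E: "cusp_at ?C b d = cusp_at ?C a c - edge log_lift c d"
      using cusp_fn_edge[OF manin_log_lift det] by simp
    have not_both: "\<not> (int N dvd c \<and> int N dvd d)"
      using det_imp_coprime(3)[OF det] not_dvd_1(1) coprime_common_divisor by blast
    consider "int N dvd c" "\<not> int N dvd d" | "int N dvd d" "\<not> int N dvd c" | "\<not> int N dvd c" "\<not> int N dvd d"
      using not_both by blast
    thus "[cusp_at ?C b d = (if int N dvd d then - ind b else ind d)] (mod int n)"
    proof cases
      case 1
      have ad: "a * d = 1 + b * c" using det by simp
      have "[a * d = 1 + 0] (mod int N)" unfolding ad using 1 by (intro cong_add cong_refl) (simp add: cong_0_iff)
      hence ad1: "[1 = a * d] (mod int N)" by (simp add: cong_sym_eq)
      have na: "\<not> int N dvd a"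
      proof
        assume "int N dvd a"
        hence "int N dvd a * d" by (rule dvd_mult2)
        with ad1 not_dvd_1(1) show False by (metis cong_dvd_iff)
      qed
      have "[0 = ind a + ind d] (mod int n)"
        using ind_mult[OF na 1(2) ad1] ind_1 by (metis cong_sym cong_trans)
      hence "[0 - ind a = ind a + ind d - ind a] (mod int n)" by (intro cong_diff cong_refl)
      hence "[- ind a = ind d] (mod int n)" by simp
      thus ?thesis using IH 1 edge_zero[OF S, of c d] E by (simp add: cong_trans)
    next
      case 2
      have bc: "b * c = -1 + a * d" using det by simp
      have "[b * c = -1 + 0] (mod int N)" unfolding bc using 2 by (intro cong_add cong_refl) (simp add: cong_0_iff)
      hence bc1: "[-1 = b * c] (mod int N)" by (simp add: cong_sym_eq)
      have nb: "\<not> int N dvd b"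
      proof
        assume "int N dvd b"
        hence "int N dvd b * c" by (rule dvd_mult2)
        with bc1 not_dvd_1(2) show False by (metis cong_dvd_iff)
      qed
      have "[0 = ind b + ind c] (mod int n)"
        using ind_mult[OF nb 2(2) bc1] ind_minus_1 by (metis cong_sym cong_trans)
      hence "[0 - ind b = ind b + ind c - ind b] (mod int n)" by (intro cong_diff cong_refl)
      hence "[ind c = - ind b] (mod int n)" by (simp add: cong_sym_eq)
      thus ?thesis using IH 2 edge_zero[OF S, of c d] E by (simp add: cong_trans)
    next
      case 3
      let ?x = "c * invr d"
      have cx: "[c = ?x * d] (mod int N)" by (rule cong_sym[OF quotient_cong[OF 3(2)]])
      have nx: "\<not> int N dvd ?x" by (rule quotient_not_dvd[OF 3])
      have "[ind c - log_lift ?x = (ind ?x + ind d) - ind ?x] (mod int n)"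
        by (intro cong_diff ind_mult[OF nx 3(2) cx] log_lift_cong nx)
      hence "[ind c - edge log_lift c d = ind d] (mod int n)" by (simp add: edge_def)
      moreover have "[cusp_at ?C a c - edge log_lift c d = ind c - edge log_lift c d] (mod int n)"
        using IH 3 by (intro cong_diff cong_refl) simp
      ultimately have "[cusp_at ?C a c - edge log_lift c d = ind d] (mod int n)" by (metis cong_trans)
      thus ?thesis using 3 by (simp add: E)
    qed
  qed
qed

lemma other_prime_not_dvd: "prime p \<Longrightarrow> p \<noteq> N \<Longrightarrow> \<not> int N dvd int p"
  using primes_dvd_imp_eq[OF prime_N] by (auto simp: int_dvd_int_iff)

lemma cusp_fn_log_lift_cong:
  assumes "coprime a c" "\<not> int N dvd c"
  shows "[cusp_fn log_lift (of_int a / of_int c) = ind c] (mod int n)"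
  using cusp_log_lift_cong[OF assms(1)] assms(2) by (cases "c = 0") (auto simp: cusp_at_def)

lemma hecke_cusps_log_lift_0:
  assumes p: "prime p" "p \<noteq> N"
  shows "[hecke_cusps p (cusp_fn log_lift) 0 = int (p - 1) * ind (int p)] (mod int n)"
proof -
  let ?C = "cusp_fn log_lift"
  have p0: "p > 1" using p(1) by (rule prime_gt_1_nat)
  have np: "\<not> int N dvd int p" by (rule other_prime_not_dvd[OF p])
  have "[?C (of_int 0 / of_int 1) = ind 1] (mod int n)"
    by (rule cusp_fn_log_lift_cong) (use N_ge in simp_all)
  also note ind_1
  finally have C0: "[?C 0 = 0] (mod int n)" by simp
  have "[(\<Sum>b<p. ?C (of_nat b / of_nat p)) = (\<Sum>b<p. if b = 0 then 0 else ind (int p))] (mod int n)"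
  proof (rule cong_sum)
    fix b assume b: "b \<in> {..<p}"
    show "[?C (of_nat b / of_nat p) = (if b = 0 then 0 else ind (int p))] (mod int n)"
    proof (cases "b = 0")
      case False
      have "\<not> p dvd b" using False b by (auto dest: nat_dvd_not_less)
      hence "coprime p b" using p(1) prime_imp_coprime by blast
      hence "coprime (int b) (int p)" by (simp add: coprime_commute)
      from cusp_fn_log_lift_cong[OF this np] False show ?thesis by simp
    qed (use C0 in simp)
  qed
  also have "(\<Sum>b<p. if b = 0 then 0 else ind (int p)) = int (p - 1) * ind (int p)"
  proof -
    have "(\<Sum>b<p. if b = 0 then 0 else ind (int p)) = (\<Sum>b\<in>{..<p} - {0}. ind (int p))"
      by (rule sum.mono_neutral_cong_right) auto
    also have "card ({..<p} - {0}) = p - 1" using p0 by simp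
    hence "(\<Sum>b\<in>{..<p} - {0}. ind (int p)) = int (p - 1) * ind (int p)" by simp
    finally show ?thesis .
  qed
  finally have "[?C 0 + (\<Sum>b<p. ?C (of_nat b / of_nat p)) = 0 + int (p - 1) * ind (int p)] (mod int n)"
    by (intro cong_add C0)
  thus ?thesis by (simp add: hecke_cusps_def)
qed

text \<open>
  Each of the \<open>p + 1\<close> fractions \<open>p/t\<close> and \<open>(1 + b t)/(t p)\<close> has denominator \<open>t p\<close> up to
  cancellation of a power of \<open>p\<close>. If \<open>p\<close> does not divide \<open>t\<close>, a factor \<open>p\<close> is missing twice: in \<open>p/t\<close> and
  for the one \<open>b\<close> with \<open>p\<close> dividing \<open>1 + b t\<close>. If \<open>p\<close> divides \<open>t\<close>, two factors \<open>p\<close> are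
  missing in \<open>p/t\<close>. The total is the same in both cases.
\<close>
lemma hecke_cusps_log_lift:
  assumes p: "prime p" "p \<noteq> N" and t: "\<not> int N dvd t"
  shows "[hecke_cusps p (cusp_fn log_lift) (1 / of_int t) = int (p + 1) * ind t + int (p - 1) * ind (int p)] (mod int n)"
proof -
  let ?C = "cusp_fn log_lift"
  have p0: "p > 1" using p(1) by (rule prime_gt_1_nat)
  have pp: "prime (int p)" using p(1) by simp
  have np: "\<not> int N dvd int p" by (rule other_prime_not_dvd[OF p])
  have t0: "t \<noteq> 0" using t by auto
  have ntp: "\<not> int N dvd t * int p" using t np by (simp add: prime_dvd_mult_N)
  have ind_tp: "[ind (t * int p) = ind t + ind (int p)] (mod int n)"
    by (rule ind_mult[OF t np cong_refl])
  have cop_t: "coprime (1 + int b * t) t" for b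
    by (rule coprimeI) (metis add_diff_cancel_right' dvd_diff dvd_mult)
  have branch: "[?C ((1 / of_int t + of_nat b) / of_nat p) =
      ind t + (if int p dvd 1 + int b * t then 0 else ind (int p))] (mod int n)" for b
  proof (cases "int p dvd 1 + int b * t")
    case False
    hence "coprime (int p) (1 + int b * t)" using pp prime_imp_coprime by blast
    hence "coprime (1 + int b * t) (t * int p)" using cop_t by (simp add: coprime_commute)
    from cusp_fn_log_lift_cong[OF this ntp]
    have "[?C (of_int (1 + int b * t) / of_int (t * int p)) = ind (t * int p)] (mod int n)" .
    also have "of_int (1 + int b * t) / of_int (t * int p) = (1 / of_int t + of_nat b) / (of_nat p :: rat)"
      using t0 p0 by (simp add: field_simps)
    finally show ?thesis using ind_tp False by simp (metis cong_trans)
  next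
    case True
    then obtain s where s: "1 + int b * t = int p * s" by blast
    have "coprime s t" using cop_t[of b] unfolding s by simp
    from cusp_fn_log_lift_cong[OF this t] have "[?C (of_int s / of_int t) = ind t] (mod int n)" .
    also have "of_int s / of_int t = (1 / of_int t + of_nat b) / (of_nat p :: rat)"
    proof -
      have "of_int (1 + int b * t) = (of_int (int p * s) :: rat)" by (simp only: s)
      thus ?thesis using t0 p0 by (simp add: field_simps)
    qed
    finally show ?thesis using True by simp
  qed
  define B where "B = {b\<in>{..<p}. int p dvd 1 + int b * t}"
  have "[(\<Sum>b<p. ?C ((1 / of_int t + of_nat b) / of_nat p)) =
     (\<Sum>b<p. ind t + (if int p dvd 1 + int b * t then 0 else ind (int p)))] (mod int n)"
    by (intro cong_sum branch)
  also have "(\<Sum>b<p. ind t + (if int p dvd 1 + int b * t then 0 else ind (int p))) =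
     int p * ind t + int (p - card B) * ind (int p)"
  proof -
    have "(\<Sum>b<p. if int p dvd 1 + int b * t then 0 else ind (int p)) = (\<Sum>b\<in>{..<p} - B. ind (int p))"
      by (rule sum.mono_neutral_cong_right) (auto simp: B_def)
    also have "card ({..<p} - B) = p - card B" by (subst card_Diff_subset) (auto simp: B_def)
    hence "(\<Sum>b\<in>{..<p} - B. ind (int p)) = int (p - card B) * ind (int p)" by simp
    finally show ?thesis by (simp add: sum.distrib)
  qed
  finally have rest: "[(\<Sum>b<p. ?C ((1 / of_int t + of_nat b) / of_nat p)) =
     int p * ind t + int (p - card B) * ind (int p)] (mod int n)" .
  show ?thesis
  proof (cases "int p dvd t")
    case True
    then obtain s where s: "t = int p * s" by blast
    have "B = {}"
    proof -
      have "\<not> int p dvd 1 + int b * t" for b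
      proof
        assume "int p dvd 1 + int b * t"
        moreover have "int p dvd int b * t" using True by simp
        ultimately have "int p dvd 1" by (simp add: dvd_add_left_iff)
        thus False using p0 by simp
      qed
      thus ?thesis by (simp add: B_def)
    qed
    hence cardB: "card B = 0" by simp
    have ns: "\<not> int N dvd s" using t unfolding s by (metis dvd_mult)
    have "[?C (of_int 1 / of_int s) = ind s] (mod int n)" by (rule cusp_fn_log_lift_cong[OF _ ns]) simp
    moreover have "(of_int 1 / of_int s :: rat) = of_nat p * (1 / of_int t)" using p0 by (simp add: s)
    moreover have "[ind s = ind t - ind (int p)] (mod int n)"
    proof -
      have "[ind t = ind (int p) + ind s] (mod int n)" by (rule ind_mult[OF np ns]) (simp add: s)
      hence "[ind t - ind (int p) = ind (int p) + ind s - ind (int p)] (mod int n)" by (intro cong_diff cong_refl)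
      thus ?thesis by (simp add: cong_sym_eq)
    qed
    ultimately have "[?C (of_nat p * (1 / of_int t)) = ind t - ind (int p)] (mod int n)"
      by (metis cong_trans)
    from cong_add[OF this rest] cardB p0 show ?thesis
      by (simp add: hecke_cusps_def algebra_simps of_nat_diff)
  next
    case False
    have "card B = 1"
    proof -
      have "coprime t (int p)" using False pp prime_imp_coprime coprime_commute by blast
      then obtain x where x: "[t * x = 1] (mod int p)" using cong_solve_coprime_int by blast
      \<comment> \<open>The solution of \<open>1 + b t = 0\<close> modulo \<open>p\<close>.\<close>
    define b0 where "b0 = nat ((- x) mod int p)"
      have b0: "int b0 = (- x) mod int p" "b0 < p" using p0 by (simp_all add: b0_def nat_less_iff)
      have iff: "int p dvd 1 + int b * t \<longleftrightarrow> [int b = int b0] (mod int p)" for b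
      proof -
        have "[int b = int b0] (mod int p) \<longleftrightarrow> [int b = - x] (mod int p)"
          unfolding b0(1) by (simp only: cong_mod_right)
        also have "\<dots> \<longleftrightarrow> [t * int b = t * - x] (mod int p)"
          using cong_mult_lcancel[OF \<open>coprime t (int p)\<close>] by blast
        also have "\<dots> \<longleftrightarrow> [t * int b = -1] (mod int p)"
        proof -
          have "[- (t * x) = - 1] (mod int p)" using x by (simp only: cong_minus_minus_iff)
          hence "[t * - x = -1] (mod int p)" by simp
          thus ?thesis by (metis cong_sym cong_trans)
        qed
        also have "\<dots> \<longleftrightarrow> int p dvd 1 + int b * t" by (simp add: cong_iff_dvd_diff algebra_simps)
        finally show ?thesis by simp
      qed
      have "B = {b0}"
        unfolding B_def iff cong_int_iff using b0(2) by (auto simp: cong_def)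
      thus ?thesis by simp
    qed
    moreover have "[?C (of_int (int p) / of_int t) = ind t] (mod int n)"
      using False pp by (intro cusp_fn_log_lift_cong t prime_imp_coprime)
    hence "[?C (of_nat p * (1 / of_int t)) = ind t] (mod int n)" by simp
    from cong_add[OF this rest] show ?thesis using \<open>card B = 1\<close>
      by (simp add: hecke_cusps_def algebra_simps of_nat_diff)
  qed
qed

text \<open>
  The contributions of \<open>p\<close> at \<open>1/t\<close> and at 0 cancel.
\<close>
lemma hecke_sym_log_lift:
  assumes p: "prime p" "p \<noteq> N" "n dvd 1 + p" and t: "\<not> int N dvd t"
  shows "int n dvd hecke_sym p log_lift t"
proof -
  have "hecke_sym p log_lift t = hecke_cusps p (cusp_fn log_lift) (1 / of_int t) - hecke_cusps p (cusp_fn log_lift) 0"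
    by (simp add: hecke_sym_def proj_manin[OF manin_log_lift])
  also have "[\<dots> = (int (p + 1) * ind t + int (p - 1) * ind (int p)) - int (p - 1) * ind (int p)] (mod int n)"
    by (intro cong_diff hecke_cusps_log_lift hecke_cusps_log_lift_0 p t)
  finally have "[hecke_sym p log_lift t = int (1 + p) * ind t] (mod int n)" by (simp add: add.commute)
  moreover have "int n dvd int (1 + p) * ind t" using p(3) by (intro dvd_mult2) (simp only: int_dvd_int_iff)
  ultimately show ?thesis by (simp add: cong_dvd_iff)
qed

end

section \<open>Hecke eigenvectors among the symbols\<close>

lemma quasi_periodic_reflect:
  assumes C: "quasi_periodic N C"
  shows "quasi_periodic N (\<lambda>x. C (-x))"
  unfolding quasi_periodic_def
proof (intro allI impI)
  fix a b c d x y :: int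
  assume det: "a * d - b * c = 1" and dvd: "int N dvd c" and cop: "coprime x y"
  have r: "cusp_at (\<lambda>x. C (-x)) a c = cusp_at C a (-c)" for a c
    by (simp add: cusp_at_def)
  have "a * d - (-b) * (-c) = 1" "int N dvd -c" "coprime x (-y)" using det dvd cop by simp_all
  hence "cusp_at C (a * x + (-b) * (-y)) ((-c) * x + d * (-y)) = cusp_at C x (-y) + cusp_at C a (-c)"
    using C unfolding quasi_periodic_def by blast
  thus "cusp_at (\<lambda>x. C (-x)) (a * x + b * y) (c * x + d * y) = cusp_at (\<lambda>x. C (-x)) x y + cusp_at (\<lambda>x. C (-x)) a c"
    unfolding r by (simp add: algebra_simps)
qed

lemma quasi_periodic_add:
  assumes "quasi_periodic N C" "quasi_periodic N D"
  shows "quasi_periodic N (\<lambda>x. C x + D x)"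
proof -
  have s: "cusp_at (\<lambda>x. C x + D x) a c = cusp_at C a c + cusp_at D a c" for a c
    by (simp add: cusp_at_def)
  show ?thesis
    unfolding quasi_periodic_def s
  proof (intro allI impI)
    fix a b c d x y :: int
    assume *: "a * d - b * c = 1" "int N dvd c" "coprime x y"
    show "cusp_at C (a * x + b * y) (c * x + d * y) + cusp_at D (a * x + b * y) (c * x + d * y) =
      cusp_at C x y + cusp_at D x y + (cusp_at C a c + cusp_at D a c)"
      using assms(1)[unfolded quasi_periodic_def, rule_format, OF *]
        assms(2)[unfolded quasi_periodic_def, rule_format, OF *] by simp
  qed
qed

lemma quasi_periodic_shift:
  assumes C: "quasi_periodic N C"
  shows "C (x + 1) = C x"
proof -
  obtain a c where "quotient_of x = (a, c)" and x: "x = of_int a / of_int c" "c > 0" "coprime a c"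
    by (rule rat_lowest_terms[of x])
  have "cusp_at C (1 * a + 1 * c) (0 * a + 1 * c) = cusp_at C a c + cusp_at C 1 0"
    using C[unfolded quasi_periodic_def, rule_format, of 1 1 1 0 a c] x(3) by simp
  thus ?thesis using x by (simp add: cusp_at_def add_divide_distrib)
qed

text \<open>
  Reflection permutes the fractions \<open>(x + b)/p\<close> modulo 1.
\<close>
lemma hecke_cusps_reflect:
  assumes C: "quasi_periodic N C" and p: "p > 0"
  shows "hecke_cusps p (\<lambda>x. C (-x)) x = hecke_cusps p C (-x)"
proof -
  have "(\<Sum>b<p. C (- ((x + of_nat b) / of_nat p))) = (\<Sum>b<p. C ((- x + of_nat b) / of_nat p))"
  proof (rule sum.reindex_bij_witness[of _ "\<lambda>b. if b = 0 then 0 else p - b" "\<lambda>b. if b = 0 then 0 else p - b"])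
    fix b assume b: "b \<in> {..<p}"
    show "C ((- x + of_nat (if b = 0 then 0 else p - b)) / of_nat p) = C (- ((x + of_nat b) / of_nat p))"
    proof (cases "b = 0")
      case False
      have "(- x + of_nat (p - b)) / of_nat p = - ((x + of_nat b) / of_nat p) + 1"
        using b p by (simp add: of_nat_diff field_simps)
      thus ?thesis using False quasi_periodic_shift[OF C, of "- ((x + of_nat b) / of_nat p)"] by simp
    qed simp
  qed auto
  thus ?thesis by (simp add: hecke_cusps_def)
qed

lemma hecke_cusps_add: "hecke_cusps p (\<lambda>x. C x + D x) x = hecke_cusps p C x + hecke_cusps p D x"
  for C :: "rat \<Rightarrow> complex"
  by (simp add: hecke_cusps_def sum.distrib)

lemma denominator_dvd:
  assumes "m \<noteq> 0"
  shows "snd (quotient_of (of_int u / of_int m)) dvd m"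
proof -
  obtain a c where ac: "quotient_of (of_int u / of_int m) = (a, c)"
    and x: "of_int u / of_int m = (of_int a / of_int c :: rat)" "c > 0" "coprime a c"
    by (rule rat_lowest_terms[of "of_int u / of_int m"])
  have "(of_int (u * c) :: rat) = of_int (a * m)" using x(1,2) assms by (simp add: field_simps)
  hence "u * c = a * m" by (simp only: of_int_eq_iff)
  hence "c dvd a * m" by (metis dvd_triv_right)
  hence "c dvd m" using x(3) by (simp add: coprime_commute coprime_dvd_mult_right_iff)
  thus ?thesis by (simp add: ac)
qed

context prime_level
begin

text \<open>
  All the fractions in \<open>T\<^sub>p\<close> at \<open>1/t\<close> and at 0 have denominators prime to \<open>N\<close>, where the function
  integrated from the symbol differs from \<open>C\<close> by a constant.
\<close>
lemma hecke_sym_symbol_of: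
  assumes C: "quasi_periodic N C" and even: "\<And>x. C (-x) = C x"
    and eigen: "\<And>x. l * C x = hecke_cusps p C x" and p: "p > 0" "\<not> int N dvd int p" and t: "\<not> int N dvd t"
  shows "hecke_sym p (symbol_of C) t = l * symbol_of C t"
proof -
  let ?D = "cusp_fn (symbol_of C)"
  have M: "manin (symbol_of C)" by (rule manin_symbol_of[OF C even])
  have D: "?D (of_int u / of_int m) = C (of_int u / of_int m) - C 0" if "\<not> int N dvd m" for u m
  proof -
    have "m \<noteq> 0" using that by auto
    hence "\<not> int N dvd snd (quotient_of (of_int u / of_int m))"
      using denominator_dvd[of m u] that dvd_trans by blast
    thus ?thesis using cusp_fn_symbol_of[OF C even] by simp
  qed
  have H: "hecke_cusps p ?D (of_int u / of_int m) = hecke_cusps p C (of_int u / of_int m) - of_nat (p + 1) * C 0"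
    if m: "\<not> int N dvd m" for u m
  proof -
    have m0: "m \<noteq> 0" using m by auto
    have "of_nat p * (of_int u / of_int m) = (of_int (int p * u) / of_int m :: rat)" by simp
    hence 1: "?D (of_nat p * (of_int u / of_int m)) = C (of_nat p * (of_int u / of_int m)) - C 0"
      using D[OF m] by metis
    have 2: "?D ((of_int u / of_int m + of_nat b) / of_nat p) = C ((of_int u / of_int m + of_nat b) / of_nat p) - C 0" for b
    proof -
      have "(of_int u / of_int m + of_nat b) / of_nat p = (of_int (u + int b * m) / of_int (m * int p) :: rat)"
        using m0 p(1) by (simp add: field_simps)
      moreover have "\<not> int N dvd m * int p" using m p by (simp add: prime_dvd_mult_N)
      ultimately show ?thesis using D by metis
    qed
    show ?thesis unfolding hecke_cusps_def 1 2 by (simp add: sum_subtractf algebra_simps)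
  qed
  have e1: "hecke_cusps p ?D (1 / of_int t) = l * C (1 / of_int t) - of_nat (p + 1) * C 0"
    using H[OF t, of 1] eigen by simp
  have e2: "hecke_cusps p ?D 0 = l * C 0 - of_nat (p + 1) * C 0"
    using H[OF not_dvd_1(1), of 0] eigen by simp
  show ?thesis
    unfolding hecke_sym_def proj_manin[OF M] e1 e2 using t by (simp add: symbol_of_def algebra_simps)
qed

lemma cusp_fn_zero: "cusp_fn (\<lambda>_. 0 :: 'a :: comm_ring_1) x = 0"
  using cusp_fn_sum[of "\<lambda>_. 0 :: 'a" "\<lambda>_ _. 0" "{} :: nat set" x] by simp

lemma hecke_sym_path_sym:
  assumes "v \<in> reps"
  shows "hecke_sym p (\<lambda>t. of_int (path_sym v t) :: complex) t = of_int (path_sym v t)"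
proof -
  have "proj (\<lambda>t. of_int (path_sym v t)) = (\<lambda>t. 0 :: complex)"
    by (intro ext proj_path_sym assms)
  thus ?thesis by (simp add: hecke_sym_def hecke_cusps_def cusp_fn_zero)
qed

end

lemma ex_primitive_root_level:
  assumes "prime N" "N = 12 * n + 1" "N > 3"
  shows "\<exists>w. primitive_root_level N n w"
proof -
  obtain w where w: "residue_primroot N w" using prime_primitive_root_exists[of N] assms by auto
  have tot: "totient N = 12 * n" using totient_prime[OF assms(1)] assms(2) by simp
  have ord: "ord N w = 12 * n" and cop: "coprime N w" using w tot by (auto simp: residue_primroot_def)
  show ?thesis
  proof (intro exI[of _ w], unfold_locales)
    show "prime N" "N > 3" "N = 12 * n + 1" by fact+
    show "[int w ^ i = int w ^ j] (mod int N) \<longleftrightarrow> [i = j] (mod (12 * n))" for i j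
      using order_divides_expdiff[OF cop, of i j] unfolding ord by (simp add: cong_int_iff flip: of_nat_power)
    show "\<exists>j. [t = int w ^ j] (mod int N)" if t: "\<not> int N dvd t" for t
    proof -
      define s where "s = nat (t mod int N)"
      have "int s = t mod int N" using assms(3) by (simp add: s_def)
      hence st: "[t = int s] (mod int N)" by (simp only: cong_mod_right cong_refl)
      have nd: "\<not> N dvd s" using t cong_dvd_iff[OF st] by simp
      have "s < N" using assms(3) by (simp add: s_def nat_less_iff)
      moreover have "s > 0" using nd by (intro Nat.gr0I) simp
      moreover have "coprime s N" using prime_imp_coprime[OF assms(1) nd] by (simp add: coprime_commute)
      ultimately have "s \<in> totatives N" by (simp add: totatives_def)
      then obtain j where "s = w ^ j mod N"
        using residue_primroot_is_generator[OF _ w] assms(3) by (auto simp: bij_betw_def)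
      hence "[s = w ^ j] (mod N)" by (simp add: cong_def)
      hence "[int s = int w ^ j] (mod int N)" by (simp add: cong_int_iff flip: of_nat_power)
      with st show ?thesis by (metis cong_trans)
    qed
  qed
qed

section \<open>Divisibility of the product\<close>

theorem theorem1p2:
  fixes N n p :: nat and f :: "nat \<Rightarrow> complex \<Rightarrow> complex"
  assumes "prime N" and "12 dvd N - 1" and "n = (N - 1) div 12"
    and eigenforms: "\<And>i. i \<in> {1..n - 1} \<Longrightarrow> normalized_hecke_eigenform 2 N (f i)"
    and basis: "inj_on f {1..n - 1}" "cfun.independent (f ` {1..n - 1})"
      "cfun.span (f ` {1..n - 1}) = cusp_forms 2 N"
    and "prime p" and "p \<noteq> N" and "n dvd 1 + p"
  shows "\<exists>\<mu> :: int. (\<Prod>i = 1..n - 1. fourier_coeff (f i) p) = of_int \<mu> \<and> int n dvd \<mu>"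
proof -
  have N_eq: "N = 12 * n + 1" using assms(2,3) prime_gt_1_nat[OF assms(1)] by auto
  have n0: "n > 0" using N_eq prime_gt_1_nat[OF assms(1)] by (intro Nat.gr0I) auto
  have N3: "N > 3" using N_eq n0 by simp
  have N0: "N > 0" using N3 by simp
  obtain w where "primitive_root_level N n w" using ex_primitive_root_level[OF assms(1) N_eq N3] ..
  then interpret primitive_root_level N n w .
  have cop: "coprime p N" using assms(1,8,9) by (simp add: primes_coprime)
  have p0: "p > 0" using assms(8) by (simp add: prime_gt_0_nat)
  have np: "\<not> int N dvd int p" by (rule other_prime_not_dvd[OF assms(8,9)])

  have "\<forall>i. i \<in> {1..n-1} \<longrightarrow> (\<exists>F. cusp_primitive N F \<and> (\<forall>z\<in>\<H>. (F has_field_derivative f i z) (at z)))"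
  proof (intro allI impI)
    fix i assume "i \<in> {1..n-1}"
    hence "f i \<in> cusp_forms 2 N"
      using eigenforms by (simp add: normalized_hecke_eigenform_def hecke_eigenform_def)
    then obtain F where "cusp_primitive N F" "\<And>z. z \<in> \<H> \<Longrightarrow> (F has_field_derivative f i z) (at z)"
      using ex_cusp_primitive[OF _ N0] by metis
    thus "\<exists>F. cusp_primitive N F \<and> (\<forall>z\<in>\<H>. (F has_field_derivative f i z) (at z))" by blast
  qed
  then obtain F where F_all: "\<forall>i. i \<in> {1..n-1} \<longrightarrow> cusp_primitive N (F i) \<and> (\<forall>z\<in>\<H>. (F i has_field_derivative f i z) (at z))"
    by (subst (asm) choice_iff') blast
  have F: "cusp_primitive N (F i)" and F': "\<And>z. z \<in> \<H> \<Longrightarrow> (F i has_field_derivative f i z) (at z)"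
    if "i \<in> {1..n-1}" for i using F_all that by simp_all

  define C where "C = (\<lambda>i x. boundary_value (F i) x + boundary_value (F i) (-x))"
  define a where "a = (\<lambda>i. fourier_coeff (f i) p)"
  define L where "L = (\<lambda>i. symbol_of (C i))"
  have C_even: "C i (-x) = C i x" for i x by (simp add: C_def)
  have C: "quasi_periodic N (C i)" if i: "i \<in> {1..n-1}" for i
    unfolding C_def using quasi_periodic_boundary_value[OF N0 F[OF i]]
    by (intro quasi_periodic_add quasi_periodic_reflect)
  have C_eigen: "a i * C i x = hecke_cusps p (C i) x" if i: "i \<in> {1..n-1}" for i x
  proof -
    have "hecke 2 N p (f i) = fun_scale (a i) (f i)"
      unfolding a_def by (rule normalized_hecke_eigenvalue[OF eigenforms[OF i] N0 assms(8) cop])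
    hence "a i * F i z = F i (of_nat p * z) + (\<Sum>b<p. F i ((z + of_nat b) / of_nat p))" if "z \<in> \<H>" for z
      using primitive_hecke[OF N0 assms(8) cop F[OF i] F'[OF i]] that by blast
    note bv = boundary_value_hecke[OF N0 p0 F[OF i] this]
    show ?thesis
      unfolding C_def hecke_cusps_add hecke_cusps_reflect[OF quasi_periodic_boundary_value[OF N0 F[OF i]] p0]
      by (simp add: distrib_left bv)
  qed
  have L: "manin (L i)" if i: "i \<in> {1..n-1}" for i
    unfolding L_def by (rule manin_symbol_of[OF C[OF i] C_even])
  have L_eigen: "hecke_sym p (L i) t = a i * L i t" if "i \<in> {1..n-1}" "\<not> int N dvd t" for i t
    unfolding L_def by (rule hecke_sym_symbol_of[OF C[OF that(1)] C_even C_eigen[OF that(1)] p0 np that(2)])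

  have L_indep: "x i = 0"
    if zero: "\<And>t. (\<Sum>i\<in>{1..n-1}. x i * L i t) = 0" and i: "i \<in> {1..n-1}" for x i
  proof -
    \<comment> \<open>A relation among the symbols says that \<open>G\<close> has vanishing even periods, hence is 0.\<close>
    define G where "G = (\<lambda>z. \<Sum>i\<in>{1..n-1}. x i * F i z)"
    have G: "cusp_primitive N G" unfolding G_def by (intro cusp_primitive_sum F)
    have bvG: "boundary_value G x' + boundary_value G (-x') = (\<Sum>i\<in>{1..n-1}. x i * C i x')" for x'
    proof -
      have "boundary_value G x' = (\<Sum>i\<in>{1..n-1}. x i * boundary_value (F i) x')" for x'
        unfolding G_def by (rule boundary_value_sum[OF N0 F])
      thus ?thesis by (simp add: C_def sum.distrib distrib_left)
    qed
    have sumC: "(\<Sum>i\<in>{1..n-1}. x i * C i x') = 0" if den: "int N dvd snd (quotient_of x')" for x'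
    proof -
      have "(\<Sum>i\<in>{1..n-1}. x i * C i x') = (\<Sum>i\<in>{1..n-1}. x i * cusp_fn (L i) x')"
        using den cusp_fn_symbol_of[OF C C_even] by (intro sum.cong) (auto simp: L_def)
      also have "\<dots> = cusp_fn (\<lambda>t. \<Sum>i\<in>{1..n-1}. x i * L i t) x'" by (rule cusp_fn_sum[symmetric])
      also have "\<dots> = 0" by (simp only: zero cusp_fn_zero)
      finally show ?thesis .
    qed
    have G0: "G z = 0" if "z \<in> \<H>" for z
    proof (rule even_boundary_value_zero[OF N0 G _ that])
      fix a b c d :: int assume det: "a * d - b * c = 1" and dvd: "int N dvd c"
      show "cusp_at (boundary_value G) a c + cusp_at (boundary_value G) a (- c) = 0"
      proof (cases "c = 0")
        case False
        have den: "int N dvd snd (quotient_of (of_int a / of_int c))"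
        proof (cases "c > 0")
          case True
          thus ?thesis using quotient_of_coprime_frac[OF det_imp_coprime(1)[OF det]] dvd by simp
        next
          case neg: False
          have "quotient_of (of_int (-a) / of_int (-c)) = (-a, -c)"
            using det_imp_coprime(1)[OF det] neg False by (intro quotient_of_coprime_frac) auto
          thus ?thesis using dvd by simp
        qed
        show ?thesis using bvG[of "of_int a / of_int c"] sumC[OF den] False by (simp add: cusp_at_def)
      qed (simp add: cusp_at_def)
    qed
    have fsum: "(\<Sum>i\<in>{1..n-1}. x i * f i z) = 0" for z
    proof (cases "z \<in> \<H>")
      case True
      have "(G has_field_derivative (\<Sum>i\<in>{1..n-1}. x i * f i z)) (at z)"
        unfolding G_def by (intro DERIV_sum DERIV_cmult F' True)
      moreover have "(G has_field_derivative 0) (at z)"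
        by (rule has_field_derivative_transform_within_open[OF DERIV_const open_uhp True]) (simp add: G0)
      ultimately show ?thesis by (rule DERIV_unique)
    next
      case False
      have "f i z = 0" if "i \<in> {1..n-1}" for i
        using eigenforms[OF that] False
        by (simp add: normalized_hecke_eigenform_def hecke_eigenform_def cusp_forms_def)
      thus ?thesis by simp
    qed
    have rel: "(\<Sum>g\<in>f ` {1..n-1}. fun_scale (x (inv_into {1..n-1} f g)) g) = 0"
    proof -
      have "(\<Sum>g\<in>f ` {1..n-1}. fun_scale (x (inv_into {1..n-1} f g)) g) = (\<Sum>i\<in>{1..n-1}. fun_scale (x i) (f i))"
        using basis(1) by (subst sum.reindex) auto
      also have "\<dots> = 0"
      proof
        fix z
        have "sum g I z = (\<Sum>i\<in>I. g i z)" for g :: "nat \<Rightarrow> complex \<Rightarrow> complex" and I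
          by (induction I rule: infinite_finite_induct) auto
        thus "(\<Sum>i\<in>{1..n-1}. fun_scale (x i) (f i)) z = 0 z"
          using fsum[of z] by (simp add: fun_scale_def)
      qed
      finally show ?thesis .
    qed
    have "x (inv_into {1..n-1} f (f i)) = 0"
      by (rule cfun.independentD[OF basis(2) _ subset_refl rel]) (use i in auto)
    thus ?thesis using basis(1) i by simp
  qed

  \<comment> \<open>The size of the matrix. Rows are indexed via \<open>\<kappa>\<close> by exponents of \<open>w\<close>; the first \<open>n - 1\<close> columns belong to eigenforms, the others via \<open>v\<close> to representatives of generic orbits.\<close>
  define r where "r = 3 * n - 2"
  obtain \<kappa> where \<kappa>: "bij_betw \<kappa> {..<r} idx"
    using ex_bij_betw_nat_finite[OF finite_idx] card_idx by (auto simp: r_def lessThan_atLeast0)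
  obtain R where R: "R \<subseteq> reps" "card R = 2 * n - 1"
  proof -
    have "2 * n - 1 \<le> card reps" using card_reps N_eq by simp
    thus ?thesis using that by (rule obtain_subset_with_card_n)
  qed
  have finR: "finite R" using R(1) finite_reps finite_subset by blast
  obtain \<sigma> where \<sigma>: "bij_betw \<sigma> {..<2 * n - 1} R"
    using ex_bij_betw_nat_finite[OF finR] R(2) by (auto simp: lessThan_atLeast0)
  define v where "v = (\<lambda>j. \<sigma> (j - (n - 1)))"
  have v: "v j \<in> reps" if "n - 1 \<le> j" "j < r" for j
  proof -
    have "j - (n - 1) < 2 * n - 1" using that n0 by (simp add: r_def)
    hence "v j \<in> R" using bij_betwE[OF \<sigma>] by (simp add: v_def)
    thus ?thesis using R(1) by blast
  qed
  have v_inj: "v i = v j \<longleftrightarrow> i = j" if "n - 1 \<le> i" "i < r" "n - 1 \<le> j" "j < r" for i j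
  proof -
    have "i - (n - 1) \<in> {..<2 * n - 1}" "j - (n - 1) \<in> {..<2 * n - 1}" using that n0 by (auto simp: r_def)
    hence "v i = v j \<longleftrightarrow> i - (n - 1) = j - (n - 1)"
      unfolding v_def by (rule inj_on_eq_iff[OF bij_betw_imp_inj_on[OF \<sigma>]])
    thus ?thesis using that by auto
  qed
  define b where "b = (\<lambda>j. if j < n - 1 then L (Suc j) else (\<lambda>t. of_int (path_sym (v j) t)))"
  define d where "d = (\<lambda>j. if j < n - 1 then a (Suc j) else 1)"
  have b_sym: "symbol_fn (b j)" and b_van: "vanishes_at_cube_roots (b j)" if "j < r" for j
  proof -
    have "symbol_fn (b j) \<and> vanishes_at_cube_roots (b j)"
    proof (cases "j < n - 1")
      case True
      hence "manin (L (Suc j))" by (intro L) auto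
      thus ?thesis using True manin_vanishes[of "L (Suc j)"] by (auto simp: b_def manin_def)
    next
      case False
      hence vj: "v j \<in> reps" using v that by simp
      hence "vanishes_at_cube_roots (path_sym (v j))" using path_sym_vanishes reps(1) by blast
      hence "vanishes_at_cube_roots (\<lambda>t. of_int (path_sym (v j) t) :: complex)"
        by (simp add: vanishes_at_cube_roots_def)
      moreover have "symbol_fn (\<lambda>t. of_int (path_sym (v j) t) :: complex)"
        using reps_range[OF vj] by (intro symbol_fn_of_int symbol_fn_path_sym) simp
      ultimately show ?thesis using False by (simp add: b_def)
    qed
    thus "symbol_fn (b j)" "vanishes_at_cube_roots (b j)" by simp_all
  qed
  have reindex: "(\<Sum>l<r. h (\<kappa> l)) = (\<Sum>k\<in>idx. h k)" for h :: "nat \<Rightarrow> 'x::comm_monoid_add"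
    by (rule sum.reindex_bij_betw[OF \<kappa>])
  define X where "X = (\<lambda>i l. hecke_sym p (coord (\<kappa> l)) (int w ^ \<kappa> i))"
  have apply_X: "(\<Sum>l<r. of_int (X i l) * y (int w ^ \<kappa> l)) = hecke_sym p y (int w ^ \<kappa> i)"
    if y: "symbol_fn y" "vanishes_at_cube_roots y" for y :: "int \<Rightarrow> 'y::{idom, ring_char_0}" and i
  proof -
    have "y = (\<lambda>t. \<Sum>k\<in>idx. y (int w ^ k) * of_int (coord k t))"
      by (rule ext) (rule symbol_fn_expansion[OF y])
    hence "hecke_sym p y (int w ^ \<kappa> i) = hecke_sym p (\<lambda>t. \<Sum>k\<in>idx. y (int w ^ k) * of_int (coord k t)) (int w ^ \<kappa> i)"
      by simp
    also have "\<dots> = (\<Sum>k\<in>idx. y (int w ^ k) * of_int (hecke_sym p (coord k) (int w ^ \<kappa> i)))"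
      unfolding hecke_sym_sum hecke_sym_of_int ..
    also have "\<dots> = (\<Sum>l<r. of_int (X i l) * y (int w ^ \<kappa> l))"
      unfolding X_def by (subst reindex[symmetric]) (simp add: mult.commute)
    finally show ?thesis ..
  qed

  have "\<exists>\<mu>. (\<Prod>j<r. d j) = of_int \<mu> \<and> (\<forall>i<r. int n dvd \<mu> * log_lift (int w ^ \<kappa> i))"
  proof (rule det_eigenvalues_divisible[of r X "\<lambda>i j. b j (int w ^ \<kappa> i)"])
    fix i j assume ij: "i < r" "j < r"
    have "(\<Sum>l<r. of_int (X i l) * b j (int w ^ \<kappa> l)) = hecke_sym p (b j) (int w ^ \<kappa> i)"
      by (rule apply_X[OF b_sym[OF ij(2)] b_van[OF ij(2)]])
    also have "\<dots> = d j * b j (int w ^ \<kappa> i)"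
    proof (cases "j < n - 1")
      case True
      thus ?thesis unfolding b_def d_def using L_eigen[of "Suc j", OF _ pow_not_dvd] by simp
    next
      case False
      thus ?thesis unfolding b_def d_def using hecke_sym_path_sym[OF v[of j]] ij(2) by simp
    qed
    finally show "(\<Sum>l<r. of_int (X i l) * b j (int w ^ \<kappa> l)) = d j * b j (int w ^ \<kappa> i)" .
  next
    fix x j assume zero: "\<And>i. i < r \<Longrightarrow> (\<Sum>j<r. b j (int w ^ \<kappa> i) * x j) = 0" and j: "j < r"
    define y where "y = (\<lambda>t. \<Sum>j<r. x j * b j t)"
    have y_sym: "symbol_fn y" unfolding y_def by (intro symbol_fn_sum b_sym) simp
    have y_van: "vanishes_at_cube_roots y"
      using b_van unfolding y_def vanishes_at_cube_roots_def by (auto intro!: sum.neutral)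
    have "y (int w ^ k) = 0" if "k \<in> idx" for k
    proof -
      obtain i where "i < r" "k = \<kappa> i" using \<kappa> \<open>k \<in> idx\<close> by (auto simp: bij_betw_def)
      thus ?thesis using zero[of i] by (simp add: y_def mult.commute)
    qed
    hence y0: "y t = 0" for t using symbol_fn_expansion[OF y_sym y_van, of t] by simp
    \<comment> \<open>The defect at the orbit of \<open>v i\<close> isolates the coefficient of its path symbol.\<close>
    have path_zero: "x i = 0" if i: "n - 1 \<le> i" "i < r" for i
    proof -
      have "0 = tri y (int (v i))" by (simp add: tri_def y0)
      also have "\<dots> = (\<Sum>j<r. x j * tri (b j) (int (v i)))" unfolding y_def by (rule tri_sum)
      also have "\<dots> = (\<Sum>j<r. if j = i then x j else 0)"
      proof (rule sum.cong)
        fix j assume j: "j \<in> {..<r}"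
        show "x j * tri (b j) (int (v i)) = (if j = i then x j else 0)"
        proof (cases "j < n - 1")
          case True
          hence "manin (L (Suc j))" by (intro L) auto
          moreover have "\<not> int N dvd int (v i)"
            using reps_range[OF v[OF i]] by (intro not_dvd_small) auto
          ultimately show ?thesis using True i by (auto simp: b_def manin_def)
        next
          case False
          hence "tri (b j) (int (v i)) = of_int (tri (path_sym (v j)) (int (v i)))"
            by (simp add: b_def tri_of_int)
          also have "tri (path_sym (v j)) (int (v i)) = of_bool (v j = v i)"
            using False i j by (intro tri_path_sym_reps v) auto
          also have "v j = v i \<longleftrightarrow> j = i" using False i j by (intro v_inj) auto
          finally show ?thesis by simp
        qed
      qed simp
      also have "\<dots> = x i" using i by simp
      finally show ?thesis by simp
    qed
    have cusp_zero: "x i = 0" if i: "i < n - 1" for i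
    proof -
      have "(\<Sum>i\<in>{1..n-1}. x (i - 1) * L i t) = 0" for t
      proof -
        have "(\<Sum>i\<in>{1..n-1}. x (i - 1) * L i t) = (\<Sum>i<n-1. x i * L (Suc i) t)"
          by (rule sum.reindex_bij_witness[of _ Suc "\<lambda>i. i - 1"]) auto
        also have "\<dots> = (\<Sum>j<r. x j * b j t)"
          by (rule sum.mono_neutral_cong_left) (auto simp: r_def b_def path_zero)
        also have "\<dots> = 0" using y0[of t] by (simp add: y_def)
        finally show ?thesis .
      qed
      from L_indep[of "\<lambda>i. x (i - 1)" "Suc i", OF this] i show ?thesis by simp
    qed
    show "x j = 0" using path_zero cusp_zero j by (cases "j < n - 1") auto
  next
    fix i assume "i < r"
    have "(\<Sum>l<r. X i l * log_lift (int w ^ \<kappa> l)) = hecke_sym p log_lift (int w ^ \<kappa> i)"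
      using apply_X[of log_lift i] manin_log_lift manin_vanishes[OF manin_log_lift] by (simp add: manin_def)
    also have "int n dvd \<dots>"
      by (rule hecke_sym_log_lift[OF assms(8,9,10) pow_not_dvd])
    finally show "int n dvd (\<Sum>l<r. X i l * log_lift (int w ^ \<kappa> l))" .
  qed
  then obtain \<mu> where \<mu>: "(\<Prod>j<r. d j) = of_int \<mu>" "\<And>i. i < r \<Longrightarrow> int n dvd \<mu> * log_lift (int w ^ \<kappa> i)"
    by blast
  have "(\<Prod>j<r. d j) = (\<Prod>j<n-1. a (Suc j))"
    by (rule prod.mono_neutral_cong_right) (auto simp: d_def r_def)
  also have "\<dots> = (\<Prod>i = 1..n - 1. a i)"
    by (rule prod.reindex_bij_witness[of _ "\<lambda>i. i - 1" Suc]) auto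
  finally have prod: "(\<Prod>i = 1..n - 1. fourier_coeff (f i) p) = of_int \<mu>" using \<mu>(1) by (simp add: a_def)
  have "1 \<in> idx" using n0 by (auto simp: idx_def)
  hence "1 \<in> \<kappa> ` {..<r}" using bij_betw_imp_surj_on[OF \<kappa>] by simp
  then obtain i where i: "i < r" "\<kappa> i = 1" by auto
  \<comment> \<open>At the exponent 1 the vector is a unit modulo \<open>n\<close>.\<close>
  have "[ind (int w) = 1] (mod int n)" using ind_unique[of "int w" 1] by simp
  hence "[log_lift (int w) = 1] (mod int n)"
    using log_lift_cong[of "int w"] pow_not_dvd[of 1] by (metis cong_trans power_one_right)
  hence "[\<mu> * log_lift (int w) = \<mu> * 1] (mod int n)" by (intro cong_mult cong_refl)
  hence "int n dvd \<mu>" using \<mu>(2)[OF i(1)] i(2) by (simp add: cong_dvd_iff)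
  with prod show ?thesis by blast
qed

end
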